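(* Let $d\ge 2$, let $\Omega\subset\mathbb{R}^d$ be a polytopal domain, let $k\ge 0$ be an integer, and let $\theta\in(0,1)$, $\varrho>0$. There exists a constant $C>0$, depending only on $\Omega$, $\theta$, $\varrho$ and $k$, such that for every hybrid mesh $\mathcal{M}_h=(\mathcal{T}_h,\mathcal{F}_h)$ of $\Omega$ that is regular with parameter $\theta$ and quasi-uniform with parameter $\varrho$, there exists a linear operator $\mathcal{L}_h:U_h^{\partial,{\rm bd}}\to\underline{U}_h$ such that $$ |\mathcal{L}_h(w_h)|_{1,h}\le C\,|w_h|_{1/2,h}\quad\forall\,w_h\in U_h^{\partial,{\rm bd}},\qquad \gamma\circ\mathcal{L}_h=\mathrm{Id}_{U_h^{\partial,{\rm bd}}}. $$
   Context: Domain: a polytopal domain is a bounded connected open set whose boundary is polytopal and is locally the graph of a Lipschitz function ($\Omega$ lying locally on one side). Mesh: a hybrid mesh $\mathcal{M}_h=(\mathcal{T}_h,\mathcal{F}_h)$ of $\Omega$ consists of a finite set $\mathcal{T}_h$ of non-empty pairwise disjoint open polytopes (cells) whose closures cover $\overline\Omega$, and a finite set $\mathcal{F}_h$ of non-empty pairwise disjoint $(d-1)$-dimensional polytopes (faces), each one being a connected, relatively open subset of a hyperplane, such that: each face is either contained in $\partial\Omega$ and in the boundary of exactly one cell (boundary face), or contained in $\Omega$ and in the boundary of exactly two cells (interior face); and the boundary of each cell $t$ is the union of the closures of the faces in $\mathcal{F}_t=\{f\in\mathcal{F}_h: f\subset\partial t\}$. $\mathcal{F}_h^{\rm bd}$ is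 the set of boundary faces. $h_t,h_f$ are the diameters of a cell $t$, a face $f$, and $h=\max_{t\in\mathcal{T}_h}h_t$. Regularity with parameter $\theta$: there is a conforming simplicial mesh $\mathfrak{S}_h$ of $\Omega$ such that each simplex is contained in a unique cell of $\mathcal{T}_h$, each (relatively open) simplicial face is either contained in or disjoint from each given face of $\mathcal{F}_h$, each simplex $\tau$ has inradius at least $\theta h_\tau$ ($h_\tau$ its diameter), and $\theta h_t\le h_\tau$ whenever $\tau\subset t\in\mathcal{T}_h$. Quasi-uniformity with parameter $\varrho$: $h\le\varrho h_t$ for all $t\in\mathcal{T}_h$. Centroids: for each face $f$, $x_f\in f$ is an arbitrarily fixed point such that $f$ contains the ($(d-1)$-dimensional) ball centred at $x_f$ of radius $\varpi h_f$, where $\varpi>0$ depends only on $\theta$. Spaces: $\mathbb{P}_k(X)$ denotes polynomials of total degree at most $k$ on $X$. $\underline{U}_h=\prod_{t\in\mathcal{T}_h}\mathbb{P}_k(t)\times\prod_{f\in\mathcal{F}_h}\mathbb{P}_k(f)$, with elements $\underline{v}_h=((v_t)_{t},(v_f)_{f})$; $U_h^{\partial,{\rm bd}}=\prod_{f\in\mathcal{F}_h^{\rm bd}}\mathbb{P}_k(f)$. Trace: $\gamma:\underline{U}_h\to U_h^{\partial,{\rm bd}}$, $\gamma(\underline{v}_h)=(v_f)_{f\in\mathcal{F}_h^{\rm bd}}$. Seminorms: $$|\underline{v}_h|_{1,h}^2=\sum_{t\in\mathcal{T}_h}\Big(\|\nabla v_t\|_{L^2(t)}^2+\sum_{f\in\mathcal{F}_t}h_t^{-1}\|v_f-v_t\|_{L^2(f)}^2\Big),$$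 $$|w_h|_{1/2,h}^2=\sum_{f\in\mathcal{F}_h^{\rm bd}}h_f^{-1}\|w_f-\overline{w}_f\|_{L^2(f)}^2+\sum_{f,f'\in\mathcal{F}_h^{\rm bd},\,f\ne f'}|f|_{d-1}|f'|_{d-1}\frac{|\overline{w}_f-\overline{w}_{f'}|^2}{|x_f-x_{f'}|^d},$$ where the last sum is over ordered pairs, $|\cdot|_{d-1}$ is the $(d-1)$-dimensional measure and $\overline{w}_f$ is the average of $w_f$ over $f$. *)

theory Defs
  imports "HOL-Analysis.Analysis"
begin

subsection \<open>Polytopal sets, domains and hybrid meshes\<close>

text \<open>
  Open polytopes are in general not convex, so the library's \<^const>\<open>polytope\<close> does not apply.
  An \<open>m\<close>-dimensional open polytope is the interior, relative to an \<open>m\<close>-dimensional affine space,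
  of a finite union of \<open>m\<close>-simplices lying in that space.  For \<open>m = DIM('a)\<close> the relative interior
  is the topological interior.
\<close>
definition open_polytope :: "nat \<Rightarrow> 'a::euclidean_space set \<Rightarrow> bool" where
  "open_polytope m X \<longleftrightarrow>
     (\<exists>\<S>. finite \<S> \<and> (\<forall>S\<in>\<S>. int m simplex S) \<and> aff_dim (\<Union>\<S>) = int m \<and> X = rel_interior (\<Union>\<S>))"

text \<open>
  In the direction of the unit vector \<open>n\<close>, and writing \<open>y - (n \<bullet> y) n\<close> for the projection of \<open>y\<close> on
  the hyperplane orthogonal to \<open>n\<close>, the boundary is the graph of \<open>\<phi>\<close> and \<open>\<Omega>\<close> lies below it.
\<close>
definition lipschitz_boundary :: "'a::euclidean_space set \<Rightarrow> bool" where
  "lipschitz_boundary \<Omega> \<longleftrightarrow>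
     (\<forall>p\<in>frontier \<Omega>. \<exists>U n \<phi> L. open U \<and> p \<in> U \<and> norm n = 1 \<and> L-lipschitz_on {y. n \<bullet> y = 0} \<phi> \<and>
        frontier \<Omega> \<inter> U = {y\<in>U. n \<bullet> y = \<phi> (y - (n \<bullet> y) *\<^sub>R n)} \<and>
        \<Omega> \<inter> U = {y\<in>U. n \<bullet> y < \<phi> (y - (n \<bullet> y) *\<^sub>R n)})"

definition polytopal_domain :: "'a::euclidean_space set \<Rightarrow> bool" where
  "polytopal_domain \<Omega> \<longleftrightarrow>
     bounded \<Omega> \<and> connected \<Omega> \<and> open \<Omega> \<and>
     (\<exists>\<S>. finite \<S> \<and> (\<forall>S\<in>\<S>. int (DIM('a) - 1) simplex S) \<and> frontier \<Omega> = \<Union>\<S>) \<and>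
     lipschitz_boundary \<Omega>"

definition cell_faces :: "'a::euclidean_space set set \<Rightarrow> 'a set \<Rightarrow> 'a set set" where
  "cell_faces \<F> t = {f\<in>\<F>. f \<subseteq> frontier t}"

definition boundary_faces :: "'a::euclidean_space set \<Rightarrow> 'a set set \<Rightarrow> 'a set set" where
  "boundary_faces \<Omega> \<F> = {f\<in>\<F>. f \<subseteq> frontier \<Omega>}"

definition hybrid_mesh ::
    "'a::euclidean_space set \<Rightarrow> 'a set set \<Rightarrow> 'a set set \<Rightarrow> bool" where
  "hybrid_mesh \<Omega> \<T> \<F> \<longleftrightarrow>
     finite \<T> \<and> (\<forall>t\<in>\<T>. t \<noteq> {} \<and> open_polytope DIM('a) t) \<and> pairwise disjnt \<T> \<and>
     (\<Union>t\<in>\<T>. closure t) = closure \<Omega> \<and>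
     finite \<F> \<and> (\<forall>f\<in>\<F>. f \<noteq> {} \<and> connected f \<and> open_polytope (DIM('a) - 1) f) \<and> pairwise disjnt \<F> \<and>
     (\<forall>f\<in>\<F>. (f \<subseteq> frontier \<Omega> \<and> card {t\<in>\<T>. f \<subseteq> frontier t} = 1) \<or>
              (f \<subseteq> \<Omega> \<and> card {t\<in>\<T>. f \<subseteq> frontier t} = 2)) \<and>
     (\<forall>t\<in>\<T>. frontier t = (\<Union>f\<in>cell_faces \<F> t. closure f))"

definition mesh_size :: "'a::euclidean_space set set \<Rightarrow> real" where
  "mesh_size \<T> = Max (diameter ` \<T>)"

definition inradius :: "'a::euclidean_space set \<Rightarrow> real" where
  "inradius S = Sup {r. 0 \<le> r \<and> (\<exists>x. ball x r \<subseteq> S)}"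

definition conforming_simplicial_mesh :: "'a::euclidean_space set \<Rightarrow> 'a set set \<Rightarrow> bool" where
  "conforming_simplicial_mesh \<Omega> \<SS> \<longleftrightarrow>
     triangulation \<SS> \<and> (\<forall>\<tau>\<in>\<SS>. int DIM('a) simplex \<tau>) \<and> \<Union>\<SS> = closure \<Omega>"

text \<open>
  The simplices of a \<^const>\<open>triangulation\<close> are closed, whereas cells and faces are (relatively) open;
  inclusions and disjointness are therefore stated for the (relative) interiors.
\<close>
definition regular_mesh ::
    "real \<Rightarrow> 'a::euclidean_space set \<Rightarrow> 'a set set \<Rightarrow> 'a set set \<Rightarrow> bool" where
  "regular_mesh \<theta> \<Omega> \<T> \<F> \<longleftrightarrow>
     (\<exists>\<SS>. conforming_simplicial_mesh \<Omega> \<SS> \<and>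
        (\<forall>\<tau>\<in>\<SS>. \<exists>!t. t \<in> \<T> \<and> interior \<tau> \<subseteq> t) \<and>
        (\<forall>\<tau>\<in>\<SS>. \<forall>\<sigma>. \<sigma> facet_of \<tau> \<longrightarrow>
           (\<forall>f\<in>\<F>. rel_interior \<sigma> \<subseteq> f \<or> disjnt (rel_interior \<sigma>) f)) \<and>
        (\<forall>\<tau>\<in>\<SS>. \<theta> * diameter \<tau> \<le> inradius \<tau>) \<and>
        (\<forall>\<tau>\<in>\<SS>. \<forall>t\<in>\<T>. interior \<tau> \<subseteq> t \<longrightarrow> \<theta> * diameter t \<le> diameter \<tau>))"

definition quasi_uniform :: "real \<Rightarrow> 'a::euclidean_space set set \<Rightarrow> bool" where
  "quasi_uniform \<rho> \<T> \<longleftrightarrow> (\<forall>t\<in>\<T>. mesh_size \<T> \<le> \<rho> * diameter t)"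

definition face_centroids ::
    "real \<Rightarrow> 'a::euclidean_space set set \<Rightarrow> ('a set \<Rightarrow> 'a) \<Rightarrow> bool" where
  "face_centroids \<delta> \<F> x \<longleftrightarrow>
     (\<forall>f\<in>\<F>. x f \<in> f \<and> ball (x f) (\<delta> * diameter f) \<inter> affine hull f \<subseteq> f)"


subsection \<open>Lebesgue measure on affine subspaces\<close>

text \<open>
  The Lebesgue measure of the affine space \<open>A\<close>, as a measure on the ambient space: the image of the
  product Lebesgue measure under orthonormal affine coordinates.  This follows the definition of
  \<^const>\<open>lborel\<close> and does not depend on the chosen origin \<open>p\<close> and orthonormal basis \<open>B\<close>.
\<close>
definition affine_lborel :: "'a::euclidean_space set \<Rightarrow> 'a measure" where
  "affine_lborel A =
     (let p = (SOME p. p \<in> A);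
          B = (SOME B. pairwise orthogonal B \<and> (\<forall>b\<in>B. norm b = 1) \<and> span B = (\<lambda>x. x - p) ` A)
      in distr (Pi\<^sub>M B (\<lambda>_. lborel)) borel (\<lambda>c. p + (\<Sum>b\<in>B. c b *\<^sub>R b)))"

definition face_integral :: "'a::euclidean_space set \<Rightarrow> ('a \<Rightarrow> real) \<Rightarrow> real" where
  "face_integral f g = set_lebesgue_integral (affine_lborel (affine hull f)) f g"

definition face_measure :: "'a::euclidean_space set \<Rightarrow> real" where
  "face_measure f = measure (affine_lborel (affine hull f)) f"

definition face_average :: "'a::euclidean_space set \<Rightarrow> ('a \<Rightarrow> real) \<Rightarrow> real" where
  "face_average f g = face_integral f g / face_measure f"


subsection \<open>Discrete spaces\<close>

definition polynomials :: "nat \<Rightarrow> ('a::euclidean_space \<Rightarrow> real) set" where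
  "polynomials k =
     {p. \<exists>c. p = (\<lambda>x. \<Sum>\<alpha>\<in>{\<alpha> \<in> Basis \<rightarrow>\<^sub>E {..k}. (\<Sum>b\<in>Basis. \<alpha> b) \<le> k}.
                     c \<alpha> * (\<Prod>b\<in>Basis. (x \<bullet> b) ^ \<alpha> b))}"

text \<open>
  A polynomial on \<open>X\<close> is represented by its values on the closure of \<open>X\<close>, extended by zero.  The values
  on the closure are determined by those on \<open>X\<close>, and they make the trace of a cell polynomial on the
  faces of that (open) cell available without a separate trace operator.
\<close>
definition polynomials_on :: "nat \<Rightarrow> 'a::euclidean_space set \<Rightarrow> ('a \<Rightarrow> real) set" where
  "polynomials_on k X = {v. \<exists>p\<in>polynomials k. v = (\<lambda>x. if x \<in> closure X then p x else 0)}"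

text \<open>
  The Cartesian product of the spaces \<open>polynomials_on k X\<close> for \<open>X \<in> I\<close>; components outside the index
  set are zero, so that equality in the product is equality of functions.
\<close>
definition polynomial_product ::
    "nat \<Rightarrow> 'a::euclidean_space set set \<Rightarrow> ('a set \<Rightarrow> 'a \<Rightarrow> real) set" where
  "polynomial_product k I =
     {v. (\<forall>X\<in>I. v X \<in> polynomials_on k X) \<and> (\<forall>X. X \<notin> I \<longrightarrow> v X = (\<lambda>_. 0))}"

definition hybrid_space ::
    "nat \<Rightarrow> 'a::euclidean_space set set \<Rightarrow> 'a set set \<Rightarrow>
     (('a set \<Rightarrow> 'a \<Rightarrow> real) \<times> ('a set \<Rightarrow> 'a \<Rightarrow> real)) set" where
  "hybrid_space k \<T> \<F> = polynomial_product k \<T> \<times> polynomial_product k \<F>"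

definition boundary_space ::
    "nat \<Rightarrow> 'a::euclidean_space set \<Rightarrow> 'a set set \<Rightarrow> ('a set \<Rightarrow> 'a \<Rightarrow> real) set" where
  "boundary_space k \<Omega> \<F> = polynomial_product k (boundary_faces \<Omega> \<F>)"

definition boundary_trace ::
    "'a::euclidean_space set \<Rightarrow> 'a set set \<Rightarrow>
     ('a set \<Rightarrow> 'a \<Rightarrow> real) \<times> ('a set \<Rightarrow> 'a \<Rightarrow> real) \<Rightarrow> 'a set \<Rightarrow> 'a \<Rightarrow> real" where
  "boundary_trace \<Omega> \<F> v = (\<lambda>f. if f \<in> boundary_faces \<Omega> \<F> then snd v f else (\<lambda>_. 0))"

definition lin_comb ::
    "real \<Rightarrow> ('a set \<Rightarrow> 'a \<Rightarrow> real) \<Rightarrow> real \<Rightarrow> ('a set \<Rightarrow> 'a \<Rightarrow> real) \<Rightarrow> 'a set \<Rightarrow> 'a \<Rightarrow> real" where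
  "lin_comb a v b w = (\<lambda>X x. a * v X x + b * w X x)"

definition linear_operator_on ::
    "('a set \<Rightarrow> 'a \<Rightarrow> real) set \<Rightarrow>
     (('a set \<Rightarrow> 'a \<Rightarrow> real) \<times> ('a set \<Rightarrow> 'a \<Rightarrow> real)) set \<Rightarrow>
     (('a set \<Rightarrow> 'a \<Rightarrow> real) \<Rightarrow> ('a set \<Rightarrow> 'a \<Rightarrow> real) \<times> ('a set \<Rightarrow> 'a \<Rightarrow> real)) \<Rightarrow> bool" where
  "linear_operator_on U V L \<longleftrightarrow>
     (\<forall>w\<in>U. L w \<in> V) \<and>
     (\<forall>w\<in>U. \<forall>w'\<in>U. \<forall>a b.
        L (lin_comb a w b w') =
          (lin_comb a (fst (L w)) b (fst (L w')), lin_comb a (snd (L w)) b (snd (L w'))))"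


subsection \<open>Discrete seminorms\<close>

definition gradient :: "('a::euclidean_space \<Rightarrow> real) \<Rightarrow> 'a \<Rightarrow> 'a" where
  "gradient v x = (THE D. GDERIV v x :> D)"

definition seminorm_1h ::
    "'a::euclidean_space set set \<Rightarrow> 'a set set \<Rightarrow>
     ('a set \<Rightarrow> 'a \<Rightarrow> real) \<times> ('a set \<Rightarrow> 'a \<Rightarrow> real) \<Rightarrow> real" where
  "seminorm_1h \<T> \<F> v =
     sqrt (\<Sum>t\<in>\<T>. set_lebesgue_integral lborel t (\<lambda>x. (norm (gradient (fst v t) x))\<^sup>2) +
             (\<Sum>f\<in>cell_faces \<F> t.
                inverse (diameter t) * face_integral f (\<lambda>x. (snd v f x - fst v t x)\<^sup>2)))"

definition seminorm_half_h ::
    "'a::euclidean_space set \<Rightarrow> 'a set set \<Rightarrow> ('a set \<Rightarrow> 'a) \<Rightarrow>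
     ('a set \<Rightarrow> 'a \<Rightarrow> real) \<Rightarrow> real" where
  "seminorm_half_h \<Omega> \<F> x w =
     sqrt ((\<Sum>f\<in>boundary_faces \<Omega> \<F>.
              inverse (diameter f) * face_integral f (\<lambda>y. (w f y - face_average f (w f))\<^sup>2)) +
           (\<Sum>f\<in>boundary_faces \<Omega> \<F>. \<Sum>f'\<in>boundary_faces \<Omega> \<F> - {f}.
              face_measure f * face_measure f' *
                (\<bar>face_average f (w f) - face_average f' (w f')\<bar>\<^sup>2 / dist (x f) (x f') ^ DIM('a))))"

end

theory Submission
  imports Defs
begin

text \<open>
  The lifting is piecewise constant away from the boundary.  Write \<open>d\<close> for the dimension and let
  \<open>a\<^sub>f\<close> be the average of \<open>w\<^sub>f\<close> over a boundary face \<open>f\<close>.  Every cell \<open>t\<close> receives a constant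
  \<open>c\<^sub>t\<close> that depends linearly on the numbers \<open>a\<^sub>f\<close>, every interior face copies the constant of one of
  its two cells, and every boundary face keeps \<open>w\<^sub>f\<close>.  All gradients vanish, so only jumps are left to
  estimate.  On a boundary face \<open>w\<^sub>f - a\<^sub>f\<close> is orthogonal to constants, and so the jump splits into
  \<open>w\<^sub>f - a\<^sub>f\<close>, which the boundary seminorm contains, and the number \<open>a\<^sub>f - c\<^sub>t\<close>
  (lemmas \<open>face_integral_about_average\<close> and \<open>seminorm_constant_lifting_le\<close>).

  The problem has become discrete, and an averaging kernel solves it: \<open>c\<^sub>t\<close> is the mean of the \<open>a\<^sub>f\<close>
  with weights \<open>(\<bar>x\<^sub>t - x\<^sub>f\<bar> + h) ^ -(d + 1)\<close>, where \<open>x\<^sub>t\<close> is a point of \<open>t\<close>.  Let \<open>r\<^sub>t\<close> be \<open>h\<close> plus the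
  distance from \<open>x\<^sub>t\<close> to the nearest \<open>x\<^sub>f\<close>, and let \<open>p\<^sub>f(t)\<close> be the normalised weights.
  Between neighbouring cells a weight changes by a relative amount of order \<open>h / r\<^sub>t\<close>; since adding a
  constant to all \<open>a\<^sub>f\<close> does not affect the difference of two means, this gives
  \<open>\<bar>c\<^sub>t - c\<^sub>t'\<bar>\<^sup>2 \<le> C (h / r\<^sub>t)\<^sup>2 \<Sum> p\<^sub>f(t) p\<^sub>f'(t) \<bar>a\<^sub>f - a\<^sub>f'\<bar>\<^sup>2\<close>
  (lemmas \<open>weighted_mean_perturbation\<close> and \<open>extension_neighbour\<close>).
  The boundary is \<open>(d - 1)\<close>-dimensional: up to the scale of the domain, at least \<open>c (R / h) ^ (d - 1)\<close> of
  the points \<open>x\<^sub>f'\<close> lie within distance \<open>R + h\<close> of each \<open>x\<^sub>f\<close>.  Hence the total weight at \<open>t\<close> is at least of order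
  \<open>h ^ -(d - 1) r\<^sub>t ^ -2\<close> (lemma \<open>mass_ge\<close>).  The space is \<open>d\<close>-dimensional: a ball of radius \<open>R \<ge> h\<close> contains
  at most \<open>A (R / h) ^ d\<close> of the \<open>x\<^sub>t\<close>.  A sum over dyadic shells of cells then shows
  \<open>\<Sum>\<^sub>t (h / r\<^sub>t)\<^sup>2 p\<^sub>f(t) p\<^sub>f'(t) \<le> C h ^ d / \<bar>x\<^sub>f - x\<^sub>f'\<bar> ^ d\<close> (lemma \<open>interaction_le\<close>).  Because every face
  measure is comparable to \<open>h ^ (d - 1)\<close>, the right-hand side is, after scaling, the kernel of the
  boundary seminorm.

  The mesh enters through four facts.  Every cell contains a ball of radius \<open>\<beta> h\<close>, where \<open>\<beta>\<close> depends only on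
  \<open>\<theta>\<close> and \<open>\<rho>\<close>; every cell has boundedly many faces, because each of its faces contains the interior of a facet of a
  simplex of the cell; every face has a diameter of at least \<open>\<beta> h\<close>, because such a facet does; and the closures of
  the boundary faces cover the frontier of the domain, which as a finite union of \<open>(d - 1)\<close>-simplices
  contains well-separated points in the required number around each of its points.
\<close>

section \<open>Sums over dyadic shells\<close>


text \<open>
  A sum is controlled once it is split into levels whose contributions decay geometrically.
\<close>
lemma sum_le_geometric_levels:
  fixes g :: "'i \<Rightarrow> real" and J :: "'i \<Rightarrow> nat"
  assumes "finite T" and q: "0 \<le> q"
    and lev: "\<And>j. (\<Sum>t\<in>{t\<in>T. J t = j}. g t) \<le> q * (1/2) ^ j"
  shows "sum g T \<le> 2 * q"
proof -
  have "sum g T = (\<Sum>j\<in>J ` T. \<Sum>t\<in>{t\<in>T. J t = j}. g t)"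
    using sum.image_gen[OF \<open>finite T\<close>, of g J] .
  also have "\<dots> \<le> (\<Sum>j\<in>J ` T. q * (1/2) ^ j)" by (intro sum_mono lev)
  also have "\<dots> = q * (\<Sum>j\<in>J ` T. (1/2) ^ j)" by (simp add: sum_distrib_left)
  also have "\<dots> \<le> q * (\<Sum>j. (1/2) ^ j)"
    using \<open>finite T\<close> q by (intro mult_left_mono sum_le_suminf) (auto simp: summable_geometric)
  also have "\<dots> = 2 * q" by (simp add: suminf_geometric)
  finally show ?thesis .
qed

lemma dyadic_level:
  fixes u :: real
  assumes "1 \<le> u"
  shows "\<exists>j::nat. 2 ^ j \<le> u \<and> u \<le> 2 ^ Suc j"
proof -
  obtain n where "u < 2 ^ n" using real_arch_pow[of 2 u] by auto
  define n0 where "n0 = (LEAST n. u < 2 ^ n)"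
  have 1: "u < 2 ^ n0" unfolding n0_def by (rule LeastI) fact
  have "n0 \<noteq> 0" using 1 assms by (cases n0) auto
  then obtain j where j: "n0 = Suc j" by (cases n0) auto
  have "\<not> u < 2 ^ j" using not_less_Least[of j "\<lambda>n. u < 2 ^ n"] j n0_def by auto
  then show ?thesis using 1 j by (intro exI[of _ j]) auto
qed

text \<open>
  The indices with \<open>\<rho> t\<close> near \<open>D / 2 ^ j\<close> number at most \<open>B (D / 2 ^ j) ^ (m + 1)\<close>, and each contributes about
  \<open>(2 ^ j / D) ^ m\<close>.  The counting exponent exceeds the decay exponent by one, and so the shell at level \<open>j\<close>
  contributes in proportion to \<open>2 ^ -j\<close>: the largest shell dominates.
\<close>
lemma sum_inverse_power_near:
  fixes \<rho> :: "'i \<Rightarrow> real"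
  assumes "finite T" and pos: "\<And>t. t \<in> T \<Longrightarrow> 0 < \<rho> t" and D: "0 < D" and B: "0 \<le> B"
    and count: "\<And>R. 0 < R \<Longrightarrow> real (card {t\<in>T. \<rho> t \<le> R}) \<le> B * R ^ Suc m"
  shows "(\<Sum>t\<in>{t\<in>T. \<rho> t \<le> D}. 1 / \<rho> t ^ m) \<le> 2 * (2 ^ m * B * D)"
proof -
  have "\<forall>t\<in>{t\<in>T. \<rho> t \<le> D}. \<exists>j::nat. 2 ^ j \<le> D / \<rho> t \<and> D / \<rho> t \<le> 2 ^ Suc j"
    using pos by (intro ballI dyadic_level) (auto simp: field_simps)
  then obtain J where J: "\<And>t. t \<in> T \<Longrightarrow> \<rho> t \<le> D \<Longrightarrow> (2::real) ^ J t \<le> D / \<rho> t \<and> D / \<rho> t \<le> 2 ^ Suc (J t)"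
    by (metis (mono_tags, lifting) mem_Collect_eq)
  show ?thesis
  proof (rule sum_le_geometric_levels[where J = J])
    show "finite {t\<in>T. \<rho> t \<le> D}" using \<open>finite T\<close> by simp
    show "0 \<le> 2 ^ m * B * D" using B D by simp
    fix j
    let ?I = "{t \<in> {t\<in>T. \<rho> t \<le> D}. J t = j}"
    have "(\<Sum>t\<in>?I. 1 / \<rho> t ^ m) \<le> (\<Sum>t\<in>?I. (2 ^ Suc j / D) ^ m)"
    proof (rule sum_mono)
      fix t assume t: "t \<in> ?I"
      then have "1 / \<rho> t \<le> 2 ^ Suc j / D"
        using J[of t] pos[of t] D by (auto simp: field_simps simp del: power_Suc)
      then have "(1 / \<rho> t) ^ m \<le> (2 ^ Suc j / D) ^ m"
        using pos[of t] t by (intro power_mono) (auto simp: less_imp_le)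
      then show "1 / \<rho> t ^ m \<le> (2 ^ Suc j / D) ^ m" by (simp add: power_one_over)
    qed
    also have "\<dots> = real (card ?I) * (2 ^ Suc j / D) ^ m" by simp
    also have "\<dots> \<le> (B * (D / 2 ^ j) ^ Suc m) * (2 ^ Suc j / D) ^ m"
    proof (rule mult_right_mono)
      have "?I \<subseteq> {t\<in>T. \<rho> t \<le> D / 2 ^ j}"
      proof
        fix t assume t: "t \<in> ?I"
        then have "2 ^ j \<le> D / \<rho> t" using J[of t] by auto
        then show "t \<in> {t\<in>T. \<rho> t \<le> D / 2 ^ j}"
          using t pos[of t] by (auto simp: field_simps)
      qed
      then have "card ?I \<le> card {t\<in>T. \<rho> t \<le> D / 2 ^ j}"
        using \<open>finite T\<close> by (intro card_mono) auto
      also have "real \<dots> \<le> B * (D / 2 ^ j) ^ Suc m" using D by (intro count) auto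
      finally show "real (card ?I) \<le> B * (D / 2 ^ j) ^ Suc m" by simp
    qed (use D in simp)
    also have "\<dots> = 2 ^ m * B * D * (1/2) ^ j"
    proof -
      have "B * (D / x) ^ Suc m * (2 * x / D) ^ m = 2 ^ m * B * D * (1 / x)" if "0 < x" for x :: real
        using D that by (simp add: power_divide power_mult_distrib)
      from this[of "2 ^ j"] show ?thesis by (simp add: power_one_over)
    qed
    finally show "(\<Sum>t\<in>?I. 1 / \<rho> t ^ m) \<le> 2 ^ m * B * D * (1/2) ^ j" .
  qed
qed

text \<open>
  Outside the radius \<open>D\<close> the decay exponent \<open>2 (m + 1)\<close> is twice the counting exponent, so that now the
  smallest shell dominates.
\<close>
lemma sum_inverse_power_far:
  fixes \<rho> :: "'i \<Rightarrow> real"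
  assumes "finite T" and D: "0 < D" and B: "0 \<le> B"
    and count: "\<And>R. 0 < R \<Longrightarrow> real (card {t\<in>T. \<rho> t \<le> R}) \<le> B * R ^ Suc m"
  shows "(\<Sum>t\<in>{t\<in>T. D \<le> \<rho> t}. 1 / \<rho> t ^ (2 * Suc m)) \<le> 2 * (2 ^ Suc m * B / D ^ Suc m)"
proof -
  have "\<forall>t\<in>{t\<in>T. D \<le> \<rho> t}. \<exists>j::nat. 2 ^ j \<le> \<rho> t / D \<and> \<rho> t / D \<le> 2 ^ Suc j"
    using D by (intro ballI dyadic_level) (auto simp: field_simps)
  then obtain J where J: "\<And>t. t \<in> T \<Longrightarrow> D \<le> \<rho> t \<Longrightarrow> (2::real) ^ J t \<le> \<rho> t / D \<and> \<rho> t / D \<le> 2 ^ Suc (J t)"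
    by (metis (mono_tags, lifting) mem_Collect_eq)
  show ?thesis
  proof (rule sum_le_geometric_levels[where J = J])
    show "finite {t\<in>T. D \<le> \<rho> t}" using \<open>finite T\<close> by simp
    show "0 \<le> 2 ^ Suc m * B / D ^ Suc m" using B D by simp
    fix j
    let ?I = "{t \<in> {t\<in>T. D \<le> \<rho> t}. J t = j}"
    have "(\<Sum>t\<in>?I. 1 / \<rho> t ^ (2 * Suc m)) \<le> (\<Sum>t\<in>?I. 1 / (2 ^ j * D) ^ (2 * Suc m))"
    proof (rule sum_mono)
      fix t assume t: "t \<in> ?I"
      have "0 < \<rho> t" using t D by simp
      have "2 ^ j * D \<le> \<rho> t" using t J[of t] D by (auto simp: field_simps)
      then have "(2 ^ j * D) ^ (2 * Suc m) \<le> \<rho> t ^ (2 * Suc m)" using D by (intro power_mono) auto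
      then show "1 / \<rho> t ^ (2 * Suc m) \<le> 1 / (2 ^ j * D) ^ (2 * Suc m)"
        using D by (intro divide_left_mono mult_pos_pos) (simp_all add: \<open>0 < \<rho> t\<close>)
    qed
    also have "\<dots> = real (card ?I) * (1 / (2 ^ j * D) ^ (2 * Suc m))" by simp
    also have "\<dots> \<le> (B * (2 ^ Suc j * D) ^ Suc m) * (1 / (2 ^ j * D) ^ (2 * Suc m))"
    proof (rule mult_right_mono)
      have "?I \<subseteq> {t\<in>T. \<rho> t \<le> 2 ^ Suc j * D}"
        using J D by (fastforce simp: field_simps)
      then have "card ?I \<le> card {t\<in>T. \<rho> t \<le> 2 ^ Suc j * D}"
        using \<open>finite T\<close> by (intro card_mono) auto
      also have "real \<dots> \<le> B * (2 ^ Suc j * D) ^ Suc m" using D by (intro count) auto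
      finally show "real (card ?I) \<le> B * (2 ^ Suc j * D) ^ Suc m" by simp
    qed (use D in simp)
    also have "\<dots> = 2 ^ Suc m * B / D ^ Suc m * (1 / 2 ^ (j * Suc m))"
    proof -
      have "B * (2 * x * D) ^ Suc m * (1 / (x * D) ^ (2 * Suc m)) = 2 ^ Suc m * B / D ^ Suc m * (1 / x ^ Suc m)"
        if "0 < x" for x :: real
        using D that unfolding mult_2 power_add by (simp add: power_mult_distrib ac_simps)
      from this[of "2 ^ j"] show ?thesis by (simp only: power_mult zero_less_power zero_less_numeral power_Suc)
    qed
    also have "\<dots> \<le> 2 ^ Suc m * B / D ^ Suc m * (1/2) ^ j"
      using B D by (intro mult_left_mono) (auto simp: power_one_over power_add divide_simps)
    finally show "(\<Sum>t\<in>?I. 1 / \<rho> t ^ (2 * Suc m)) \<le> 2 ^ Suc m * B / D ^ Suc m * (1/2) ^ j" .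
  qed
qed

text \<open>
  The discrete form of the integral of \<open>\<bar>x\<bar> ^ -m max(\<bar>x\<bar>, D) ^ -(m + 2)\<close> over a space of dimension \<open>m + 1\<close>.
  The exponents add up to twice the dimension, which gives the scaling \<open>D ^ -(m + 1)\<close>; the uneven split
  keeps the singularity at the origin integrable, whereas \<open>m + 1\<close> in both factors would
  produce a logarithm.
\<close>
lemma sum_two_scale_kernel:
  fixes \<rho> :: "'i \<Rightarrow> real"
  assumes "finite T" and pos: "\<And>t. t \<in> T \<Longrightarrow> 0 < \<rho> t" and D: "0 < D" and B: "0 \<le> B"
    and count: "\<And>R. 0 < R \<Longrightarrow> real (card {t\<in>T. \<rho> t \<le> R}) \<le> B * R ^ Suc m"
  shows "(\<Sum>t\<in>T. 1 / (\<rho> t ^ m * max (\<rho> t) D ^ (m + 2))) \<le> 2 ^ (m + 3) * B / D ^ Suc m"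
proof -
  let ?g = "\<lambda>t. 1 / (\<rho> t ^ m * max (\<rho> t) D ^ (m + 2))"
  have "(\<Sum>t\<in>T. ?g t) = (\<Sum>t\<in>{t\<in>T. \<rho> t \<le> D} \<union> {t\<in>T. \<not> \<rho> t \<le> D}. ?g t)"
    by (intro sum.cong) auto
  also have "\<dots> = (\<Sum>t\<in>{t\<in>T. \<rho> t \<le> D}. ?g t) + (\<Sum>t\<in>{t\<in>T. \<not> \<rho> t \<le> D}. ?g t)"
    using \<open>finite T\<close> by (intro sum.union_disjoint) auto
  also have "(\<Sum>t\<in>{t\<in>T. \<rho> t \<le> D}. ?g t) = (\<Sum>t\<in>{t\<in>T. \<rho> t \<le> D}. 1 / \<rho> t ^ m) / D ^ (m + 2)"
    by (auto simp: sum_divide_distrib max_def intro!: sum.cong)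
  also have "(\<Sum>t\<in>{t\<in>T. \<not> \<rho> t \<le> D}. ?g t) = (\<Sum>t\<in>{t\<in>T. \<not> \<rho> t \<le> D}. 1 / \<rho> t ^ (2 * Suc m))"
    by (auto simp: max_def mult_2 simp flip: power_add intro!: sum.cong)
  also have "\<dots> \<le> (\<Sum>t\<in>{t\<in>T. D \<le> \<rho> t}. 1 / \<rho> t ^ (2 * Suc m))"
    using \<open>finite T\<close> pos
    by (intro sum_mono2) (simp_all add: less_imp_le subset_eq del: power_Suc mult_Suc_right)
  also have "\<dots> \<le> 2 * (2 ^ Suc m * B / D ^ Suc m)"
    by (rule sum_inverse_power_far[OF \<open>finite T\<close> D B count])
  also have "(\<Sum>t\<in>{t\<in>T. \<rho> t \<le> D}. 1 / \<rho> t ^ m) / D ^ (m + 2) \<le> 2 * (2 ^ m * B * D) / D ^ (m + 2)"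
    using D by (intro divide_right_mono sum_inverse_power_near[OF \<open>finite T\<close> pos D B count]) auto
  also have "2 * (2 ^ m * B * D) / D ^ (m + 2) + 2 * (2 ^ Suc m * B / D ^ Suc m)
      = 6 * (2 ^ m * B / D ^ Suc m)"
    using D by (simp add: field_simps)
  also have "\<dots> \<le> 8 * (2 ^ m * B / D ^ Suc m)" using B D by (intro mult_right_mono) auto
  also have "\<dots> = 2 ^ (m + 3) * B / D ^ Suc m" by (simp add: power_add)
  finally show ?thesis by simp
qed

section \<open>Weighted means\<close>
definition weighted_mean :: "'i set \<Rightarrow> ('i \<Rightarrow> real) \<Rightarrow> ('i \<Rightarrow> real) \<Rightarrow> real" where
  "weighted_mean I K a = (\<Sum>i\<in>I. K i * a i) / (\<Sum>i\<in>I. K i)"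

lemma weighted_mean_linear:
  "weighted_mean I K (\<lambda>i. \<alpha> * a i + \<beta> * b i) = \<alpha> * weighted_mean I K a + \<beta> * weighted_mean I K b"
  unfolding weighted_mean_def
  by (simp add: sum.distrib sum_distrib_left add_divide_distrib algebra_simps)

lemma weighted_sum_square:
  fixes K :: "'i \<Rightarrow> real"
  assumes K: "\<And>i. i \<in> I \<Longrightarrow> 0 \<le> K i"
  shows "(\<Sum>i\<in>I. K i * u i)\<^sup>2 \<le> sum K I * (\<Sum>i\<in>I. K i * (u i)\<^sup>2)"
proof -
  have "(\<Sum>i\<in>I. K i * u i) = (\<Sum>i\<in>I. sqrt (K i) * (sqrt (K i) * u i))"
    using K by (intro sum.cong) (auto simp: mult.assoc[symmetric])
  also have "\<dots>\<^sup>2 \<le> (\<Sum>i\<in>I. (sqrt (K i))\<^sup>2) * (\<Sum>i\<in>I. (sqrt (K i) * u i)\<^sup>2)"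
    by (rule Cauchy_Schwarz_ineq_sum)
  also have "\<dots> = sum K I * (\<Sum>i\<in>I. K i * (u i)\<^sup>2)"
    using K by (simp add: power_mult_distrib)
  finally show ?thesis .
qed

lemma weighted_mean_deviation:
  assumes K: "\<And>i. i \<in> I \<Longrightarrow> 0 \<le> K i" and S: "0 < sum K I"
  shows "(c - weighted_mean I K a)\<^sup>2 \<le> (\<Sum>i\<in>I. K i * (c - a i)\<^sup>2) / sum K I"
proof -
  have "c - weighted_mean I K a = (\<Sum>i\<in>I. K i * (c - a i)) / sum K I"
    using S by (simp add: weighted_mean_def field_simps sum_subtractf sum_distrib_left)
  then have "(c - weighted_mean I K a)\<^sup>2 = (\<Sum>i\<in>I. K i * (c - a i))\<^sup>2 / (sum K I)\<^sup>2"
    by (simp add: power_divide)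
  also have "\<dots> \<le> (sum K I * (\<Sum>i\<in>I. K i * (c - a i)\<^sup>2)) / (sum K I)\<^sup>2"
    using K by (intro divide_right_mono weighted_sum_square) auto
  also have "\<dots> = (\<Sum>i\<in>I. K i * (c - a i)\<^sup>2) / sum K I"
    using S by (simp add: power2_eq_square)
  finally show ?thesis .
qed

text \<open>
  The difference of two means of \<open>a\<close> does not change when the mean with weights \<open>K\<close> is subtracted from \<open>a\<close>.
  After that this mean is zero, and only the relative change \<open>\<epsilon>\<close> of the weights contributes.
\<close>
lemma weighted_mean_perturbation:
  assumes K: "\<And>i. i \<in> I \<Longrightarrow> 0 \<le> K i" and S: "0 < sum K I"
    and \<kappa>: "0 < \<kappa>" "\<kappa> * sum K I \<le> sum K' I"
    and \<epsilon>: "\<And>i. i \<in> I \<Longrightarrow> \<bar>K' i - K i\<bar> \<le> \<epsilon> * K i"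
  shows "(weighted_mean I K' a - weighted_mean I K a)\<^sup>2
      \<le> (\<epsilon> / \<kappa>)\<^sup>2 * ((\<Sum>i\<in>I. \<Sum>j\<in>I. K i * K j * (a i - a j)\<^sup>2) / (sum K I)\<^sup>2)"
proof -
  let ?c = "weighted_mean I K a" and ?S = "sum K I" and ?S' = "sum K' I"
  have S': "0 < ?S'" using S \<kappa> by (smt (verit) mult_pos_pos)
  have \<epsilon>K: "\<And>i. i \<in> I \<Longrightarrow> 0 \<le> \<epsilon> * K i" using \<epsilon> by (smt (verit))
  have "(\<Sum>i\<in>I. K i * (a i - ?c)) = (\<Sum>i\<in>I. K i * a i) - ?S * ?c"
    by (simp add: right_diff_distrib sum_subtractf sum_distrib_right)
  also have "\<dots> = 0" using S by (simp add: weighted_mean_def)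
  finally have "(\<Sum>i\<in>I. K i * (a i - ?c)) = 0" .
  moreover have "(\<Sum>i\<in>I. K' i * (a i - ?c)) = (\<Sum>i\<in>I. K' i * a i) - ?S' * ?c"
    by (simp add: right_diff_distrib sum_subtractf sum_distrib_right)
  then have "weighted_mean I K' a - ?c = (\<Sum>i\<in>I. K' i * (a i - ?c)) / ?S'"
    using S' by (simp add: weighted_mean_def[of I K' a] field_simps)
  ultimately have "weighted_mean I K' a - ?c = (\<Sum>i\<in>I. (K' i - K i) * (a i - ?c)) / ?S'"
    by (simp add: left_diff_distrib sum_subtractf)
  then have "\<bar>weighted_mean I K' a - ?c\<bar> = \<bar>\<Sum>i\<in>I. (K' i - K i) * (a i - ?c)\<bar> / ?S'"
    using S' by simp
  also have "\<dots> \<le> (\<Sum>i\<in>I. \<epsilon> * K i * \<bar>a i - ?c\<bar>) / ?S'"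
    using S' \<epsilon> by (intro divide_right_mono order_trans[OF sum_abs] sum_mono)
      (auto simp: abs_mult intro!: mult_right_mono)
  also have "\<dots> \<le> (\<Sum>i\<in>I. \<epsilon> * K i * \<bar>a i - ?c\<bar>) / (\<kappa> * ?S)"
    using S \<kappa> S' \<epsilon>K by (intro divide_left_mono sum_nonneg) (auto intro: mult_nonneg_nonneg)
  also have "\<dots> = \<epsilon> / \<kappa> * ((\<Sum>i\<in>I. K i * \<bar>a i - ?c\<bar>) / ?S)"
    by (simp add: sum_distrib_left[of \<epsilon>] mult.assoc)
  finally have "\<bar>weighted_mean I K' a - ?c\<bar>\<^sup>2 \<le> (\<epsilon> / \<kappa> * ((\<Sum>i\<in>I. K i * \<bar>a i - ?c\<bar>) / ?S))\<^sup>2"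
    by (intro power_mono) auto
  also have "\<dots> = (\<epsilon> / \<kappa>)\<^sup>2 * ((\<Sum>i\<in>I. K i * \<bar>a i - ?c\<bar>)\<^sup>2 / ?S\<^sup>2)"
    by (simp add: power_mult_distrib power_divide)
  also have "\<dots> \<le> (\<epsilon> / \<kappa>)\<^sup>2 * ((?S * (\<Sum>i\<in>I. K i * \<bar>a i - ?c\<bar>\<^sup>2)) / ?S\<^sup>2)"
    using K by (intro mult_left_mono divide_right_mono weighted_sum_square) auto
  \<comment> \<open>The deviation of \<open>a i\<close> from the mean is itself a mean of differences \<open>a i - a j\<close>.\<close>
  also have "\<dots> \<le> (\<epsilon> / \<kappa>)\<^sup>2 * ((?S * (\<Sum>i\<in>I. K i * ((\<Sum>j\<in>I. K j * (a i - a j)\<^sup>2) / ?S))) / ?S\<^sup>2)"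
    using K S by (intro mult_left_mono divide_right_mono sum_mono)
      (auto simp: less_imp_le intro: weighted_mean_deviation)
  also have "(\<Sum>i\<in>I. K i * ((\<Sum>j\<in>I. K j * (a i - a j)\<^sup>2) / ?S))
      = (\<Sum>i\<in>I. \<Sum>j\<in>I. K i * K j * (a i - a j)\<^sup>2) / ?S"
    by (simp add: sum_distrib_left sum_divide_distrib mult.assoc)
  finally show ?thesis using S by simp
qed

section \<open>Extending boundary values by averaging\<close>

text \<open>
  The discrete problem in isolation.  The points \<open>X t\<close> stand for the cells and the points \<open>Y f\<close> for the
  boundary faces of a mesh of size \<open>h\<close> in dimension \<open>m + 1\<close>: the first are spread out in dimension \<open>m + 1\<close>
  (\<open>packing\<close>), while the second are at least as dense as in dimension \<open>m\<close> (\<open>covering\<close>) at all scales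
  up to the diameter \<open>R1\<close> of the configuration.
\<close>
locale boundary_sampling =
  fixes T :: "'t set" and F :: "'f set" and X :: "'t \<Rightarrow> 'a::metric_space" and Y :: "'f \<Rightarrow> 'a"
    and h R1 A c :: real and m :: nat
  assumes finite_T: "finite T" and finite_F: "finite F" and F_nonempty: "F \<noteq> {}"
    and h_pos: "0 < h" and A_nonneg: "0 \<le> A" and c_pos: "0 < c"
    and inj_Y: "inj_on Y F"
    and packing: "\<And>y R. h \<le> R \<Longrightarrow> real (card {t\<in>T. dist (X t) y \<le> R}) \<le> A * (R / h) ^ Suc m"
    and covering: "\<And>f\<^sub>0 R. \<lbrakk>f\<^sub>0 \<in> F; 0 < R; R \<le> R1\<rbrakk>
        \<Longrightarrow> c * (R / h) ^ m \<le> real (card {f\<in>F. dist (Y f) (Y f\<^sub>0) \<le> R + h})"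
    and extent: "\<And>t f. \<lbrakk>t \<in> T; f \<in> F\<rbrakk> \<Longrightarrow> dist (X t) (Y f) + h \<le> R1"
begin

text \<open>
  The summand \<open>h\<close> regularises the distance at the mesh scale.  Neighbouring cells then have comparable
  reaches, also next to the boundary.
\<close>
definition reach :: "'t \<Rightarrow> 'f \<Rightarrow> real" where
  "reach t f = dist (X t) (Y f) + h"

definition depth :: "'t \<Rightarrow> real" where
  "depth t = Min (reach t ` F)"

text \<open>
  The exponent must exceed the dimension \<open>m + 1\<close>: in \<open>interaction_le\<close> the total decay of two weights is
  distributed unevenly between the two samples, with exponents \<open>m\<close> and \<open>m + 2\<close>.
\<close>
definition weight :: "'t \<Rightarrow> 'f \<Rightarrow> real" where
  "weight t f = 1 / reach t f ^ (m + 2)"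

definition mass :: "'t \<Rightarrow> real" where
  "mass t = sum (weight t) F"

definition extension :: "('f \<Rightarrow> real) \<Rightarrow> 't \<Rightarrow> real" where
  "extension a t = weighted_mean F (weight t) a"

text \<open>
  The bound for the squared difference of the extension between \<open>t\<close> and its neighbours.
\<close>
definition variation :: "('f \<Rightarrow> real) \<Rightarrow> 't \<Rightarrow> real" where
  "variation a t = (2 * real (m + 2) * 9 ^ (m + 2) * h / depth t)\<^sup>2 *
     ((\<Sum>f\<in>F. \<Sum>f'\<in>F. weight t f * weight t f' * (a f - a f')\<^sup>2) / (mass t)\<^sup>2)"

lemma reach_ge: "h \<le> reach t f" and reach_pos: "0 < reach t f"
  using h_pos by (auto simp: reach_def add_nonneg_pos)

lemma weight_pos: "0 < weight t f"
  by (simp add: weight_def reach_pos)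

lemma mass_pos: "0 < mass t"
  unfolding mass_def using finite_F F_nonempty weight_pos by (intro sum_pos) auto

lemma depth_le: "f \<in> F \<Longrightarrow> depth t \<le> reach t f"
  unfolding depth_def using finite_F by (intro Min_le) auto

lemma depth_attained: obtains f where "f \<in> F" "depth t = reach t f"
proof -
  have "depth t \<in> reach t ` F"
    unfolding depth_def using finite_F F_nonempty by (intro Min_in) auto
  then show ?thesis using that by blast
qed

lemma depth_ge: "h \<le> depth t" and depth_pos: "0 < depth t"
  by (metis depth_attained reach_ge, metis depth_attained reach_pos)

text \<open>
  Let \<open>f\<^sub>0\<close> be the nearest sample and \<open>r\<close> its reach.  The samples within \<open>r + h\<close> of \<open>f\<^sub>0\<close> have a reach of at most
  \<open>3 r\<close>, and there are at least \<open>c (r / h) ^ m\<close> of them.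
\<close>
lemma mass_ge:
  assumes "t \<in> T"
  shows "c / 3 ^ (m + 2) / (h ^ m * (depth t)\<^sup>2) \<le> mass t"
proof -
  obtain f\<^sub>0 where f0: "f\<^sub>0 \<in> F" "depth t = reach t f\<^sub>0" by (rule depth_attained)
  let ?r = "depth t"
  let ?G = "{f\<in>F. dist (Y f) (Y f\<^sub>0) \<le> ?r + h}"
  have r: "0 < ?r" "h \<le> ?r" by (rule depth_pos, rule depth_ge)
  have "c / 3 ^ (m + 2) / (h ^ m * ?r\<^sup>2) = c * (?r / h) ^ m * (1 / (3 * ?r) ^ (m + 2))"
    using r h_pos by (simp add: power_mult_distrib power_divide power_add power2_eq_square)
  also have "\<dots> \<le> real (card ?G) * (1 / (3 * ?r) ^ (m + 2))"
    using r f0 extent[OF assms f0(1)] by (intro mult_right_mono covering) (auto simp: reach_def)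
  also have "\<dots> = (\<Sum>f\<in>?G. 1 / (3 * ?r) ^ (m + 2))" by simp
  also have "\<dots> \<le> (\<Sum>f\<in>?G. weight t f)"
  proof (rule sum_mono)
    fix f assume f: "f \<in> ?G"
    have "dist (X t) (Y f) \<le> dist (X t) (Y f\<^sub>0) + dist (Y f) (Y f\<^sub>0)"
      by (metis dist_commute dist_triangle)
    then have "reach t f \<le> 3 * ?r" using f f0 r h_pos zero_le_dist[of "X t" "Y f\<^sub>0"]
      unfolding reach_def mem_Collect_eq by linarith
    then have "reach t f ^ (m + 2) \<le> (3 * ?r) ^ (m + 2)" using reach_pos by (intro power_mono) (auto simp: less_imp_le)
    then show "1 / (3 * ?r) ^ (m + 2) \<le> weight t f"
      unfolding weight_def using r reach_pos by (intro divide_left_mono mult_pos_pos zero_less_power) auto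
  qed
  also have "\<dots> \<le> mass t" unfolding mass_def
    using finite_F weight_pos by (intro sum_mono2) (auto simp: less_imp_le)
  finally show ?thesis .
qed

lemma relative_weight_le:
  assumes "t \<in> T"
  shows "weight t f / mass t \<le> 3 ^ (m + 2) / c * (h ^ m * (depth t)\<^sup>2) / reach t f ^ (m + 2)"
proof -
  have p: "0 < c / 3 ^ (m + 2) / (h ^ m * (depth t)\<^sup>2)" using c_pos h_pos depth_pos[of t] by simp
  have "weight t f / mass t \<le> weight t f / (c / 3 ^ (m + 2) / (h ^ m * (depth t)\<^sup>2))"
    using weight_pos[of t f] mass_pos p by (intro divide_left_mono mass_ge assms mult_pos_pos) (auto simp: less_imp_le)
  then show ?thesis by (simp add: weight_def ac_simps)
qed

text \<open>
  Near the boundary the depth is of order \<open>h\<close>.  The deviation of the mean from \<open>a f\<^sub>0\<close> therefore involves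
  the relative weights \<open>h ^ (m + 2) / reach ^ (m + 2)\<close>, and the reach dominates both \<open>h\<close> and the distance
  of the samples.
\<close>
lemma extension_near_boundary:
  assumes "t \<in> T" "f\<^sub>0 \<in> F" "dist (X t) (Y f\<^sub>0) \<le> h"
  shows "(a f\<^sub>0 - extension a t)\<^sup>2
    \<le> 4 * 3 ^ (m + 2) / c * h ^ Suc m * (\<Sum>f\<in>F - {f\<^sub>0}. (a f\<^sub>0 - a f)\<^sup>2 / dist (Y f\<^sub>0) (Y f) ^ Suc m)"
proof -
  let ?C = "4 * 3 ^ (m + 2) / c * h ^ Suc m"
  have r: "0 < depth t" "depth t \<le> 2 * h"
    using depth_le[OF assms(2), of t] assms(3) depth_pos by (auto simp: reach_def)
  have "(a f\<^sub>0 - extension a t)\<^sup>2 \<le> (\<Sum>f\<in>F. weight t f * (a f\<^sub>0 - a f)\<^sup>2) / mass t"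
    unfolding extension_def mass_def using weight_pos mass_pos[of t]
    by (intro weighted_mean_deviation) (auto simp: less_imp_le mass_def)
  also have "\<dots> = (\<Sum>f\<in>F. (weight t f / mass t) * (a f\<^sub>0 - a f)\<^sup>2)"
    by (simp add: sum_divide_distrib)
  also have "\<dots> = (\<Sum>f\<in>F - {f\<^sub>0}. (weight t f / mass t) * (a f\<^sub>0 - a f)\<^sup>2)"
    using finite_F assms(2) by (subst sum.remove[of F f\<^sub>0]) auto
  also have "\<dots> \<le> (\<Sum>f\<in>F - {f\<^sub>0}. (?C / dist (Y f\<^sub>0) (Y f) ^ Suc m) * (a f\<^sub>0 - a f)\<^sup>2)"
  proof (intro sum_mono mult_right_mono)
    fix f assume f: "f \<in> F - {f\<^sub>0}"
    let ?D = "dist (Y f\<^sub>0) (Y f)"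
    have D: "0 < ?D" using f assms(2) inj_Y by (auto simp: inj_on_def)
    have "?D \<le> dist (X t) (Y f\<^sub>0) + dist (X t) (Y f)" by (metis dist_commute dist_triangle)
    then have "?D \<le> reach t f" using assms(3) by (simp add: reach_def)
    then have "h * ?D ^ Suc m \<le> reach t f * reach t f ^ Suc m"
      using D h_pos reach_ge[of t f] by (intro mult_mono power_mono) auto
    then have k: "h * ?D ^ Suc m \<le> reach t f ^ (m + 2)" by simp
    have r2: "(depth t)\<^sup>2 \<le> (2 * h)\<^sup>2" using r by (intro power_mono) auto
    have "weight t f / mass t \<le> 3 ^ (m + 2) / c * (h ^ m * (depth t)\<^sup>2) / reach t f ^ (m + 2)"
      by (rule relative_weight_le[OF assms(1)])
    also have "\<dots> \<le> 3 ^ (m + 2) / c * (h ^ m * (2 * h)\<^sup>2) / (h * ?D ^ Suc m)"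
      using r2 k D h_pos c_pos reach_pos[of t f]
      by (intro frac_le mult_left_mono) auto
    also have "\<dots> = ?C / ?D ^ Suc m" using h_pos by (simp add: power2_eq_square ac_simps)
    finally show "weight t f / mass t \<le> ?C / ?D ^ Suc m" .
  qed auto
  also have "\<dots> = ?C * (\<Sum>f\<in>F - {f\<^sub>0}. (a f\<^sub>0 - a f)\<^sup>2 / dist (Y f\<^sub>0) (Y f) ^ Suc m)"
    by (simp add: sum_distrib_left)
  finally show ?thesis .
qed

text \<open>
  The reach is 1-Lipschitz in the cell point and at least \<open>h\<close>, so that a displacement by \<open>2 h\<close> changes it
  by a factor of at most 3.  The difference of the powers then factors through the difference of the reaches.
\<close>
lemma weight_perturbation:
  assumes "dist (X t) (X t') \<le> 2 * h"
  shows "\<bar>weight t' f - weight t f\<bar> \<le> 2 * real (m + 2) * 3 ^ (m + 2) * h / reach t f * weight t f"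
    and "weight t f / 3 ^ (m + 2) \<le> weight t' f"
proof -
  let ?N = "m + 2" and ?r = "reach t f" and ?s = "reach t' f"
  have pos: "0 < ?r" "0 < ?s" "h \<le> ?r" "h \<le> ?s" by (auto simp: reach_pos reach_ge)
  have rs: "\<bar>?r - ?s\<bar> \<le> 2 * h"
    using assms dist_triangle[of "X t" "Y f" "X t'"] dist_triangle[of "X t'" "Y f" "X t"]
    by (simp add: reach_def dist_commute)
  then have rs3: "?r \<le> 3 * ?s" "?s \<le> 3 * ?r" using pos by auto
  have sN: "?s ^ ?N \<le> 3 ^ ?N * ?r ^ ?N"
    using power_mono[OF rs3(2), of ?N] pos by (simp only: power_mult_distrib)
  show "weight t f / 3 ^ ?N \<le> weight t' f"
    unfolding weight_def using pos sN by (simp add: field_simps)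
  have "\<bar>?r ^ ?N - ?s ^ ?N\<bar> \<le> 2 * real ?N * 3 ^ ?N * h / ?r * ?s ^ ?N"
  proof -
    have "?s ^ ?N - ?r ^ ?N = (?s - ?r) * (\<Sum>i<?N. ?r ^ (?N - Suc i) * ?s ^ i)"
      by (rule power_diff_sumr2)
    then have "\<bar>?r ^ ?N - ?s ^ ?N\<bar> = \<bar>(?s - ?r) * (\<Sum>i<?N. ?r ^ (?N - Suc i) * ?s ^ i)\<bar>"
      by (simp only: abs_minus_commute)
    also have "\<dots> = \<bar>?r - ?s\<bar> * (\<Sum>i<?N. ?r ^ (?N - Suc i) * ?s ^ i)"
    proof -
      have "0 \<le> (\<Sum>i<?N. ?r ^ (?N - Suc i) * ?s ^ i)" using pos by (intro sum_nonneg) auto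
      then show ?thesis by (simp only: abs_mult abs_of_nonneg abs_minus_commute)
    qed
    also have "\<dots> \<le> (2 * h) * (\<Sum>i<?N. 3 ^ ?N * ?s ^ ?N / ?r)"
    proof (intro mult_mono rs sum_mono sum_nonneg)
      fix i assume i: "i \<in> {..<?N}"
      have "?r ^ (?N - Suc i) * ?s ^ i * ?r = ?r ^ (?N - i) * ?s ^ i"
      proof -
        have "?N - i = Suc (?N - Suc i)" using i by auto
        then show ?thesis by (simp only: power_Suc2 ac_simps)
      qed
      also have "\<dots> \<le> (3 * ?s) ^ (?N - i) * ?s ^ i"
        using pos rs3 by (intro mult_right_mono power_mono) auto
      also have "\<dots> = 3 ^ (?N - i) * ?s ^ ?N"
        using i by (simp add: power_mult_distrib flip: power_add)
      also have "\<dots> \<le> 3 ^ ?N * ?s ^ ?N"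
        using pos by (intro mult_right_mono power_increasing) auto
      finally show "?r ^ (?N - Suc i) * ?s ^ i \<le> 3 ^ ?N * ?s ^ ?N / ?r"
        using pos by (simp add: field_simps)
    qed (use pos h_pos in auto)
    also have "\<dots> = 2 * real ?N * 3 ^ ?N * h / ?r * ?s ^ ?N" by simp
    finally show ?thesis .
  qed
  then have "\<bar>?r ^ ?N - ?s ^ ?N\<bar> / (?r ^ ?N * ?s ^ ?N)
      \<le> (2 * real ?N * 3 ^ ?N * h / ?r * ?s ^ ?N) / (?r ^ ?N * ?s ^ ?N)"
    using pos by (intro divide_right_mono) auto
  moreover have "(2 * real ?N * 3 ^ ?N * h / ?r * ?s ^ ?N) / (?r ^ ?N * ?s ^ ?N)
      = 2 * real ?N * 3 ^ ?N * h / ?r * weight t f"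
    unfolding weight_def using pos by (simp del: power_Suc add_2_eq_Suc')
  moreover have "weight t' f - weight t f = (?r ^ ?N - ?s ^ ?N) / (?r ^ ?N * ?s ^ ?N)"
    unfolding weight_def using pos by (simp add: diff_divide_distrib del: power_Suc add_2_eq_Suc')
  then have "\<bar>weight t' f - weight t f\<bar> = \<bar>?r ^ ?N - ?s ^ ?N\<bar> / (?r ^ ?N * ?s ^ ?N)"
    using pos by (simp add: abs_divide del: power_Suc add_2_eq_Suc')
  ultimately show "\<bar>weight t' f - weight t f\<bar> \<le> 2 * real ?N * 3 ^ ?N * h / ?r * weight t f"
    by simp
qed

lemma extension_neighbour:
  assumes "dist (X t) (X t') \<le> 2 * h"
  shows "(extension a t' - extension a t)\<^sup>2 \<le> variation a t"
proof -
  let ?e = "2 * real (m + 2) * 3 ^ (m + 2) * h / depth t"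
  have "(extension a t' - extension a t)\<^sup>2 \<le> (?e / (1 / 3 ^ (m + 2)))\<^sup>2 *
     ((\<Sum>f\<in>F. \<Sum>f'\<in>F. weight t f * weight t f' * (a f - a f')\<^sup>2) / (mass t)\<^sup>2)"
    unfolding extension_def mass_def
  proof (rule weighted_mean_perturbation)
    show "0 \<le> weight t f" for f using weight_pos[of t f] by simp
    show "0 < sum (weight t) F" using mass_pos[of t] by (simp add: mass_def)
    show "1 / 3 ^ (m + 2) * sum (weight t) F \<le> sum (weight t') F"
      unfolding sum_distrib_left using weight_perturbation(2)[OF assms] by (intro sum_mono) simp
    fix f assume "f \<in> F"
    have "\<bar>weight t' f - weight t f\<bar> \<le> 2 * real (m + 2) * 3 ^ (m + 2) * h / reach t f * weight t f"
      by (rule weight_perturbation(1)[OF assms])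
    also have "\<dots> \<le> ?e * weight t f"
      using depth_le[OF \<open>f \<in> F\<close>, of t] depth_pos[of t] weight_pos[of t f] h_pos
      by (intro mult_right_mono divide_left_mono) auto
    finally show "\<bar>weight t' f - weight t f\<bar> \<le> ?e * weight t f" .
  qed simp
  also have "?e / (1 / 3 ^ (m + 2)) = 2 * real (m + 2) * 9 ^ (m + 2) * h / depth t"
  proof -
    have "(9::real) ^ (m + 2) = 3 ^ (m + 2) * 3 ^ (m + 2)" by (simp flip: power_mult_distrib)
    then show ?thesis by (simp only: divide_divide_eq_right) simp
  qed
  finally show ?thesis by (simp only: variation_def)
qed

text \<open>
  Of two samples at distance \<open>2 D\<close>, at least one has a reach of \<open>D\<close> or more, and so has the larger one.  The
  factor \<open>(depth t)\<^sup>2\<close> that is left after normalising the weights is absorbed by the sample with the smaller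
  reach, which lowers its exponent from \<open>m + 2\<close> to \<open>m\<close>.  What remains is the two-scale kernel.
\<close>
lemma interaction_le:
  assumes "f \<in> F" "f' \<in> F" "f \<noteq> f'"
  shows "(\<Sum>t\<in>T. (h / depth t)\<^sup>2 * (weight t f / mass t) * (weight t f' / mass t))
    \<le> 2 ^ (2 * m + 5) * A * (3 ^ (m + 2) / c)\<^sup>2 * h ^ Suc m / dist (Y f) (Y f') ^ Suc m"
proof -
  let ?D = "dist (Y f) (Y f') / 2" and ?c = "3 ^ (m + 2) / c"
  let ?G = "\<lambda>\<rho>. 1 / (\<rho> ^ m * max \<rho> ?D ^ (m + 2))"
  have D: "0 < ?D" using assms inj_Y by (auto simp: inj_on_def)
  have c: "0 < ?c" using c_pos by simp
  have scale: "(\<Sum>t\<in>T. ?G (reach t g)) \<le> 2 ^ (m + 3) * (A / h ^ Suc m) / ?D ^ Suc m" for g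
  proof (rule sum_two_scale_kernel[OF finite_T reach_pos D])
    show "0 \<le> A / h ^ Suc m" using A_nonneg h_pos by simp
    fix R :: real assume "0 < R"
    show "real (card {t\<in>T. reach t g \<le> R}) \<le> A / h ^ Suc m * R ^ Suc m"
    proof (cases "h \<le> R")
      case True
      have "card {t\<in>T. reach t g \<le> R} \<le> card {t\<in>T. dist (X t) (Y g) \<le> R}"
        using finite_T h_pos by (intro card_mono) (auto simp: reach_def)
      also have "real \<dots> \<le> A * (R / h) ^ Suc m" by (rule packing[OF True])
      finally show ?thesis by (simp add: power_divide)
    next
      case False
      then have "{t\<in>T. reach t g \<le> R} = {}" using reach_ge[of _ g] by (auto simp: not_le intro: less_le_trans)
      then show ?thesis using A_nonneg h_pos \<open>0 < R\<close> by (simp only: card.empty) simp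
    qed
  qed
  have pt: "(h / depth t)\<^sup>2 * (weight t f / mass t) * (weight t f' / mass t)
      \<le> ?c\<^sup>2 * h ^ (2 * m + 2) * (?G (reach t f) + ?G (reach t f'))" if "t \<in> T" for t
  proof -
    let ?r = "depth t"
    have r: "0 < ?r" by (rule depth_pos)
    have half: "?r\<^sup>2 / (\<rho> ^ (m + 2) * \<rho>' ^ (m + 2)) \<le> ?G \<rho>"
      if "?r \<le> \<rho>" "0 < \<rho>" "\<rho> \<le> \<rho>'" "?D \<le> \<rho>'" for \<rho> \<rho>' :: real
    proof -
      have "?r\<^sup>2 / (\<rho> ^ (m + 2) * \<rho>' ^ (m + 2)) \<le> \<rho>\<^sup>2 / (\<rho> ^ (m + 2) * max \<rho> ?D ^ (m + 2))"
        using that r D by (intro frac_le mult_left_mono power_mono mult_pos_pos zero_less_power) (auto simp: max_def)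
      also have "\<dots> = ?G \<rho>" using that by (simp add: power_add power2_eq_square)
      finally show ?thesis .
    qed
    have Gpos: "0 \<le> ?G \<rho>" if "0 < \<rho>" for \<rho> :: real using that D by simp
    have "dist (Y f) (Y f') \<le> dist (X t) (Y f) + dist (X t) (Y f')" by (metis dist_commute dist_triangle)
    then have "2 * ?D \<le> reach t f + reach t f'" using h_pos by (simp add: reach_def)
    then consider "reach t f \<le> reach t f'" "?D \<le> reach t f'" | "reach t f' \<le> reach t f" "?D \<le> reach t f"
      by linarith
    then have "?r\<^sup>2 / (reach t f ^ (m + 2) * reach t f' ^ (m + 2)) \<le> ?G (reach t f) + ?G (reach t f')"
    proof cases
      case 1
      have "?r\<^sup>2 / (reach t f ^ (m + 2) * reach t f' ^ (m + 2)) \<le> ?G (reach t f)"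
        by (intro half depth_le assms reach_pos 1)
      then show ?thesis using Gpos[OF reach_pos, of t f'] by linarith
    next
      case 2
      have "?r\<^sup>2 / (reach t f' ^ (m + 2) * reach t f ^ (m + 2)) \<le> ?G (reach t f')"
        by (intro half depth_le assms reach_pos 2)
      then show ?thesis using Gpos[OF reach_pos, of t f]
        unfolding mult.commute[of "reach t f' ^ (m + 2)"] by linarith
    qed
    then have step: "?c\<^sup>2 * h ^ (2 * m + 2) * (?r\<^sup>2 / (reach t f ^ (m + 2) * reach t f' ^ (m + 2)))
        \<le> ?c\<^sup>2 * h ^ (2 * m + 2) * (?G (reach t f) + ?G (reach t f'))"
      using h_pos by (intro mult_left_mono) auto
    have "(h / ?r)\<^sup>2 * (weight t f / mass t) * (weight t f' / mass t)
      \<le> (h / ?r)\<^sup>2 * (?c * (h ^ m * ?r\<^sup>2) / reach t f ^ (m + 2)) * (?c * (h ^ m * ?r\<^sup>2) / reach t f' ^ (m + 2))"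
    proof (intro mult_mono relative_weight_le[OF that])
      show "0 \<le> (h / ?r)\<^sup>2 * (?c * (h ^ m * ?r\<^sup>2) / reach t f ^ (m + 2))"
        using h_pos c_pos reach_pos[of t f] by simp
    qed (use weight_pos mass_pos in \<open>auto simp: less_imp_le\<close>)
    also have "\<dots> = ?c\<^sup>2 * h ^ (2 * m + 2) * (?r\<^sup>2 / (reach t f ^ (m + 2) * reach t f' ^ (m + 2)))"
    proof -
      have "(h / r)\<^sup>2 * (k * (h ^ m * r\<^sup>2) / u) * (k * (h ^ m * r\<^sup>2) / v) = k\<^sup>2 * h ^ (2 * m + 2) * (r\<^sup>2 / (u * v))"
        if "0 < r" "0 < u" "0 < v" for r u v k :: real
        using that unfolding mult_2 power_add by (simp add: field_simps power2_eq_square)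
      then show ?thesis by this (intro r reach_pos zero_less_power)+
    qed
    also note step
    finally show ?thesis .
  qed
  have "(\<Sum>t\<in>T. (h / depth t)\<^sup>2 * (weight t f / mass t) * (weight t f' / mass t))
      \<le> (\<Sum>t\<in>T. ?c\<^sup>2 * h ^ (2 * m + 2) * (?G (reach t f) + ?G (reach t f')))"
    by (intro sum_mono pt)
  also have "\<dots> = ?c\<^sup>2 * h ^ (2 * m + 2) * ((\<Sum>t\<in>T. ?G (reach t f)) + (\<Sum>t\<in>T. ?G (reach t f')))"
    by (simp only: sum.distrib flip: sum_distrib_left)
  also have "\<dots> \<le> ?c\<^sup>2 * h ^ (2 * m + 2) * (2 ^ (m + 3) * (A / h ^ Suc m) / ?D ^ Suc m + 2 ^ (m + 3) * (A / h ^ Suc m) / ?D ^ Suc m)"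
    using h_pos by (intro mult_left_mono add_mono scale) auto
  also have "\<dots> = 2 ^ (2 * m + 5) * A * ?c\<^sup>2 * h ^ Suc m / dist (Y f) (Y f') ^ Suc m"
  proof -
    have "k * h ^ (2 * m + 2) * (2 ^ (m + 3) * (A / h ^ Suc m) / (D / 2) ^ Suc m + 2 ^ (m + 3) * (A / h ^ Suc m) / (D / 2) ^ Suc m)
      = 2 ^ (2 * m + 5) * A * k * h ^ Suc m / D ^ Suc m" if "0 < D" for k D :: real
    proof -
      have 1: "h ^ (2 * m + 2) = h ^ Suc m * h ^ Suc m" by (simp add: mult_2 power_add)
      have "2 * m + 5 = Suc ((m + 3) + Suc m)" by simp
      then have 2: "(2::real) ^ (2 * m + 5) = 2 * 2 ^ (m + 3) * 2 ^ Suc m"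
        by (simp only: power_add power_Suc mult.assoc)
      have "k * (H * H) * (q * (A / H) / (E / s) + q * (A / H) / (E / s)) = 2 * q * s * A * k * H / E"
        if "0 < H" "0 < E" "0 < s" for H E q s :: real
      proof -
        have "q * (A / H) / (E / s) + q * (A / H) / (E / s) = 2 * q * s * A / (H * E)"
          by (simp add: ac_simps)
        then show ?thesis using that by simp
      qed
      from this[of "h ^ Suc m" "D ^ Suc m" "2 ^ Suc m" "2 ^ (m + 3)"]
      show ?thesis unfolding 1 2 power_divide using that h_pos by (simp only: zero_less_power zero_less_numeral)
    qed
    then show ?thesis by this (use D in simp)
  qed
  finally show ?thesis .
qed

lemma sum_variation_le:
  "(\<Sum>t\<in>T. variation a t)
    \<le> (2 * real (m + 2) * 9 ^ (m + 2))\<^sup>2 * (2 ^ (2 * m + 5) * A * (3 ^ (m + 2) / c)\<^sup>2) * h ^ Suc m *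
       (\<Sum>f\<in>F. \<Sum>f'\<in>F - {f}. (a f - a f')\<^sup>2 / dist (Y f) (Y f') ^ Suc m)"
proof -
  let ?k = "(2 * real (m + 2) * 9 ^ (m + 2))\<^sup>2"
  let ?C = "2 ^ (2 * m + 5) * A * (3 ^ (m + 2) / c)\<^sup>2 * h ^ Suc m"
  let ?q = "\<lambda>t f f'. (h / depth t)\<^sup>2 * (weight t f / mass t) * (weight t f' / mass t)"
  have "variation a t = ?k * (\<Sum>f\<in>F. \<Sum>f'\<in>F. ?q t f f' * (a f - a f')\<^sup>2)" for t
    unfolding variation_def
    by (simp add: sum_distrib_left sum_divide_distrib power_mult_distrib power_divide power2_eq_square ac_simps)
  then have "(\<Sum>t\<in>T. variation a t) = ?k * (\<Sum>t\<in>T. \<Sum>f\<in>F. \<Sum>f'\<in>F. ?q t f f' * (a f - a f')\<^sup>2)"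
    by (simp only: sum_distrib_left)
  moreover have "(\<Sum>t\<in>T. \<Sum>f\<in>F. \<Sum>f'\<in>F. ?q t f f' * (a f - a f')\<^sup>2)
      \<le> ?C * (\<Sum>f\<in>F. \<Sum>f'\<in>F - {f}. (a f - a f')\<^sup>2 / dist (Y f) (Y f') ^ Suc m)"
  proof -
    have "(\<Sum>t\<in>T. \<Sum>f\<in>F. \<Sum>f'\<in>F. ?q t f f' * (a f - a f')\<^sup>2)
      = (\<Sum>f\<in>F. \<Sum>f'\<in>F. \<Sum>t\<in>T. ?q t f f' * (a f - a f')\<^sup>2)"
      by (subst sum.swap) (intro sum.cong refl sum.swap)
    also have "\<dots> = (\<Sum>f\<in>F. \<Sum>f'\<in>F - {f}. (\<Sum>t\<in>T. ?q t f f') * (a f - a f')\<^sup>2)"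
      unfolding sum_distrib_right using finite_F
      by (intro sum.cong refl sum.mono_neutral_right) auto
    also have "\<dots> \<le> (\<Sum>f\<in>F. \<Sum>f'\<in>F - {f}. ?C / dist (Y f) (Y f') ^ Suc m * (a f - a f')\<^sup>2)"
      by (intro sum_mono mult_right_mono interaction_le) auto
    also have "\<dots> = ?C * (\<Sum>f\<in>F. \<Sum>f'\<in>F - {f}. (a f - a f')\<^sup>2 / dist (Y f) (Y f') ^ Suc m)"
      by (simp only: sum_distrib_left times_divide_eq_left times_divide_eq_right)
    finally show ?thesis .
  qed
  ultimately have "(\<Sum>t\<in>T. variation a t)
      \<le> ?k * (?C * (\<Sum>f\<in>F. \<Sum>f'\<in>F - {f}. (a f - a f')\<^sup>2 / dist (Y f) (Y f') ^ Suc m))"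
    by (simp only: mult_left_mono zero_le_power2)
  then show ?thesis by (simp only: mult.assoc)
qed

end

section \<open>Lebesgue measure on affine subspaces\<close>


lemma orthonormal_sum_inner:
  assumes "finite B" "pairwise orthogonal B" "\<forall>b\<in>B. norm b = 1" "b \<in> B"
  shows "(\<Sum>b'\<in>B. c b' *\<^sub>R b') \<bullet> b = c b"
proof -
  have "(\<Sum>b'\<in>B. c b' *\<^sub>R b') \<bullet> b = (\<Sum>b'\<in>B. if b' = b then c b else 0)"
    unfolding inner_sum_left using assms
    by (intro sum.cong) (auto simp: pairwise_def orthogonal_def simp flip: power2_norm_eq_inner)
  then show ?thesis using assms by simp
qed

lemma orthonormal_expansion:
  assumes "finite B" "pairwise orthogonal B" "\<forall>b\<in>B. norm b = 1" "v \<in> span B"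
  shows "v = (\<Sum>b\<in>B. (v \<bullet> b) *\<^sub>R b)"
proof -
  obtain c where c: "v = (\<Sum>b\<in>B. c b *\<^sub>R b)"
    using assms(1,4) by (auto simp: span_finite)
  show ?thesis
    by (subst (1) c) (intro sum.cong refl, simp add: c orthonormal_sum_inner[OF assms(1-3)])
qed

text \<open>
  Unfolds the choices in \<^const>\<open>affine_lborel\<close>: whatever origin and orthonormal basis were chosen, they have the
  properties that determine the measure of boxes.
\<close>
lemma affine_orthonormal_coordinates:
  assumes "affine A" "A \<noteq> {}" "aff_dim A = int m"
  shows "\<exists>p B. p \<in> A \<and> finite B \<and> card B = m \<and> pairwise orthogonal B \<and>
    (\<forall>b\<in>B. norm b = 1) \<and> span B = (\<lambda>x. x - p) ` A \<and>
    affine_lborel A = distr (Pi\<^sub>M B (\<lambda>_. lborel)) borel (\<lambda>c. p + (\<Sum>b\<in>B. c b *\<^sub>R b))"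
proof -
  define p where "p = (SOME p. p \<in> A)"
  have p: "p \<in> A" unfolding p_def using assms(2) by (auto intro: someI)
  let ?P = "\<lambda>B. pairwise orthogonal B \<and> (\<forall>b\<in>B. norm b = 1) \<and> span B = (\<lambda>x. x - p) ` A"
  define B where "B = (SOME B. ?P B)"
  have sub: "subspace ((\<lambda>x. x - p) ` A)"
    using affine_diffs_subspace_subtract[OF assms(1) p] .
  obtain B0 where "?P B0" using orthonormal_basis_subspace[OF sub] by metis
  then have B: "?P B" unfolding B_def by (rule someI)
  then have "0 \<notin> B" by force
  then have "independent B" using B pairwise_orthogonal_independent by blast
  then have fin: "finite B" by (rule independent_imp_finite)
  have "int (card B) = int (dim (span B))" using \<open>independent B\<close> by (simp add: dim_eq_card_independent)
  also have "\<dots> = aff_dim A"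
    using B p aff_dim_eq_dim_subtract[of p A] by (simp add: hull_inc)
  finally have "card B = m" using assms(3) by simp
  moreover have "affine_lborel A = distr (Pi\<^sub>M B (\<lambda>_. lborel)) borel (\<lambda>c. p + (\<Sum>b\<in>B. c b *\<^sub>R b))"
    unfolding affine_lborel_def Let_def p_def[symmetric] B_def[symmetric] ..
  ultimately show ?thesis using p fin B by blast
qed

lemma coordinate_map_measurable:
  assumes "finite B"
  shows "(\<lambda>c. p + (\<Sum>b\<in>B. c b *\<^sub>R b)) \<in> measurable (Pi\<^sub>M B (\<lambda>_. lborel)) (borel :: 'a::euclidean_space measure)"
proof -
  have "(\<lambda>c. c b) \<in> borel_measurable (Pi\<^sub>M B (\<lambda>_. lborel :: real measure))" if "b \<in> B" for b
    using measurable_component_singleton[OF that, of "\<lambda>_. lborel :: real measure"] by simp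
  then show ?thesis by (intro borel_measurable_add borel_measurable_const borel_measurable_sum borel_measurable_scaleR)
qed

lemma emeasure_coordinate_box:
  fixes B :: "'a::euclidean_space set" and y :: "'a \<Rightarrow> real"
  assumes "finite B" "0 \<le> r"
  shows "emeasure (Pi\<^sub>M B (\<lambda>_. lborel)) (Pi\<^sub>E B (\<lambda>b. {y b - r..y b + r})) = ennreal ((2 * r) ^ card B)"
proof -
  interpret product_sigma_finite "\<lambda>_. lborel :: real measure" by unfold_locales
  show ?thesis using assms by (simp add: emeasure_PiM ennreal_power)
qed

lemma sets_affine_lborel [simp]: "sets (affine_lborel A) = sets borel"
  by (simp add: affine_lborel_def Let_def)

text \<open>
  Coordinates with respect to an orthonormal basis do not exceed the norm, so the coordinate image of \<open>f\<close>
  lies in a cube of side \<open>2 r\<close>.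
\<close>
lemma emeasure_affine_lborel_le:
  assumes "affine A" "A \<noteq> {}" "aff_dim A = int m" "f \<in> sets borel" "f \<subseteq> cball y r" "0 \<le> r"
  shows "emeasure (affine_lborel A) f \<le> ennreal ((2 * r) ^ m)"
proof -
  obtain p B where B: "p \<in> A" "finite B" "card B = m" "pairwise orthogonal B"
    "\<forall>b\<in>B. norm b = 1" "span B = (\<lambda>x. x - p) ` A"
    and eq: "affine_lborel A = distr (Pi\<^sub>M B (\<lambda>_. lborel)) borel (\<lambda>c. p + (\<Sum>b\<in>B. c b *\<^sub>R b))"
    using affine_orthonormal_coordinates[OF assms(1-3)] by blast
  let ?M = "Pi\<^sub>M B (\<lambda>_. lborel :: real measure)" and ?\<phi> = "\<lambda>c. p + (\<Sum>b\<in>B. c b *\<^sub>R b)"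
  let ?box = "Pi\<^sub>E B (\<lambda>b. {(y - p) \<bullet> b - r..(y - p) \<bullet> b + r})"
  have "emeasure (affine_lborel A) f = emeasure ?M (?\<phi> -` f \<inter> space ?M)"
    unfolding eq using coordinate_map_measurable[OF B(2)] assms(4) by (rule emeasure_distr)
  also have "\<dots> \<le> emeasure ?M ?box"
  proof (rule emeasure_mono)
    show "?\<phi> -` f \<inter> space ?M \<subseteq> ?box"
    proof
      fix c assume c: "c \<in> ?\<phi> -` f \<inter> space ?M"
      have "\<bar>c b - (y - p) \<bullet> b\<bar> \<le> r" if b: "b \<in> B" for b
      proof -
        have "c b - (y - p) \<bullet> b = (?\<phi> c - y) \<bullet> b"
          using orthonormal_sum_inner[OF B(2,4,5) b, of c] by (simp add: inner_diff_left inner_add_left)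
        also have "\<bar>\<dots>\<bar> \<le> norm (?\<phi> c - y)"
          using Cauchy_Schwarz_ineq2[of "?\<phi> c - y" b] B(5)[rule_format, OF b] by simp
        also have "\<dots> \<le> r" using c assms(5) by (auto simp: dist_norm norm_minus_commute)
        finally show ?thesis .
      qed
      moreover have "c \<in> extensional B" using c by (auto simp: space_PiM PiE_def)
      ultimately show "c \<in> ?box" by (auto simp: PiE_def abs_le_iff) (smt (verit))+
    qed
    show "?box \<in> sets ?M" using B(2) by (intro sets_PiM_I_finite) auto
  qed
  also have "\<dots> = ennreal ((2 * r) ^ m)" unfolding B(3)[symmetric] by (rule emeasure_coordinate_box[OF B(2) assms(6)])
  finally show ?thesis .
qed

text \<open>
  Conversely, a cube of half-side \<open>r / (m + 1)\<close> fits into the open ball of radius \<open>r\<close>, by the triangle inequality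
  over the \<open>m\<close> basis vectors.
\<close>
lemma emeasure_affine_lborel_ge:
  assumes "affine A" "aff_dim A = int m" "f \<in> sets borel" "y \<in> A" "ball y r \<inter> A \<subseteq> f" "0 < r"
  shows "ennreal ((2 * r / real (Suc m)) ^ m) \<le> emeasure (affine_lborel A) f"
proof -
  have "A \<noteq> {}" using assms(4) by auto
  obtain p B where B: "p \<in> A" "finite B" "card B = m" "pairwise orthogonal B"
    "\<forall>b\<in>B. norm b = 1" "span B = (\<lambda>x. x - p) ` A"
    and eq: "affine_lborel A = distr (Pi\<^sub>M B (\<lambda>_. lborel)) borel (\<lambda>c. p + (\<Sum>b\<in>B. c b *\<^sub>R b))"
    using affine_orthonormal_coordinates[OF assms(1) \<open>A \<noteq> {}\<close> assms(2)] by blast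
  let ?M = "Pi\<^sub>M B (\<lambda>_. lborel :: real measure)" and ?\<phi> = "\<lambda>c. p + (\<Sum>b\<in>B. c b *\<^sub>R b)"
  let ?s = "r / real (Suc m)"
  let ?box = "Pi\<^sub>E B (\<lambda>b. {(y - p) \<bullet> b - ?s..(y - p) \<bullet> b + ?s})"
  have "ennreal ((2 * r / real (Suc m)) ^ m) = emeasure ?M ?box"
  proof -
    have s: "0 \<le> ?s" using assms(6) by simp
    show ?thesis using emeasure_coordinate_box[OF B(2) s]
      unfolding B(3)[symmetric] times_divide_eq_right[symmetric]
      by (rule sym)
  qed
  also have "\<dots> \<le> emeasure ?M (?\<phi> -` f \<inter> space ?M)"
  proof (rule emeasure_mono)
    show "?box \<subseteq> ?\<phi> -` f \<inter> space ?M"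
    proof
      fix c assume c: "c \<in> ?box"
      have "y - p \<in> span B" using B(6) assms(4) by auto
      then have yp: "y - p = (\<Sum>b\<in>B. ((y - p) \<bullet> b) *\<^sub>R b)"
        by (rule orthonormal_expansion[OF B(2,4,5)])
      have "?\<phi> c - y = (\<Sum>b\<in>B. c b *\<^sub>R b) - (y - p)" by simp
      also have "\<dots> = (\<Sum>b\<in>B. (c b - (y - p) \<bullet> b) *\<^sub>R b)"
        by (subst yp) (simp add: scaleR_diff_left sum_subtractf)
      finally have "norm (?\<phi> c - y) \<le> (\<Sum>b\<in>B. norm ((c b - (y - p) \<bullet> b) *\<^sub>R b))"
        by (simp only: norm_sum)
      also have "\<dots> \<le> (\<Sum>b\<in>B. ?s)"
      proof (rule sum_mono)
        fix b assume b: "b \<in> B"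
        then have "c b \<in> {(y - p) \<bullet> b - ?s..(y - p) \<bullet> b + ?s}" using c by (rule PiE_mem[rotated])
        then show "norm ((c b - (y - p) \<bullet> b) *\<^sub>R b) \<le> ?s" using B(5)[rule_format, OF b] by (simp add: abs_le_iff)
      qed
      also have "\<dots> < r" using assms(6) B(3) by (simp add: field_simps)
      finally have "?\<phi> c \<in> ball y r" by (simp add: dist_norm norm_minus_commute)
      moreover have "(\<Sum>b\<in>B. c b *\<^sub>R b) \<in> (\<lambda>x. x - p) ` A"
        unfolding B(6)[symmetric] by (intro span_sum span_scale span_base)
      then have "?\<phi> c \<in> A" by auto
      ultimately show "c \<in> ?\<phi> -` f \<inter> space ?M" using assms(5) c by (auto simp: space_PiM PiE_def)
    qed
    show "?\<phi> -` f \<inter> space ?M \<in> sets ?M"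
      using coordinate_map_measurable[OF B(2)] assms(3) by (rule measurable_sets)
  qed
  also have "\<dots> = emeasure (affine_lborel A) f"
    unfolding eq using coordinate_map_measurable[OF B(2)] assms(3) by (rule emeasure_distr[symmetric])
  finally show ?thesis .
qed

section \<open>Lower regularity of polytopal sets\<close>


text \<open>
  If one of the closed sets does not contain \<open>U\<close>, the part of \<open>U\<close> outside it is open, non-empty and covered by the
  others.  In the applications \<open>A\<close> is a hyperplane and the closed sets are flat: the set that contains an
  open piece of \<open>A\<close> spans \<open>A\<close>.
\<close>
lemma finite_closed_cover_contains_open:
  assumes "finite \<K>" "\<And>K. K \<in> \<K> \<Longrightarrow> closed K"
    "openin (top_of_set A) U" "U \<noteq> {}" "U \<subseteq> \<Union>\<K>"
  shows "\<exists>K\<in>\<K>. \<exists>V. openin (top_of_set A) V \<and> V \<noteq> {} \<and> V \<subseteq> U \<and> V \<subseteq> K"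
  using assms
proof (induction \<K> arbitrary: U rule: finite_induct)
  case (insert K \<K>)
  show ?case
  proof (cases "U \<subseteq> K")
    case True
    then show ?thesis using insert.prems by blast
  next
    case False
    have "openin (top_of_set A) (U \<inter> - K)"
      using insert.prems(1)[of K] insert.prems(2) by (intro openin_Int_open) auto
    moreover have "U \<inter> - K \<noteq> {}" "U \<inter> - K \<subseteq> \<Union>\<K>" using False insert.prems(4) by auto
    ultimately obtain L V where "L \<in> \<K>" "openin (top_of_set A) V" "V \<noteq> {}" "V \<subseteq> U \<inter> - K" "V \<subseteq> L"
      using insert.IH[of "U \<inter> - K"] insert.prems(1) by blast
    then show ?thesis by blast
  qed
qed simp

text \<open>
  At every scale \<open>R \<le> R1\<close> the set \<open>S\<close> is at least \<open>m\<close>-dimensional around each of its points, with a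
  constant that does not depend on the scale.  Size is measured by the number of separated points instead of
  a measure: distinct points at distance \<open>2 h\<close> cannot lie in the same set of diameter \<open>h\<close>, so that a
  lower bound for the number of sets in a covering follows at once.
\<close>
definition lower_regular :: "nat \<Rightarrow> real \<Rightarrow> real \<Rightarrow> 'a::euclidean_space set \<Rightarrow> bool" where
  "lower_regular m c R1 S \<longleftrightarrow> (\<forall>y\<in>S. \<forall>R h. 0 < R \<longrightarrow> R \<le> R1 \<longrightarrow> 0 < h \<longrightarrow>
    (\<exists>Z. finite Z \<and> Z \<subseteq> S \<inter> cball y R \<and> (\<forall>z\<in>Z. \<forall>z'\<in>Z. z \<noteq> z' \<longrightarrow> 2 * h \<le> dist z z') \<and>
       c * (R / h) ^ m \<le> real (card Z)))"

text \<open>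
  The points form a cubic lattice of spacing \<open>2 h\<close> in \<open>m\<close> orthonormal directions, with \<open>M + 1\<close> points in each
  direction, where \<open>M\<close> is chosen such that the lattice stays within distance \<open>r\<close> of its corner \<open>q\<close>.
\<close>
lemma separated_points_in_disc:
  fixes q :: "'a::euclidean_space"
  assumes A: "affine A" "aff_dim A = int m" "q \<in> A" and "0 < r" "0 < h"
  shows "\<exists>Z. finite Z \<and> Z \<subseteq> A \<inter> ball q r \<and> (\<forall>z\<in>Z. \<forall>z'\<in>Z. z \<noteq> z' \<longrightarrow> 2 * h \<le> dist z z') \<and>
     (r / (2 * h * real (Suc m))) ^ m \<le> real (card Z)"
proof -
  have "A \<noteq> {}" using A by auto
  have sub: "subspace ((\<lambda>x. x - q) ` A)"
    using affine_diffs_subspace_subtract[OF A(1,3)] .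
  obtain B where B: "pairwise orthogonal B" "\<forall>b\<in>B. norm b = 1" "span B = (\<lambda>x. x - q) ` A" "independent B" "card B = dim ((\<lambda>x. x - q) ` A)"
    using orthonormal_basis_subspace[OF sub] by metis
  have fin: "finite B" using B by (simp add: independent_imp_finite)
  have cardB: "card B = m"
    using B(5) A aff_dim_eq_dim_subtract[of q A] by (simp add: hull_inc)
  define M where "M = nat \<lfloor>r / (2 * h * real (Suc m))\<rfloor>"
  define \<phi> where "\<phi> g = q + (\<Sum>b\<in>B. (2 * h * real (g b)) *\<^sub>R b)" for g :: "'a \<Rightarrow> nat"
  let ?G = "PiE B (\<lambda>_. {..M})"
  have q0: "0 \<le> r / (2 * h * real (Suc m))" using assms by simp
  have M: "real M \<le> r / (2 * h * real (Suc m))" "r / (2 * h * real (Suc m)) \<le> real (Suc M)"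
    unfolding M_def using q0 by (simp_all add: of_nat_floor) linarith
  have sep: "2 * h \<le> dist (\<phi> g) (\<phi> g')" if gg: "g \<in> ?G" "g' \<in> ?G" "g \<noteq> g'" for g g'
  proof -
    obtain b where b: "b \<in> B" "g b \<noteq> g' b" using PiE_ext[OF gg(1,2)] gg(3) by blast
    have coord: "2 * h * real (g b) - 2 * h * real (g' b) = (\<phi> g - \<phi> g') \<bullet> b"
      unfolding \<phi>_def inner_diff_left inner_add_left
        orthonormal_sum_inner[OF fin B(1,2) b(1), of "\<lambda>b. 2 * h * real (g b)"]
        orthonormal_sum_inner[OF fin B(1,2) b(1), of "\<lambda>b. 2 * h * real (g' b)"] by simp
    have "2 * h * 1 \<le> 2 * h * \<bar>real (g b) - real (g' b)\<bar>"
      using b \<open>0 < h\<close> by (intro mult_left_mono) (auto simp: abs_if)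
    also have "\<dots> = \<bar>2 * h * real (g b) - 2 * h * real (g' b)\<bar>"
      using \<open>0 < h\<close> by (simp only: right_diff_distrib[symmetric] abs_mult)
    also have "\<dots> = \<bar>(\<phi> g - \<phi> g') \<bullet> b\<bar>" by (simp only: coord)
    also have "\<dots> \<le> dist (\<phi> g) (\<phi> g')"
      using Cauchy_Schwarz_ineq2[of "\<phi> g - \<phi> g'" b] B(2) b(1) by (simp add: dist_norm)
    finally show ?thesis by simp
  qed
  have inj: "inj_on \<phi> ?G" 
  proof (rule inj_onI, rule ccontr)
    fix g g' assume a: "g \<in> ?G" "g' \<in> ?G" "\<phi> g = \<phi> g'" "g \<noteq> g'"
    show False using sep[OF a(1,2,4)] a(3) \<open>0 < h\<close> by simp
  qed
  have "\<phi> ` ?G \<subseteq> A \<inter> ball q r"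
  proof
    fix z assume "z \<in> \<phi> ` ?G"
    then obtain g where g: "g \<in> ?G" "z = \<phi> g" by auto
    have "(\<Sum>b\<in>B. (2 * h * real (g b)) *\<^sub>R b) \<in> span B" by (intro span_sum span_scale span_base)
    then have "z \<in> A" using B(3) g by (auto simp: \<phi>_def)
    have "norm (\<Sum>b\<in>B. (2 * h * real (g b)) *\<^sub>R b) \<le> (\<Sum>b\<in>B. norm ((2 * h * real (g b)) *\<^sub>R b))"
      by (rule norm_sum)
    also have "\<dots> \<le> (\<Sum>b\<in>B. 2 * h * real M)"
      using g \<open>0 < h\<close> B(2) by (intro sum_mono) (auto simp: PiE_def Pi_def abs_mult)
    also have "\<dots> = real m * (2 * h * real M)" using cardB by simp
    also have "\<dots> \<le> real m * (2 * h * (r / (2 * h * real (Suc m))))"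
      using M \<open>0 < h\<close> by (intro mult_left_mono) auto
    also have "\<dots> < r" using \<open>0 < h\<close> \<open>0 < r\<close> by (simp add: divide_simps)
    finally have "z \<in> ball q r" using g by (simp add: \<phi>_def dist_norm)
    then show "z \<in> A \<inter> ball q r" using \<open>z \<in> A\<close> by simp
  qed
  moreover have "(r / (2 * h * real (Suc m))) ^ m \<le> real (card (\<phi> ` ?G))"
  proof -
    have "(r / (2 * h * real (Suc m))) ^ m \<le> real (Suc M) ^ m" using M q0 by (intro power_mono) auto
    also have "\<dots> = real (card (\<phi> ` ?G))" using inj fin cardB by (simp add: card_image card_PiE)
    finally show ?thesis .
  qed
  moreover have "finite (\<phi> ` ?G)" using fin by (intro finite_imageI finite_PiE) auto
  moreover have "\<forall>z\<in>\<phi> ` ?G. \<forall>z'\<in>\<phi> ` ?G. z \<noteq> z' \<longrightarrow> 2 * h \<le> dist z z'" using sep by blast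
  ultimately show ?thesis by blast
qed

text \<open>
  The homothety of ratio \<open>l\<close> proportional to \<open>R\<close> with centre \<open>y\<close> maps \<open>S\<close> into \<open>S\<close> and into the ball of
  radius \<open>R\<close>, by convexity.  The image of a fixed disc in \<open>S\<close> is a disc with a radius proportional to \<open>R\<close>, however
  close \<open>y\<close> is to the relative frontier.
\<close>
lemma convex_lower_regular:
  fixes S :: "'a::euclidean_space set"
  assumes S: "convex S" "bounded S" "S \<noteq> {}" "aff_dim S = int m" and "0 < R1"
  shows "\<exists>c>0. lower_regular m c R1 S"
proof -
  let ?A = "affine hull S"
  obtain q where "q \<in> rel_interior S" using S rel_interior_eq_empty by blast
  then obtain s where s: "q \<in> S" "0 < s" "ball q s \<inter> ?A \<subseteq> S" by (auto simp: mem_rel_interior_ball)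
  obtain D where D: "0 < D" "\<And>x y. x \<in> S \<Longrightarrow> y \<in> S \<Longrightarrow> dist x y \<le> D"
    using bounded_two_points[of S] S(2) by (metis less_eq_real_def linorder_not_less gt_ex order_trans)
  define \<kappa> where "\<kappa> = min (1 / R1) (1 / D)"
  have \<kappa>: "0 < \<kappa>" "\<kappa> * R1 \<le> 1" "\<kappa> * D \<le> 1" using D \<open>0 < R1\<close> by (auto simp: \<kappa>_def min_def field_simps)
  let ?c = "(\<kappa> * s / (2 * real (Suc m))) ^ m"
  have "0 < ?c" using \<kappa> s by simp
  moreover have "\<exists>Z. finite Z \<and> Z \<subseteq> S \<inter> cball y R \<and> (\<forall>z\<in>Z. \<forall>z'\<in>Z. z \<noteq> z' \<longrightarrow> 2 * h \<le> dist z z') \<and>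
       ?c * (R / h) ^ m \<le> real (card Z)" if y: "y \<in> S" and R: "0 < R" "R \<le> R1" and h: "0 < h" for y R h
  proof -
    define l where "l = \<kappa> * R"
    have "\<kappa> * R \<le> \<kappa> * R1" using \<kappa> R by (intro mult_left_mono) auto
    also note \<kappa>(2)
    finally have l: "0 < l" "l \<le> 1" using \<kappa>(1) R by (auto simp: l_def)
    let ?q = "y + l *\<^sub>R (q - y)"
    have "?q = (1 - l) *\<^sub>R y + l *\<^sub>R q" by (simp add: algebra_simps)
    then have q: "?q \<in> ?A" using y s(1) l by (metis affine_affine_hull hull_inc mem_affine add.commute diff_add_cancel)
    obtain Z where Z: "finite Z" "Z \<subseteq> ?A \<inter> ball ?q (l * s)" "\<forall>z\<in>Z. \<forall>z'\<in>Z. z \<noteq> z' \<longrightarrow> 2 * h \<le> dist z z'"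
       "(l * s / (2 * h * real (Suc m))) ^ m \<le> real (card Z)"
      using separated_points_in_disc[OF affine_affine_hull, of S m ?q "l * s" h] q l s h S(4) by auto
    have "Z \<subseteq> S \<inter> cball y R"
    proof
      fix z assume z: "z \<in> Z"
      define w where "w = y + (1 / l) *\<^sub>R (z - y)"
      have w: "w = (1 - 1 / l) *\<^sub>R y + (1 / l) *\<^sub>R z" by (simp add: w_def algebra_simps)
      have wA: "w \<in> ?A" unfolding w using Z(2) z y
        by (intro mem_affine[OF affine_affine_hull]) (auto intro: hull_inc)
      have "w - q = (1 / l) *\<^sub>R (z - ?q)" using l by (simp add: w_def algebra_simps)
      then have "norm (w - q) = dist ?q z / l" using l by (simp add: dist_norm norm_minus_commute)
      also have "\<dots> < s"
      proof -
        have "dist ?q z < l * s" using Z(2) z by auto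
        then show ?thesis using l by (simp add: divide_simps mult.commute)
      qed
      finally have wS: "w \<in> S" using s(3) wA by (auto simp: dist_norm norm_minus_commute)
      have zw: "z = (1 - l) *\<^sub>R y + l *\<^sub>R w" using l by (simp add: w_def algebra_simps)
      then have "z \<in> S" using S(1) y wS l by (simp add: convexD_alt)
      have "y - z = l *\<^sub>R (y - w)" unfolding zw by (simp add: algebra_simps)
      then have "dist y z = l * dist y w" using l by (simp add: dist_norm)
      also have "\<dots> \<le> l * D" using l D(2)[OF y wS] by simp
      also have "\<dots> = R * (\<kappa> * D)" by (simp add: l_def)
      also have "\<dots> \<le> R * 1" using R \<kappa> by (intro mult_left_mono) auto
      finally show "z \<in> S \<inter> cball y R" using \<open>z \<in> S\<close> by simp
    qed
    moreover have "?c * (R / h) ^ m = (l * s / (2 * h * real (Suc m))) ^ m"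
      unfolding power_mult_distrib[symmetric] by (simp add: l_def ac_simps)
    ultimately show ?thesis using Z by (intro exI[of _ Z]) simp
  qed
  ultimately show ?thesis unfolding lower_regular_def by blast
qed

lemma lower_regular_Un:
  assumes "lower_regular m c1 R1 S" "lower_regular m c2 R1 S'"
  shows "lower_regular m (min c1 c2) R1 (S \<union> S')"
  unfolding lower_regular_def
proof (intro ballI allI impI)
  fix y and R h :: real assume y: "y \<in> S \<union> S'" and R: "0 < R" "R \<le> R1" and h: "0 < h"
  have weaken: "\<exists>Z. finite Z \<and> Z \<subseteq> (S \<union> S') \<inter> cball y R \<and> (\<forall>z\<in>Z. \<forall>z'\<in>Z. z \<noteq> z' \<longrightarrow> 2 * h \<le> dist z z') \<and>
       min c1 c2 * (R / h) ^ m \<le> real (card Z)"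
    if reg: "lower_regular m c R1 X" and X: "y \<in> X" "X \<subseteq> S \<union> S'" and c: "min c1 c2 \<le> c" for c X
  proof -
    from reg[unfolded lower_regular_def, THEN bspec, OF X(1), THEN spec[of _ R], THEN spec[of _ h], THEN mp, OF R(1),
        THEN mp, OF R(2), THEN mp, OF h]
    obtain Z where Z: "finite Z" "Z \<subseteq> X \<inter> cball y R" "\<forall>z\<in>Z. \<forall>z'\<in>Z. z \<noteq> z' \<longrightarrow> 2 * h \<le> dist z z'"
       "c * (R / h) ^ m \<le> real (card Z)"
      by blast
    have "min c1 c2 * (R / h) ^ m \<le> c * (R / h) ^ m" using c R h by (intro mult_right_mono) auto
    then have "min c1 c2 * (R / h) ^ m \<le> real (card Z)" using Z(4) by linarith
    moreover have "Z \<subseteq> (S \<union> S') \<inter> cball y R" using Z(2) X(2) by blast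
    ultimately show ?thesis using Z(1,3) by (intro exI[of _ Z] conjI)
  qed
  from y show "\<exists>Z. finite Z \<and> Z \<subseteq> (S \<union> S') \<inter> cball y R \<and> (\<forall>z\<in>Z. \<forall>z'\<in>Z. z \<noteq> z' \<longrightarrow> 2 * h \<le> dist z z') \<and>
       min c1 c2 * (R / h) ^ m \<le> real (card Z)"
  proof
    assume "y \<in> S"
    then show ?thesis by (intro weaken[OF assms(1)]) auto
  next
    assume "y \<in> S'"
    then show ?thesis by (intro weaken[OF assms(2)]) auto
  qed
qed

lemma polytopal_lower_regular:
  fixes \<S> :: "'a::euclidean_space set set"
  assumes "finite \<S>" "\<forall>S\<in>\<S>. int m simplex S" "0 < R1"
  shows "\<exists>c>0. lower_regular m c R1 (\<Union>\<S>)"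
  using assms(1,2)
proof (induction \<S> rule: finite_induct)
  case empty
  have "lower_regular m 1 R1 (\<Union>{} :: 'a set)" by (simp add: lower_regular_def)
  then show ?case using zero_less_one by blast
next
  case (insert S \<S>)
  have S: "int m simplex S" using insert.prems by simp
  have "S \<noteq> {}" using S by auto
  then obtain c1 where c1: "0 < c1" "lower_regular m c1 R1 S"
    using convex_lower_regular[of S m R1] S \<open>0 < R1\<close>
    by (auto simp: convex_simplex aff_dim_simplex compact_imp_bounded compact_simplex)
  obtain c2 where c2: "0 < c2" "lower_regular m c2 R1 (\<Union>\<S>)" using insert by auto
  have "lower_regular m (min c1 c2) R1 (\<Union>(insert S \<S>))"
    using lower_regular_Un[OF c1(2) c2(2)] by simp
  moreover have "0 < min c1 c2" using c1(1) c2(1) by simp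
  ultimately show ?case by blast
qed

section \<open>Packings and simplices\<close>

text \<open>The balls have the same volume, and together they fit into the large one.\<close>
lemma card_disjoint_balls_le:
  fixes c :: "'i \<Rightarrow> 'a::euclidean_space"
  assumes "finite I" "0 < s" "0 \<le> R"
    and disj: "\<And>i j. i \<in> I \<Longrightarrow> j \<in> I \<Longrightarrow> i \<noteq> j \<Longrightarrow> ball (c i) s \<inter> ball (c j) s = {}"
    and sub: "\<And>i. i \<in> I \<Longrightarrow> ball (c i) s \<subseteq> cball y R"
  shows "real (card I) \<le> (R / s) ^ DIM('a)"
proof -
  let ?v = "measure lborel (ball (0::'a) 1)"
  have v: "0 < ?v" by (rule content_ball_pos) simp
  have fin: "emeasure lborel (ball (c i) s) \<noteq> \<infinity>" for i
    using emeasure_lborel_ball_finite[of "c i" s] by auto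
  have "real (card I) * (s ^ DIM('a) * ?v) = (\<Sum>i\<in>I. measure lborel (ball (c i) s))"
    using assms(2) by (simp add: content_ball_conv_unit_ball[of s])
  also have "\<dots> = measure lborel (\<Union>i\<in>I. ball (c i) s)"
    using assms(1) disj fin
    by (intro measure_finite_Union[symmetric]) (auto simp: disjoint_family_on_def)
  also have "\<dots> \<le> measure lborel (cball y R)"
    using sub by (intro measure_mono_fmeasurable UN_least fmeasurable_compact compact_cball)
      (auto intro!: borel_open open_UN)
  also have "\<dots> = R ^ DIM('a) * ?v"
    using content_ball_conv_unit_ball[of R y] assms(3) by (simp add: content_cball_conv_ball)
  finally have "real (card I) * s ^ DIM('a) \<le> R ^ DIM('a)" using v by (simp add: mult.assoc[symmetric])
  then show ?thesis using assms(2) by (simp add: power_divide pos_le_divide_eq)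
qed

text \<open>
  Let \<open>u\<close> be the vertex opposite to \<open>\<sigma>\<close> and \<open>q\<close> a point of \<open>\<sigma>\<close>.  In a direction \<open>e\<close> orthogonal to \<open>u - q\<close>, the
  vertex projects to the same point as \<open>q\<close>, and so all of \<open>\<tau>\<close> lies within the diameter of \<open>\<sigma>\<close> of that point.
  The inscribed ball has width \<open>2 r\<close> in this direction.  Such an \<open>e\<close> exists from dimension two on.
\<close>
lemma inradius_le_facet_diameter:
  fixes \<tau> :: "'a::euclidean_space set"
  assumes "2 \<le> DIM('a)" "n simplex \<tau>" "\<sigma> facet_of \<tau>" "ball x r \<subseteq> \<tau>"
  shows "r \<le> diameter \<sigma>"
proof -
  obtain C where C: "finite C" "\<not> affine_dependent C" "\<tau> = convex hull C"
    using assms(2) unfolding simplex by blast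
  then obtain u where u: "u \<in> C" "\<sigma> = convex hull (C - {u})" "\<sigma> \<noteq> {}"
    using assms(3) facet_of_convex_hull_affine_independent by blast
  obtain q where q: "q \<in> \<sigma>" using u by blast
  have bnd: "bounded \<sigma>" using u C by (simp add: bounded_convex_hull finite_imp_bounded)
  obtain e0 where e0: "e0 \<noteq> 0" "orthogonal (u - q) e0"
    using orthogonal_to_vector_exists[OF assms(1)] by blast
  define e where "e = e0 /\<^sub>R norm e0"
  have e: "norm e = 1" "e \<bullet> (u - q) = 0"
    using e0 by (auto simp: e_def orthogonal_def inner_commute)
  have width: "\<bar>e \<bullet> z - e \<bullet> q\<bar> \<le> diameter \<sigma>" if "z \<in> \<tau>" for z
  proof -
    have "z \<in> convex hull (insert u (C - {u}))" using that C u by (simp add: insert_absorb)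
    have "C - {u} \<noteq> {}" using u by auto
    from \<open>z \<in> convex hull (insert u (C - {u}))\<close>[unfolded convex_hull_insert[OF this]] obtain a b y where y: "0 \<le> a" "0 \<le> b" "a + b = 1" "y \<in> \<sigma>" "z = a *\<^sub>R u + b *\<^sub>R y"
      using u(2) by blast
    have "e \<bullet> u = e \<bullet> q" using e(2) by (simp add: inner_diff_right)
    then have "e \<bullet> z - e \<bullet> q = (a - 1) * (e \<bullet> q) + b * (e \<bullet> y)"
      using y(5) by (simp add: inner_add_right left_diff_distrib)
    also have "a - 1 = - b" using y by simp
    finally have "e \<bullet> z - e \<bullet> q = b * (e \<bullet> (y - q))" by (simp add: inner_diff_right algebra_simps)
    then have "\<bar>e \<bullet> z - e \<bullet> q\<bar> = b * \<bar>e \<bullet> (y - q)\<bar>" using y by (simp add: abs_mult)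
    also have "\<dots> \<le> 1 * norm (y - q)"
      using Cauchy_Schwarz_ineq2[of e "y - q"] e y by (intro mult_mono) auto
    also have "\<dots> \<le> diameter \<sigma>" using diameter_bounded_bound[OF bnd y(4) q] by (simp add: dist_norm)
    finally show ?thesis .
  qed
  show ?thesis
  proof (rule dense_le)
    fix r' assume r': "r' < r"
    show "r' \<le> diameter \<sigma>"
    proof (cases "0 < r'")
      case True
      then have "x + r' *\<^sub>R e \<in> \<tau>" "x - r' *\<^sub>R e \<in> \<tau>" using assms(4) r' e by (auto simp: dist_norm)
      then have "\<bar>e \<bullet> (x + r' *\<^sub>R e) - e \<bullet> q\<bar> \<le> diameter \<sigma>" "\<bar>e \<bullet> (x - r' *\<^sub>R e) - e \<bullet> q\<bar> \<le> diameter \<sigma>"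
        by (auto intro: width)
      moreover have "e \<bullet> e = 1" using e by (simp flip: power2_norm_eq_inner)
      ultimately show ?thesis by (simp add: inner_add_right inner_diff_right)
    next
      case False
      then show ?thesis using diameter_ge_0[OF bnd] by simp
    qed
  qed
qed

lemma card_facets_of_simplex_le:
  fixes \<tau> :: "'a::euclidean_space set"
  assumes "int n simplex \<tau>"
  shows "finite {\<sigma>. \<sigma> facet_of \<tau>}" "card {\<sigma>. \<sigma> facet_of \<tau>} \<le> Suc n"
proof -
  obtain C where C: "finite C" "\<not> affine_dependent C" "\<tau> = convex hull C" "int (card C) = int n + 1"
    using assms unfolding simplex by blast
  have sub: "{\<sigma>. \<sigma> facet_of \<tau>} \<subseteq> (\<lambda>u. convex hull (C - {u})) ` C"
    using C facet_of_convex_hull_affine_independent by blast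
  then show "finite {\<sigma>. \<sigma> facet_of \<tau>}" using C(1) by (rule finite_surj[rotated])
  have "card {\<sigma>. \<sigma> facet_of \<tau>} \<le> card C" using sub C(1) by (rule surj_card_le[rotated])
  then show "card {\<sigma>. \<sigma> facet_of \<tau>} \<le> Suc n" using C(4) by simp
qed

lemma open_polytope_face:
  fixes f :: "'a::euclidean_space set"
  assumes "open_polytope m f" "f \<noteq> {}"
  shows "aff_dim (affine hull f) = int m" "openin (top_of_set (affine hull f)) f" "bounded f" "f \<in> sets borel"
proof -
  obtain \<S> where S: "finite \<S>" "\<forall>S\<in>\<S>. int m simplex S" "aff_dim (\<Union>\<S>) = int m" "f = rel_interior (\<Union>\<S>)"
    using assms(1) unfolding open_polytope_def by blast
  have op: "openin (top_of_set (affine hull (\<Union>\<S>))) f" unfolding S(4) by (rule openin_rel_interior)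
  then have hull: "affine hull f = affine hull (\<Union>\<S>)"
    using assms(2) affine_hull_openin[of "affine hull (\<Union>\<S>)" f] by (simp add: hull_hull)
  show "aff_dim (affine hull f) = int m" using S(3) hull by simp
  show op': "openin (top_of_set (affine hull f)) f" using op hull by simp
  have "bounded (\<Union>\<S>)" using S by (intro bounded_Union) (auto intro: compact_imp_bounded compact_simplex)
  then show "bounded f" using S(4) rel_interior_subset bounded_subset by blast
  obtain W where "open W" "f = affine hull f \<inter> W" using op' by (auto simp: openin_open)
  moreover have "affine hull f \<in> sets borel" by simp
  ultimately show "f \<in> sets borel" by (metis borel_open sets.Int)
qed

section \<open>Meshes with a simplicial refinement\<close>


text \<open>
  A regular and quasi-uniform hybrid mesh together with a simplicial mesh \<open>\<SS>\<close> that witnesses its regularity.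
\<close>
locale refined_mesh =
  fixes \<Omega> :: "'a::euclidean_space set" and \<T> \<F> \<SS> :: "'a set set" and \<theta> \<rho> :: real
  assumes dim: "2 \<le> DIM('a)" and domain: "polytopal_domain \<Omega>" and mesh: "hybrid_mesh \<Omega> \<T> \<F>"
    and simplicial: "conforming_simplicial_mesh \<Omega> \<SS>"
    and simplex_in_cell: "\<And>\<tau>. \<tau> \<in> \<SS> \<Longrightarrow> \<exists>!t. t \<in> \<T> \<and> interior \<tau> \<subseteq> t"
    and facet_in_face: "\<And>\<tau> \<sigma> f. \<lbrakk>\<tau> \<in> \<SS>; \<sigma> facet_of \<tau>; f \<in> \<F>\<rbrakk> \<Longrightarrow> rel_interior \<sigma> \<subseteq> f \<or> disjnt (rel_interior \<sigma>) f"
    and shape: "\<And>\<tau>. \<tau> \<in> \<SS> \<Longrightarrow> \<theta> * diameter \<tau> \<le> inradius \<tau>"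
    and simplex_size: "\<And>\<tau> t. \<lbrakk>\<tau> \<in> \<SS>; t \<in> \<T>; interior \<tau> \<subseteq> t\<rbrakk> \<Longrightarrow> \<theta> * diameter t \<le> diameter \<tau>"
    and uniform: "quasi_uniform \<rho> \<T>" and \<theta>_pos: "0 < \<theta>" and \<rho>_pos: "0 < \<rho>"
begin

definition h :: real where "h = mesh_size \<T>"

text \<open>
  A simplex of diameter \<open>h\<^sub>\<tau>\<close> in a cell \<open>t\<close> has inradius at least \<open>\<theta> h\<^sub>\<tau> \<ge> \<theta>\<^sup>2 h\<^sub>t \<ge> \<theta>\<^sup>2 h / \<rho>\<close>.  The factor \<open>1/2\<close>
  leaves room because the inradius is defined as a supremum.
\<close>
definition \<beta> :: real where "\<beta> = \<theta>\<^sup>2 / (2 * \<rho>)"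

definition cell_simplices :: "'a set \<Rightarrow> 'a set set" where
  "cell_simplices t = {\<tau>\<in>\<SS>. interior \<tau> \<subseteq> t}"

lemma \<beta>_pos: "0 < \<beta>"
  using \<theta>_pos \<rho>_pos by (simp add: \<beta>_def)

lemma mesh_parts:
  shows finite_cells: "finite \<T>"
    and cells: "\<forall>t\<in>\<T>. t \<noteq> {} \<and> open_polytope DIM('a) t"
    and cells_disjnt: "pairwise disjnt \<T>"
    and cells_cover: "(\<Union>t\<in>\<T>. closure t) = closure \<Omega>"
    and finite_faces: "finite \<F>"
    and faces: "\<forall>f\<in>\<F>. f \<noteq> {} \<and> connected f \<and> open_polytope (DIM('a) - 1) f"
    and faces_disjnt: "pairwise disjnt \<F>"
    and face_position: "\<forall>f\<in>\<F>. (f \<subseteq> frontier \<Omega> \<and> card {t\<in>\<T>. f \<subseteq> frontier t} = 1) \<or>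
              (f \<subseteq> \<Omega> \<and> card {t\<in>\<T>. f \<subseteq> frontier t} = 2)"
    and cell_frontier: "\<forall>t\<in>\<T>. frontier t = (\<Union>f\<in>cell_faces \<F> t. closure f)"
  using mesh unfolding hybrid_mesh_def by - (elim conjE, assumption)+

lemma finite_cell_faces: "finite (cell_faces \<F> t)" and finite_boundary_faces: "finite (boundary_faces \<Omega> \<F>)"
  using finite_faces by (simp_all add: cell_faces_def boundary_faces_def)

lemma cell_nonempty: "t \<in> \<T> \<Longrightarrow> t \<noteq> {}" and cell_polytope: "t \<in> \<T> \<Longrightarrow> open_polytope DIM('a) t"
  and face_nonempty: "f \<in> \<F> \<Longrightarrow> f \<noteq> {}" and face_polytope: "f \<in> \<F> \<Longrightarrow> open_polytope (DIM('a) - 1) f"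
  using cells faces by blast+

lemma cell_disjoint: "\<lbrakk>t \<in> \<T>; t' \<in> \<T>; t \<noteq> t'\<rbrakk> \<Longrightarrow> t \<inter> t' = {}"
  and face_disjoint: "\<lbrakk>f \<in> \<F>; f' \<in> \<F>; f \<noteq> f'\<rbrakk> \<Longrightarrow> f \<inter> f' = {}"
  using pairwiseD[OF cells_disjnt] pairwiseD[OF faces_disjnt] by (simp_all add: disjnt_def)

lemma face_aff_dim: "f \<in> \<F> \<Longrightarrow> aff_dim (affine hull f) = int (DIM('a) - 1)"
  and face_openin: "f \<in> \<F> \<Longrightarrow> openin (top_of_set (affine hull f)) f"
  and face_bounded: "f \<in> \<F> \<Longrightarrow> bounded f"
  and face_borel: "f \<in> \<F> \<Longrightarrow> f \<in> sets borel"
  using open_polytope_face[OF face_polytope face_nonempty] by blast+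

lemma cell_bounded: "t \<in> \<T> \<Longrightarrow> bounded t"
  by (rule open_polytope_face(3)[OF cell_polytope cell_nonempty])

lemma cell_open: assumes "t \<in> \<T>" shows "open t"
proof -
  obtain \<S> where "aff_dim (\<Union>\<S>) = int DIM('a)" "t = rel_interior (\<Union>\<S>)"
    using cell_polytope[OF assms] unfolding open_polytope_def by blast
  then show ?thesis by (simp add: interior_rel_interior)
qed

lemma cell_diameter_pos: assumes "t \<in> \<T>" shows "0 < diameter t"
proof -
  obtain x where "x \<in> t" using cell_nonempty[OF assms] by blast
  then obtain e where e: "0 < e" "ball x e \<subseteq> t" using cell_open[OF assms] by (meson openE)
  have "0 < diameter (ball x e)" using e by (simp add: diameter_ball)
  also have "\<dots> \<le> diameter t" using e cell_bounded[OF assms] by (intro diameter_subset)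
  finally show ?thesis .
qed

lemma cell_diameter_le: "t \<in> \<T> \<Longrightarrow> diameter t \<le> h"
  unfolding h_def mesh_size_def using finite_cells by (intro Max_ge) auto

lemma cell_diameter_ge: "t \<in> \<T> \<Longrightarrow> h \<le> \<rho> * diameter t"
  using uniform by (simp add: quasi_uniform_def h_def)

lemma h_pos: "t \<in> \<T> \<Longrightarrow> 0 < h"
  using cell_diameter_pos cell_diameter_le by (meson less_le_trans)

lemma simplex: "\<tau> \<in> \<SS> \<Longrightarrow> int DIM('a) simplex \<tau>"
  using simplicial by (simp add: conforming_simplicial_mesh_def)

lemma finite_simplices: "finite \<SS>" and Union_simplices: "\<Union>\<SS> = closure \<Omega>"
  using simplicial by (simp_all add: conforming_simplicial_mesh_def triangulation_def)

lemma simplex_interior: assumes "\<tau> \<in> \<SS>"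
  shows "interior \<tau> = rel_interior \<tau>" "interior \<tau> \<noteq> {}" "closure (interior \<tau>) = \<tau>"
proof -
  note s = simplex[OF assms]
  show 1: "interior \<tau> = rel_interior \<tau>" using s by (simp add: aff_dim_simplex interior_rel_interior)
  have "\<tau> \<noteq> {}" using s by auto
  then show 2: "interior \<tau> \<noteq> {}" using s 1 by (simp add: convex_simplex rel_interior_eq_empty)
  then show "closure (interior \<tau>) = \<tau>"
    using s by (simp add: convex_simplex convex_closure_interior closed_simplex)
qed

lemma simplex_interiors_disjoint:
  assumes "\<tau> \<in> \<SS>" "\<tau>' \<in> \<SS>" "\<tau> \<noteq> \<tau>'" shows "interior \<tau> \<inter> interior \<tau>' = {}"
proof (rule ccontr)
  assume ne: "interior \<tau> \<inter> interior \<tau>' \<noteq> {}"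
  have tri: "triangulation \<SS>" using simplicial by (simp add: conforming_simplicial_mesh_def)
  have sub: "\<tau> \<subseteq> \<tau>'" if "\<tau> \<in> \<SS>" "\<tau>' \<in> \<SS>" "interior \<tau> \<inter> interior \<tau>' \<noteq> {}" for \<tau> \<tau>'
  proof -
    have face: "(\<tau> \<inter> \<tau>') face_of \<tau>" using tri that(1,2) unfolding triangulation_def by blast
    from that(3) obtain x where "x \<in> interior \<tau>" "x \<in> interior \<tau>'" by blast
    then have "x \<in> \<tau> \<inter> \<tau>' \<inter> rel_interior \<tau>"
      using interior_subset simplex_interior(1)[OF \<open>\<tau> \<in> \<SS>\<close>] by blast
    then have "\<tau> \<subseteq> \<tau> \<inter> \<tau>'" using subset_of_face_of[OF face, of \<tau>] by blast
    then show ?thesis by blast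
  qed
  have "\<tau> = \<tau>'"
    using sub[OF assms(1,2) ne] sub[OF assms(2,1)] ne by blast
  then show False using assms(3) by blast
qed

lemma cell_subset: "t \<in> \<T> \<Longrightarrow> t \<subseteq> closure \<Omega>"
  using cells_cover closure_subset by blast

text \<open>
  A simplex is the closure of its interior.  If it contains a point of the open cell \<open>t\<close>, its interior therefore meets
  \<open>t\<close>, and the cell that contains this interior must be \<open>t\<close>, as cells are disjoint.
\<close>
lemma closure_cell_subset:
  assumes "t \<in> \<T>" shows "closure t \<subseteq> \<Union>(cell_simplices t)"
proof (rule closure_minimal)
  show "t \<subseteq> \<Union>(cell_simplices t)"
  proof
    fix x assume x: "x \<in> t"
    then obtain \<tau> where \<tau>: "\<tau> \<in> \<SS>" "x \<in> \<tau>" using cell_subset[OF assms] Union_simplices by blast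
    then have "t \<inter> closure (interior \<tau>) \<noteq> {}" using x simplex_interior(3) by auto
    then have meet: "t \<inter> interior \<tau> \<noteq> {}" using open_Int_closure_eq_empty[OF cell_open[OF assms]] by blast
    obtain t' where t': "t' \<in> \<T>" "interior \<tau> \<subseteq> t'" using simplex_in_cell[OF \<tau>(1)] by blast
    then have "t' = t" using meet cell_disjoint[OF assms] by blast
    then show "x \<in> \<Union>(cell_simplices t)" using t' \<tau> by (auto simp: cell_simplices_def)
  qed
  show "closed (\<Union>(cell_simplices t))"
    using finite_simplices by (intro closed_Union) (auto simp: cell_simplices_def intro: closed_simplex simplex)
qed

lemma simplex_contains_ball:
  assumes "t \<in> \<T>" "\<tau> \<in> cell_simplices t"
  shows "\<exists>x. ball x (\<beta> * h) \<subseteq> interior \<tau>"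
proof -
  have \<tau>: "\<tau> \<in> \<SS>" "interior \<tau> \<subseteq> t" using assms(2) by (auto simp: cell_simplices_def)
  have h: "0 < h" by (rule h_pos[OF assms(1)])
  have "\<beta> * h < 2 * (\<beta> * h)" using h \<beta>_pos by simp
  also have "2 * (\<beta> * h) = \<theta> * (\<theta> * (h / \<rho>))" using \<rho>_pos by (simp add: \<beta>_def power2_eq_square)
  also have "\<dots> \<le> \<theta> * (\<theta> * diameter t)"
    using cell_diameter_ge[OF assms(1)] \<theta>_pos \<rho>_pos by (intro mult_left_mono) (auto simp: field_simps)
  also have "\<dots> \<le> \<theta> * diameter \<tau>" using simplex_size[OF \<tau>(1) assms(1) \<tau>(2)] \<theta>_pos by simp
  also have "\<dots> \<le> inradius \<tau>" by (rule shape[OF \<tau>(1)])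
  finally have "\<beta> * h < inradius \<tau>" .
  moreover have "{r. 0 \<le> r \<and> (\<exists>x. ball x r \<subseteq> \<tau>)} \<noteq> {}" by (auto intro!: exI[of _ 0])
  ultimately obtain r x where r: "\<beta> * h < r" "ball x r \<subseteq> \<tau>"
    unfolding inradius_def by (auto elim!: less_cSupE)
  have "ball x (\<beta> * h) \<subseteq> ball x r" using r by (intro subset_ball) simp
  then have "ball x (\<beta> * h) \<subseteq> interior \<tau>" using r(2) by (intro interior_maximal) auto
  then show ?thesis by blast
qed

lemma cell_contains_ball:
  assumes "t \<in> \<T>" shows "\<exists>x. ball x (\<beta> * h) \<subseteq> t"
proof -
  obtain y where "y \<in> t" using cell_nonempty[OF assms] by blast
  then obtain \<tau> where "\<tau> \<in> cell_simplices t" using closure_cell_subset[OF assms] closure_subset by blast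
  then obtain x where "ball x (\<beta> * h) \<subseteq> interior \<tau>" "interior \<tau> \<subseteq> t"
    using simplex_contains_ball[OF assms] unfolding cell_simplices_def by blast
  then show ?thesis by blast
qed

text \<open>
  The frontier of \<open>t\<close> avoids the interiors of the simplices of \<open>t\<close>, so that \<open>f\<close> is covered by their facets.  One
  facet \<open>\<sigma>\<close> then contains a relatively open piece of \<open>f\<close>.  As both have dimension \<open>d - 1\<close>, they span the same
  hyperplane, the relative interior of \<open>\<sigma>\<close> meets \<open>f\<close>, and the alternative in \<open>facet_in_face\<close> gives the inclusion.
\<close>
lemma face_contains_facet:
  assumes "t \<in> \<T>" "f \<in> cell_faces \<F> t"
  shows "\<exists>\<tau>\<in>cell_simplices t. \<exists>\<sigma>. \<sigma> facet_of \<tau> \<and> rel_interior \<sigma> \<subseteq> f"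
proof -
  have f: "f \<in> \<F>" "f \<subseteq> frontier t" using assms(2) by (auto simp: cell_faces_def)
  let ?\<K> = "\<Union>\<tau>\<in>cell_simplices t. {\<sigma>. \<sigma> facet_of \<tau>}"
  have sub: "f \<subseteq> \<Union>?\<K>"
  proof
    fix x assume "x \<in> f"
    then have x: "x \<in> closure t" "x \<notin> t" using f(2) cell_open[OF assms(1)] by (auto simp: frontier_def interior_open)
    then obtain \<tau> where \<tau>: "\<tau> \<in> cell_simplices t" "x \<in> \<tau>" using closure_cell_subset[OF assms(1)] by blast
    then have \<tau>': "\<tau> \<in> \<SS>" "interior \<tau> \<subseteq> t" by (auto simp: cell_simplices_def)
    have "x \<in> closure \<tau>" "x \<notin> interior \<tau>" using \<tau>(2) \<tau>'(2) x(2) closure_subset by blast+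
    then have "x \<in> rel_frontier \<tau>" by (simp add: rel_frontier_def simplex_interior(1)[OF \<tau>'(1)])
    then show "x \<in> \<Union>?\<K>"
      using \<tau>(1) rel_frontier_of_polyhedron[OF simplex_imp_polyhedron[OF simplex[OF \<tau>'(1)]]] by auto
  qed
  have "finite (cell_simplices t)" using finite_simplices by (simp add: cell_simplices_def)
  then have fin: "finite ?\<K>"
    by (rule finite_UN_I) (auto simp: cell_simplices_def intro: card_facets_of_simplex_le(1)[OF simplex])
  have cl: "closed \<sigma>" if "\<sigma> \<in> ?\<K>" for \<sigma>
  proof -
    from that obtain \<tau> where "\<tau> \<in> \<SS>" "\<sigma> facet_of \<tau>" unfolding cell_simplices_def by blast
    then show ?thesis
      unfolding facet_of_def
      using compact_imp_closed[OF face_of_imp_compact[of \<tau> \<sigma>]]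
        compact_simplex[OF simplex] convex_simplex[OF simplex] by blast
  qed
  from finite_closed_cover_contains_open[OF fin cl face_openin[OF f(1)] face_nonempty[OF f(1)] sub]
  obtain \<sigma> where \<sigma>: "\<sigma> \<in> ?\<K>"
    and "\<exists>V. openin (top_of_set (affine hull f)) V \<and> V \<noteq> {} \<and> V \<subseteq> f \<and> V \<subseteq> \<sigma>" by (rule bexE)
  then obtain V where V: "openin (top_of_set (affine hull f)) V" "V \<noteq> {}" "V \<subseteq> f" "V \<subseteq> \<sigma>"
    by blast
  obtain \<tau> where \<tau>: "\<tau> \<in> cell_simplices t" "\<sigma> facet_of \<tau>" using \<sigma> by blast
  then have \<tau>': "\<tau> \<in> \<SS>" by (simp add: cell_simplices_def)
  have dim\<sigma>: "aff_dim \<sigma> = int DIM('a) - 1"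
    using \<tau>(2) aff_dim_simplex[OF simplex[OF \<tau>']] by (simp add: facet_of_def)
  have "affine hull f = affine hull V"
    using affine_hull_openin[of "affine hull f" V] V by (simp add: hull_hull)
  then have "affine hull f \<subseteq> affine hull \<sigma>" using V(4) by (simp add: hull_mono)
  then have "affine hull f = affine hull \<sigma>"
    using dim\<sigma> face_aff_dim[OF f(1)] dim face_nonempty[OF f(1)]
    by (intro affine_dim_equal) auto
  then have "V \<subseteq> rel_interior \<sigma>" using V by (intro rel_interior_maximal) auto
  then have "\<not> disjnt (rel_interior \<sigma>) f" using V(2,3) by (auto simp: disjnt_def)
  then show ?thesis using facet_in_face[OF \<tau>' \<tau>(2) f(1)] \<tau> by blast
qed

lemma facet_rel_interior:
  assumes "\<tau> \<in> \<SS>" "\<sigma> facet_of \<tau>"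
  shows "rel_interior \<sigma> \<noteq> {}" "diameter (rel_interior \<sigma>) = diameter \<sigma>"
proof -
  have \<sigma>: "convex \<sigma>" "compact \<sigma>" "\<sigma> \<noteq> {}"
    using assms(2) compact_simplex[OF simplex[OF assms(1)]] convex_simplex[OF simplex[OF assms(1)]]
      face_of_imp_convex[of \<sigma> \<tau>] face_of_imp_compact[of \<tau> \<sigma>]
    unfolding facet_of_def by blast+
  then show "rel_interior \<sigma> \<noteq> {}" by (simp add: rel_interior_eq_empty)
  have "closure (rel_interior \<sigma>) = \<sigma>" using \<sigma> by (simp add: convex_closure_rel_interior compact_imp_closed)
  moreover have "bounded (rel_interior \<sigma>)"
    using \<sigma> by (meson bounded_subset compact_imp_bounded rel_interior_subset)
  ultimately show "diameter (rel_interior \<sigma>) = diameter \<sigma>" using diameter_closure by metis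
qed

lemma face_has_cell: assumes "f \<in> \<F>" obtains t where "t \<in> \<T>" "f \<in> cell_faces \<F> t"
proof -
  have "card {t\<in>\<T>. f \<subseteq> frontier t} \<noteq> 0" using face_position assms by fastforce
  then have "{t\<in>\<T>. f \<subseteq> frontier t} \<noteq> {}" by (metis card.empty)
  then show ?thesis using that assms by (auto simp: cell_faces_def)
qed

lemma face_diameter_ge: assumes "f \<in> \<F>" shows "\<beta> * h \<le> diameter f"
proof -
  obtain t where t: "t \<in> \<T>" "f \<in> cell_faces \<F> t" using face_has_cell[OF assms] .
  obtain \<tau> \<sigma> where \<tau>: "\<tau> \<in> cell_simplices t" "\<sigma> facet_of \<tau>" "rel_interior \<sigma> \<subseteq> f"
    using face_contains_facet[OF t] by blast
  have \<tau>': "\<tau> \<in> \<SS>" using \<tau> by (simp add: cell_simplices_def)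
  obtain x where "ball x (\<beta> * h) \<subseteq> \<tau>" using simplex_contains_ball[OF t(1) \<tau>(1)] interior_subset by blast
  then have "\<beta> * h \<le> diameter \<sigma>" by (rule inradius_le_facet_diameter[OF dim simplex[OF \<tau>'] \<tau>(2)])
  also have "\<dots> = diameter (rel_interior \<sigma>)" using facet_rel_interior(2)[OF \<tau>' \<tau>(2)] by simp
  also have "\<dots> \<le> diameter f" by (rule diameter_subset[OF \<tau>(3) face_bounded[OF assms]])
  finally show ?thesis .
qed

lemma cell_face_diameter_le:
  assumes "t \<in> \<T>" "f \<in> cell_faces \<F> t" shows "diameter f \<le> diameter t"
proof -
  have "f \<subseteq> closure t" using assms(2) by (auto simp: cell_faces_def frontier_def)
  then have "diameter f \<le> diameter (closure t)"
    using cell_bounded[OF assms(1)] by (intro diameter_subset bounded_closure)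
  then show ?thesis using cell_bounded[OF assms(1)] by (simp add: diameter_closure)
qed

lemma face_diameter_le: "f \<in> \<F> \<Longrightarrow> diameter f \<le> h"
  by (meson face_has_cell cell_face_diameter_le cell_diameter_le order_trans)

lemma dist_in_closure_cell:
  assumes "t \<in> \<T>" "x \<in> closure t" "y \<in> closure t" shows "dist x y \<le> h"
  using diameter_bounded_bound[OF bounded_closure[OF cell_bounded[OF assms(1)]] assms(2,3)]
    cell_diameter_le[OF assms(1)] cell_bounded[OF assms(1)] by (simp add: diameter_closure)

text \<open>
  Distinct faces contain the relative interiors of distinct facets.  A cell has boundedly many simplices, because
  each contains a ball of radius \<open>\<beta> h\<close> and the cell has a diameter of at most \<open>h\<close>.
\<close>
lemma card_cell_faces_le:
  assumes "t \<in> \<T>"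
  shows "real (card (cell_faces \<F> t)) \<le> (1 / \<beta>) ^ DIM('a) * real (Suc DIM('a))"
proof -
  have "\<forall>f\<in>cell_faces \<F> t. \<exists>\<sigma>. \<exists>\<tau>\<in>cell_simplices t. \<sigma> facet_of \<tau> \<and> rel_interior \<sigma> \<subseteq> f"
    using face_contains_facet[OF assms] by blast
  then obtain s where s: "\<And>f. f \<in> cell_faces \<F> t \<Longrightarrow> \<exists>\<tau>\<in>cell_simplices t. s f facet_of \<tau> \<and> rel_interior (s f) \<subseteq> f"
    by metis
  let ?\<K> = "\<Union>\<tau>\<in>cell_simplices t. {\<sigma>. \<sigma> facet_of \<tau>}"
  have fin: "finite (cell_simplices t)" using finite_simplices by (simp add: cell_simplices_def)
  have spx: "int DIM('a) simplex \<tau>" if "\<tau> \<in> cell_simplices t" for \<tau>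
    using that simplex by (simp add: cell_simplices_def)
  have "inj_on s (cell_faces \<F> t)"
  proof (rule inj_onI, rule ccontr)
    fix f f' assume f: "f \<in> cell_faces \<F> t" "f' \<in> cell_faces \<F> t" "s f = s f'" "f \<noteq> f'"
    obtain \<tau> where "\<tau> \<in> \<SS>" "s f facet_of \<tau>" using s[OF f(1)] by (auto simp: cell_simplices_def)
    then have "rel_interior (s f) \<noteq> {}" by (rule facet_rel_interior(1))
    moreover have "rel_interior (s f) \<subseteq> f \<inter> f'" using s[OF f(1)] s[OF f(2)] f(3) by auto
    moreover have "f \<inter> f' = {}" using f face_disjoint by (auto simp: cell_faces_def)
    ultimately show False by blast
  qed
  moreover have "s ` cell_faces \<F> t \<subseteq> ?\<K>" using s by blast
  moreover have "finite ?\<K>" using fin card_facets_of_simplex_le(1)[OF spx] by blast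
  ultimately have "card (cell_faces \<F> t) \<le> card ?\<K>" by (rule card_inj_on_le)
  also have "\<dots> \<le> (\<Sum>\<tau>\<in>cell_simplices t. card {\<sigma>. \<sigma> facet_of \<tau>})" by (rule card_UN_le[OF fin])
  also have "\<dots> \<le> (\<Sum>\<tau>\<in>cell_simplices t. Suc DIM('a))"
    using card_facets_of_simplex_le(2)[OF spx] by (intro sum_mono) auto
  finally have 1: "card (cell_faces \<F> t) \<le> card (cell_simplices t) * Suc DIM('a)" by simp
  have "\<forall>\<tau>\<in>cell_simplices t. \<exists>x. ball x (\<beta> * h) \<subseteq> interior \<tau>"
    using simplex_contains_ball[OF assms] by blast
  then obtain x where x: "\<And>\<tau>. \<tau> \<in> cell_simplices t \<Longrightarrow> ball (x \<tau>) (\<beta> * h) \<subseteq> interior \<tau>" by metis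
  obtain y where y: "y \<in> t" using cell_nonempty[OF assms] by blast
  have h: "0 < h" by (rule h_pos[OF assms])
  have "real (card (cell_simplices t)) \<le> (h / (\<beta> * h)) ^ DIM('a)"
  proof (rule card_disjoint_balls_le[OF fin])
    show "0 < \<beta> * h" "0 \<le> h" using h \<beta>_pos by auto
    show "ball (x \<tau>) (\<beta> * h) \<inter> ball (x \<tau>') (\<beta> * h) = {}"
      if "\<tau> \<in> cell_simplices t" "\<tau>' \<in> cell_simplices t" "\<tau> \<noteq> \<tau>'" for \<tau> \<tau>'
      using x[OF that(1)] x[OF that(2)] simplex_interiors_disjoint[of \<tau> \<tau>'] that
      by (auto simp: cell_simplices_def)
    show "ball (x \<tau>) (\<beta> * h) \<subseteq> cball y h" if "\<tau> \<in> cell_simplices t" for \<tau>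
    proof
      fix z assume "z \<in> ball (x \<tau>) (\<beta> * h)"
      then have "z \<in> t" using x[OF that] that by (auto simp: cell_simplices_def)
      then show "z \<in> cball y h" using dist_in_closure_cell[OF assms, of y z] y closure_subset by auto
    qed
  qed
  also have "h / (\<beta> * h) = 1 / \<beta>" using h by simp
  finally have 2: "real (card (cell_simplices t)) \<le> (1 / \<beta>) ^ DIM('a)" .
  have "real (card (cell_faces \<F> t)) \<le> real (card (cell_simplices t)) * real (Suc DIM('a))"
    using 1 by (metis of_nat_le_iff of_nat_mult)
  also have "\<dots> \<le> (1 / \<beta>) ^ DIM('a) * real (Suc DIM('a))" using 2 by (intro mult_right_mono) auto
  finally show ?thesis .
qed

lemma card_cells_of_boundary_face:
  assumes "f \<in> boundary_faces \<Omega> \<F>" shows "card {t\<in>\<T>. f \<subseteq> frontier t} = 1"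
proof -
  have f: "f \<in> \<F>" "f \<subseteq> frontier \<Omega>" using assms by (auto simp: boundary_faces_def)
  have "open \<Omega>" using domain by (simp add: polytopal_domain_def)
  then have "frontier \<Omega> \<inter> \<Omega> = {}" by (auto simp: frontier_def interior_open)
  then have "\<not> f \<subseteq> \<Omega>" using f face_nonempty by blast
  then show ?thesis using face_position f(1) by blast
qed

text \<open>
  Locally the domain lies on one side of a graph, so that arbitrarily close to \<open>p\<close> there are points above the graph.
  They are outside the closure of the domain, which contains the open set \<open>t\<close>.
\<close>
lemma frontier_outside_cells:
  assumes "p \<in> frontier \<Omega>" "t \<in> \<T>" shows "p \<notin> t"
proof
  assume "p \<in> t"
  have "lipschitz_boundary \<Omega>" using domain by (simp add: polytopal_domain_def)
  from this[unfolded lipschitz_boundary_def, THEN bspec, OF assms(1)]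
  obtain U n \<phi> where U: "open U" "p \<in> U" "norm n = 1"
     "frontier \<Omega> \<inter> U = {y\<in>U. n \<bullet> y = \<phi> (y - (n \<bullet> y) *\<^sub>R n)}"
     "\<Omega> \<inter> U = {y\<in>U. n \<bullet> y < \<phi> (y - (n \<bullet> y) *\<^sub>R n)}"
    by blast
  have "open (t \<inter> U)" "p \<in> t \<inter> U" using U cell_open[OF assms(2)] \<open>p \<in> t\<close> by auto
  then obtain e where e: "0 < e" "cball p e \<subseteq> t \<inter> U" by (meson open_contains_cball)
  let ?y = "p + e *\<^sub>R n"
  have y: "?y \<in> t \<inter> U" using e U(3) by (intro subsetD[OF e(2)]) (simp add: dist_norm)
  have nn: "n \<bullet> n = 1" using U(3) by (simp flip: power2_norm_eq_inner)
  then have proj: "?y - (n \<bullet> ?y) *\<^sub>R n = p - (n \<bullet> p) *\<^sub>R n" by (simp add: inner_add_right algebra_simps)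
  have "n \<bullet> p = \<phi> (p - (n \<bullet> p) *\<^sub>R n)" using U assms(1) by blast
  then have "n \<bullet> ?y > \<phi> (?y - (n \<bullet> ?y) *\<^sub>R n)"
    unfolding proj using e(1) nn by (simp add: inner_add_right)
  then have "?y \<notin> frontier \<Omega> \<inter> U" "?y \<notin> \<Omega> \<inter> U" unfolding U(4,5) by auto
  then have "?y \<notin> frontier \<Omega> \<union> \<Omega>" using y by blast
  then have "?y \<notin> closure \<Omega>" using closure_Un_frontier by blast
  then show False using y cell_subset[OF assms(2)] by blast
qed

text \<open>
  A frontier point lies in the frontier of a cell, hence in the closure of a face.  If an open part of the
  frontier were missed by the boundary faces, it would be covered by the sets \<open>closure f - f\<close> of the interior
  faces, since these faces lie in the open domain.  One of these sets would contain an open piece of a hyperplane;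
  this is impossible, since an open piece of the hyperplane of \<open>f\<close> that meets the closure of \<open>f\<close> also meets \<open>f\<close>.
\<close>
lemma frontier_covered:
  "frontier \<Omega> \<subseteq> (\<Union>f\<in>boundary_faces \<Omega> \<F>. closure f)"
proof (rule ccontr)
  let ?Z = "\<Union>f\<in>boundary_faces \<Omega> \<F>. closure f"
  assume "\<not> frontier \<Omega> \<subseteq> ?Z"
  then obtain p where p: "p \<in> frontier \<Omega>" "p \<notin> ?Z" by blast
  have opn: "open (- ?Z)" using finite_boundary_faces by (intro open_Compl closed_UN) auto
  obtain \<S> where \<S>: "finite \<S>" "\<forall>S\<in>\<S>. int (DIM('a) - 1) simplex S" "frontier \<Omega> = \<Union>\<S>"
    using domain unfolding polytopal_domain_def by blast
  obtain S where S: "S \<in> \<S>" "p \<in> S" using p \<S> by blast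
  have spx: "int (DIM('a) - 1) simplex S" using S \<S> by blast
  have "closure (rel_interior S) = S"
    using spx by (simp add: convex_closure_rel_interior convex_simplex closed_simplex)
  then have ne: "rel_interior S \<inter> - ?Z \<noteq> {}"
    using S(2) p(2) opn open_Int_closure_eq_empty[of "- ?Z" "rel_interior S"] by blast
  let ?U = "rel_interior S \<inter> - ?Z" and ?\<K> = "(\<lambda>f. closure f - f) ` (\<F> - boundary_faces \<Omega> \<F>)"
  have op: "openin (top_of_set (affine hull S)) ?U"
    using openin_rel_interior opn by (intro openin_Int_open)
  have \<Omega>: "open \<Omega>" using domain by (simp add: polytopal_domain_def)
  have sub: "?U \<subseteq> \<Union>?\<K>"
  proof
    fix x assume x: "x \<in> ?U"
    then have xf: "x \<in> frontier \<Omega>" using rel_interior_subset S(1) \<S>(3) by blast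
    then have "x \<in> closure \<Omega>" "x \<notin> \<Omega>" using \<Omega> by (auto simp: frontier_def interior_open)
    then obtain t where t: "t \<in> \<T>" "x \<in> closure t" using cells_cover by blast
    then have "x \<in> frontier t"
      using frontier_outside_cells[OF xf t(1)] cell_open[OF t(1)] by (simp add: frontier_def interior_open)
    then obtain f where f: "f \<in> cell_faces \<F> t" "x \<in> closure f"
      using cell_frontier t(1) by blast
    then have "f \<notin> boundary_faces \<Omega> \<F>" using x by blast
    moreover have "f \<in> \<F>" using f(1) by (simp add: cell_faces_def)
    ultimately have "f \<subseteq> \<Omega>" using face_position unfolding boundary_faces_def by blast
    then have "x \<in> closure f - f" using f(2) \<open>x \<notin> \<Omega>\<close> by blast
    then show "x \<in> \<Union>?\<K>" using \<open>f \<in> \<F>\<close> \<open>f \<notin> boundary_faces \<Omega> \<F>\<close> by blast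
  qed
  have cl: "closed (closure f - f)" if fF: "f \<in> \<F>" for f
  proof -
    obtain W where W: "open W" "f = affine hull f \<inter> W" using face_openin[OF fF] by (auto simp: openin_open)
    have "closure f \<subseteq> affine hull f" by (simp add: closure_minimal hull_subset)
    then have "closure f - f = closure f \<inter> - W" using W(2) by blast
    then show ?thesis using W(1) by (simp add: closed_Compl closed_Int)
  qed
  have fin: "finite ?\<K>" using finite_faces by simp
  have clK: "closed K" if "K \<in> ?\<K>" for K using that cl by blast
  from finite_closed_cover_contains_open[OF fin clK op ne sub]
  obtain K where "K \<in> ?\<K>"
    and "\<exists>V. openin (top_of_set (affine hull S)) V \<and> V \<noteq> {} \<and> V \<subseteq> ?U \<and> V \<subseteq> K" by (rule bexE)
  then obtain V where V: "K \<in> ?\<K>" "openin (top_of_set (affine hull S)) V" "V \<noteq> {}" "V \<subseteq> K"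
    by blast
  then obtain f where f: "f \<in> \<F>" "V \<subseteq> closure f - f" by blast
  have "closure f \<subseteq> affine hull f" by (simp add: closure_minimal hull_subset)
  then have "V \<subseteq> affine hull f" using f(2) by blast
  moreover have "affine hull V = affine hull S"
    using affine_hull_openin[of "affine hull S" V] V by (simp add: hull_hull)
  ultimately have "affine hull S \<subseteq> affine hull f" by (metis hull_minimal affine_affine_hull)
  then have "affine hull S = affine hull f"
    using face_aff_dim[OF f(1)] aff_dim_simplex[OF spx] S(2)
    by (intro affine_dim_equal) auto
  then obtain W where W: "open W" "V = affine hull f \<inter> W" using V(2) by (auto simp: openin_open)
  have "W \<inter> closure f \<noteq> {}" using W V(3) f(2) by blast
  then have "W \<inter> f \<noteq> {}" using open_Int_closure_eq_empty[OF W(1)] by blast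
  then have "V \<inter> f \<noteq> {}" using W(2) hull_subset[of f affine] by blast
  then show False using f(2) by blast
qed

lemma face_emeasure_le:
  assumes "f \<in> \<F>"
  shows "emeasure (affine_lborel (affine hull f)) f \<le> ennreal ((2 * h) ^ (DIM('a) - 1))"
proof -
  obtain y where y: "y \<in> f" using face_nonempty[OF assms] by blast
  obtain t where "t \<in> \<T>" using face_has_cell[OF assms] by blast
  then have "0 \<le> h" using h_pos by (simp add: less_imp_le)
  moreover have "f \<subseteq> cball y h"
    using diameter_bounded_bound[OF face_bounded[OF assms] y] face_diameter_le[OF assms] by fastforce
  moreover have "aff_dim (affine hull f) = int (DIM('a) - 1)" by (rule face_aff_dim[OF assms])
  ultimately show ?thesis
    using y face_borel[OF assms] by (intro emeasure_affine_lborel_le) auto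
qed

lemma face_measure_le: "f \<in> \<F> \<Longrightarrow> face_measure f \<le> (2 * h) ^ (DIM('a) - 1)"
  unfolding face_measure_def measure_def
  using enn2real_mono[OF face_emeasure_le] h_pos face_has_cell
  by (metis enn2real_ennreal ennreal_less_top less_imp_le mult_nonneg_nonneg zero_le_numeral zero_le_power)

lemma face_measure_ge:
  assumes x: "face_centroids \<delta> \<F> x" and \<delta>: "0 < \<delta>" and f: "f \<in> \<F>"
  shows "(2 * \<delta> * \<beta> / DIM('a)) ^ (DIM('a) - 1) * h ^ (DIM('a) - 1) \<le> face_measure f"
proof -
  obtain t where "t \<in> \<T>" using face_has_cell[OF f] by blast
  then have h: "0 < h" by (rule h_pos)
  have d: "0 < diameter f" using face_diameter_ge[OF f] mult_pos_pos[OF \<beta>_pos h] by linarith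
  have suc: "Suc (DIM('a) - 1) = DIM('a)" by simp
  have "2 * \<delta> * \<beta> / DIM('a) * h = 2 * (\<delta> * (\<beta> * h)) / DIM('a)" by simp
  also have "\<dots> \<le> 2 * (\<delta> * diameter f) / DIM('a)"
    using face_diameter_ge[OF f] \<delta> by (intro divide_right_mono mult_left_mono) auto
  finally have "(2 * \<delta> * \<beta> / DIM('a) * h) ^ (DIM('a) - 1) \<le> (2 * (\<delta> * diameter f) / DIM('a)) ^ (DIM('a) - 1)"
    using h \<delta> \<beta>_pos by (intro power_mono) auto
  moreover have "ennreal ((2 * (\<delta> * diameter f) / real (Suc (DIM('a) - 1))) ^ (DIM('a) - 1))
      \<le> emeasure (affine_lborel (affine hull f)) f"
    using x f d \<delta> unfolding face_centroids_def
    by (intro emeasure_affine_lborel_ge[where y = "x f"] affine_affine_hull face_aff_dim face_borel) (auto intro: hull_inc)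
  then have "(2 * (\<delta> * diameter f) / DIM('a)) ^ (DIM('a) - 1) \<le> face_measure f"
    unfolding suc face_measure_def measure_def
    using face_emeasure_le[OF f] d \<delta>
    by (metis (no_types, lifting) enn2real_ennreal enn2real_mono divide_nonneg_nonneg ennreal_less_top le_less_trans less_imp_le mult_nonneg_nonneg of_nat_0_le_iff zero_le_numeral zero_le_power)
  ultimately show ?thesis unfolding power_mult_distrib[symmetric] by (rule order_trans)
qed

end

section \<open>Polynomials and integrals over faces\<close>


text \<open>
  The functions in \<^const>\<open>polynomials_on\<close> jump to zero outside the closure of their domain.  For integrability over
  a face a continuous representative is enough.
\<close>
lemma polynomials_on_extends_continuously:
  assumes "v \<in> polynomials_on k X"
  shows "\<exists>p. continuous_on UNIV p \<and> (\<forall>x\<in>X. v x = p x)"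
proof -
  obtain p where p: "p \<in> polynomials k" "v = (\<lambda>x. if x \<in> closure X then p x else 0)"
    using assms unfolding polynomials_on_def by blast
  have "continuous_on UNIV p"
    using p(1) unfolding polynomials_def by (auto intro!: continuous_intros)
  then show ?thesis using p(2) closure_subset by (intro exI[of _ p]) auto
qed

lemma constant_polynomial_on: "(\<lambda>x. if x \<in> closure X then c else 0) \<in> polynomials_on k X"
proof -
  let ?I = "{\<alpha> \<in> (Basis :: 'a set) \<rightarrow>\<^sub>E {..k}. (\<Sum>b\<in>Basis. \<alpha> b) \<le> k}"
  let ?z = "\<lambda>b\<in>(Basis :: 'a set). 0::nat"
  have "finite ((Basis :: 'a set) \<rightarrow>\<^sub>E {..k})" by (intro finite_PiE) auto
  then have fin: "finite ?I" by simp
  have z: "?z \<in> ?I" by (auto simp: PiE_def)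
  have "(\<Sum>\<alpha>\<in>?I. (if \<alpha> = ?z then c else 0) * (\<Prod>b\<in>Basis. (x \<bullet> b) ^ \<alpha> b)) = c" for x :: 'a
  proof -
    have "(\<Sum>\<alpha>\<in>?I. (if \<alpha> = ?z then c else 0) * (\<Prod>b\<in>Basis. (x \<bullet> b) ^ \<alpha> b))
        = (\<Sum>\<alpha>\<in>?I. if \<alpha> = ?z then c else 0)"
      by (intro sum.cong refl) auto
    also have "\<dots> = c" using fin z by (subst sum.delta) auto
    finally show ?thesis .
  qed
  then have "(\<lambda>x. c) \<in> (polynomials k :: ('a \<Rightarrow> real) set)"
    unfolding polynomials_def by (intro CollectI exI[of _ "\<lambda>\<alpha>. if \<alpha> = ?z then c else 0"]) auto
  then show ?thesis unfolding polynomials_on_def by (intro CollectI bexI[of _ "\<lambda>x. c"]) auto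
qed

lemma gradient_locally_constant:
  assumes "open t" "x \<in> t" "\<And>y. y \<in> t \<Longrightarrow> v y = c"
  shows "gradient v x = 0"
proof -
  have d: "(v has_derivative (\<lambda>h. 0)) (at x)"
    using has_derivative_transform_within_open[OF has_derivative_const[of c "at x"] assms(1,2)] assms(3) by auto
  show ?thesis unfolding gradient_def
  proof (rule the_equality)
    show "GDERIV v x :> 0" using d by (simp add: gderiv_def)
    fix D assume "GDERIV v x :> D"
    then have "(\<lambda>h. inner h D) = (\<lambda>h. 0)" using d by (auto simp: gderiv_def intro: has_derivative_unique)
    then have "inner D D = 0" by metis
    then show "D = 0" by simp
  qed
qed

lemma face_integral_nonneg: "(\<And>x. 0 \<le> g x) \<Longrightarrow> 0 \<le> face_integral f g"
  unfolding face_integral_def set_lebesgue_integral_def by (intro integral_nonneg_AE) auto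

lemma face_integral_cong:
  "f \<in> sets borel \<Longrightarrow> (\<And>x. x \<in> f \<Longrightarrow> g x = g' x) \<Longrightarrow> face_integral f g = face_integral f g'"
  unfolding face_integral_def by (intro set_lebesgue_integral_cong) auto

text \<open>
  Used to count each boundary face once, although the seminorm runs over cells first.
\<close>
lemma sum_over_unique_index:
  fixes T :: "'t set" and G :: "'f \<Rightarrow> real"
  assumes "finite T" "finite B" "\<And>f. f \<in> B \<Longrightarrow> card {t\<in>T. R f t} = 1"
  shows "(\<Sum>t\<in>T. \<Sum>f\<in>{f\<in>B. R f t}. G f) = (\<Sum>f\<in>B. G f)"
proof -
  have "(\<Sum>t\<in>T. \<Sum>f\<in>{f\<in>B. R f t}. G f) = (\<Sum>f\<in>B. \<Sum>t\<in>{t\<in>T. R f t}. G f)"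
    by (rule sum.swap_restrict[OF assms(1,2)])
  also have "\<dots> = (\<Sum>f\<in>B. G f)"
    by (rule sum.cong[OF refl]) (simp add: assms(3))
  finally show ?thesis .
qed

context refined_mesh
begin

lemma face_emeasure_finite: "f \<in> \<F> \<Longrightarrow> emeasure (affine_lborel (affine hull f)) f < \<infinity>"
  using face_emeasure_le[of f] by (simp add: order_le_less_trans)

lemma face_set_integrable:
  fixes g p :: "'a \<Rightarrow> real"
  assumes "f \<in> \<F>" "continuous_on UNIV p" "\<And>x. x \<in> f \<Longrightarrow> g x = p x"
  shows "set_integrable (affine_lborel (affine hull f)) f g"
proof -
  let ?M = "affine_lborel (affine hull f)"
  have "compact (p ` closure f)"
    using assms(2) face_bounded[OF assms(1)] by (intro compact_continuous_image) (auto intro: continuous_on_subset)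
  then obtain B where B: "\<And>x. x \<in> f \<Longrightarrow> norm (p x) \<le> B"
    using closure_subset by (metis bounded_iff compact_imp_bounded image_eqI subsetD)
  have "p \<in> borel_measurable borel" using assms(2) by (rule borel_measurable_continuous_onI)
  then have meas: "p \<in> borel_measurable ?M" by (simp add: measurable_cong_sets[OF sets_affine_lborel refl])
  have "integrable ?M (\<lambda>x. indicator f x *\<^sub>R p x)"
  proof (rule integrableI_bounded_set_indicator[where B = B])
    show "f \<in> sets ?M" using face_borel[OF assms(1)] by simp
    show "AE x in ?M. x \<in> f \<longrightarrow> norm (p x) \<le> B" using B by (intro AE_I2) blast
  qed (intro meas face_emeasure_finite assms(1))+
  then have "set_integrable ?M f p" by (simp add: set_integrable_def)
  then show ?thesis using set_integrable_cong[OF refl refl, of f g p ?M] assms(3) by simp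
qed

lemma face_integral_const:
  assumes "f \<in> \<F>" shows "face_integral f (\<lambda>_. c) = face_measure f * c"
proof -
  have "f \<in> sets (affine_lborel (affine hull f))" using face_borel[OF assms] by simp
  moreover have "emeasure (affine_lborel (affine hull f)) f \<noteq> \<infinity>" using face_emeasure_finite[OF assms] by simp
  ultimately show ?thesis unfolding face_integral_def face_measure_def by (simp add: set_integral_const)
qed

lemma face_average_lin:
  assumes f: "f \<in> \<F>" and u: "u \<in> polynomials_on k f" and v: "v \<in> polynomials_on k f"
  shows "face_average f (\<lambda>x. a * u x + b * v x) = a * face_average f u + b * face_average f v"
proof -
  obtain p where p: "continuous_on UNIV p" "\<forall>x\<in>f. u x = p x" using polynomials_on_extends_continuously[OF u] by blast
  obtain q where q: "continuous_on UNIV q" "\<forall>x\<in>f. v x = q x" using polynomials_on_extends_continuously[OF v] by blast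
  have 1: "set_integrable (affine_lborel (affine hull f)) f (\<lambda>x. a * u x)"
    using p by (intro face_set_integrable[OF f, of "\<lambda>x. a * p x"] continuous_intros) auto
  have 2: "set_integrable (affine_lborel (affine hull f)) f (\<lambda>x. b * v x)"
    using q by (intro face_set_integrable[OF f, of "\<lambda>x. b * q x"] continuous_intros) auto
  show ?thesis unfolding face_average_def face_integral_def
    using set_integral_add(2)[OF 1 2] by (simp add: add_divide_distrib)
qed

text \<open>
  The function minus its average is orthogonal to constants on the face.
\<close>
lemma face_integral_about_average:
  assumes f: "f \<in> \<F>" and v: "v \<in> polynomials_on k f" and pos: "0 < face_measure f"
  shows "face_integral f (\<lambda>x. (v x - c)\<^sup>2)
    = face_integral f (\<lambda>x. (v x - face_average f v)\<^sup>2) + face_measure f * (face_average f v - c)\<^sup>2"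
proof -
  let ?M = "affine_lborel (affine hull f)" and ?m = "face_average f v"
  obtain p where p: "continuous_on UNIV p" "\<forall>x\<in>f. v x = p x" using polynomials_on_extends_continuously[OF v] by blast
  have iv: "set_integrable ?M f v" using p by (intro face_set_integrable[OF f, of p]) auto
  have ic: "set_integrable ?M f (\<lambda>_. d)" for d :: real by (intro face_set_integrable[OF f, of "\<lambda>_. d"]) auto
  have isq: "set_integrable ?M f (\<lambda>x. (v x - ?m)\<^sup>2)"
    using p by (intro face_set_integrable[OF f, of "\<lambda>x. (p x - ?m)\<^sup>2"] continuous_intros) auto
  have il: "set_integrable ?M f (\<lambda>x. 2 * (?m - c) * (v x - ?m))"
    using p by (intro face_set_integrable[OF f, of "\<lambda>x. 2 * (?m - c) * (p x - ?m)"] continuous_intros) auto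
  have "face_integral f (\<lambda>x. v x - ?m) = face_integral f v - face_measure f * ?m"
    using set_integral_diff(2)[OF iv ic[of ?m]] face_integral_const[OF f, of ?m] by (simp add: face_integral_def)
  also have "\<dots> = 0" using pos by (simp add: face_average_def)
  finally have zero: "face_integral f (\<lambda>x. v x - ?m) = 0" .
  have "(\<lambda>x. (v x - c)\<^sup>2) = (\<lambda>x. (v x - ?m)\<^sup>2 + 2 * (?m - c) * (v x - ?m) + (?m - c)\<^sup>2)"
    by (auto simp: power2_eq_square algebra_simps)
  then have "face_integral f (\<lambda>x. (v x - c)\<^sup>2)
      = face_integral f (\<lambda>x. (v x - ?m)\<^sup>2 + 2 * (?m - c) * (v x - ?m) + (?m - c)\<^sup>2)" by simp
  also have "\<dots> = face_integral f (\<lambda>x. (v x - ?m)\<^sup>2) + face_integral f (\<lambda>x. 2 * (?m - c) * (v x - ?m))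
       + face_integral f (\<lambda>_. (?m - c)\<^sup>2)"
    unfolding face_integral_def
      set_integral_add(2)[OF set_integral_add(1)[OF isq il] ic] set_integral_add(2)[OF isq il] ..
  also have "face_integral f (\<lambda>x. 2 * (?m - c) * (v x - ?m)) = 2 * (?m - c) * face_integral f (\<lambda>x. v x - ?m)"
    unfolding face_integral_def by (rule set_integral_mult_right)
  finally show ?thesis using zero by (simp add: face_integral_const[OF f])
qed

end

section \<open>The lifting\<close>


text \<open>
  The functional \<open>c w t\<close> is the constant on the cell \<open>t\<close>.  An interior face takes the constant of an arbitrary one of
  its cells; the conditions on \<open>x\<close> reflect that elements of the hybrid space vanish outside the closures
  and outside the index sets.
\<close>
definition constant_lifting ::
    "'a::euclidean_space set \<Rightarrow> 'a set set \<Rightarrow> 'a set set \<Rightarrow> (('a set \<Rightarrow> 'a \<Rightarrow> real) \<Rightarrow> 'a set \<Rightarrow> real) \<Rightarrow>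
     ('a set \<Rightarrow> 'a \<Rightarrow> real) \<Rightarrow> ('a set \<Rightarrow> 'a \<Rightarrow> real) \<times> ('a set \<Rightarrow> 'a \<Rightarrow> real)" where
  "constant_lifting \<Omega> \<T> \<F> c w =
     ((\<lambda>t x. if t \<in> \<T> \<and> x \<in> closure t then c w t else 0),
      (\<lambda>f x. if f \<in> boundary_faces \<Omega> \<F> then w f x
             else if f \<in> \<F> \<and> x \<in> closure f then c w (SOME t. t \<in> \<T> \<and> f \<subseteq> frontier t) else 0))"

lemma boundary_space_component: "w \<in> boundary_space k \<Omega> \<F> \<Longrightarrow> f \<in> boundary_faces \<Omega> \<F> \<Longrightarrow> w f \<in> polynomials_on k f"
  and boundary_space_outside: "w \<in> boundary_space k \<Omega> \<F> \<Longrightarrow> f \<notin> boundary_faces \<Omega> \<F> \<Longrightarrow> w f = (\<lambda>_. 0)"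
  by (simp_all add: boundary_space_def polynomial_product_def)

lemma constant_lifting_in_hybrid_space:
  assumes "w \<in> boundary_space k \<Omega> \<F>"
  shows "constant_lifting \<Omega> \<T> \<F> c w \<in> hybrid_space k \<T> \<F>"
proof -
  have "(\<lambda>t x. if t \<in> \<T> \<and> x \<in> closure t then c w t else 0) \<in> polynomial_product k \<T>"
    unfolding polynomial_product_def by (auto intro: constant_polynomial_on)
  moreover have "(\<lambda>f x. if f \<in> boundary_faces \<Omega> \<F> then w f x
             else if f \<in> \<F> \<and> x \<in> closure f then c w (SOME t. t \<in> \<T> \<and> f \<subseteq> frontier t) else 0) \<in> polynomial_product k \<F>"
    unfolding polynomial_product_def
  proof (intro CollectI conjI ballI allI impI)
    fix f assume f: "f \<in> \<F>"
    show "(\<lambda>x. if f \<in> boundary_faces \<Omega> \<F> then w f x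
             else if f \<in> \<F> \<and> x \<in> closure f then c w (SOME t. t \<in> \<T> \<and> f \<subseteq> frontier t) else 0) \<in> polynomials_on k f"
    proof (cases "f \<in> boundary_faces \<Omega> \<F>")
      case True
      then show ?thesis using boundary_space_component[OF assms] by simp
    next
      case False
      then show ?thesis using f constant_polynomial_on[of f "c w (SOME t. t \<in> \<T> \<and> f \<subseteq> frontier t)" k] by simp
    qed
  qed (auto simp: boundary_faces_def)
  ultimately show ?thesis by (simp add: constant_lifting_def hybrid_space_def)
qed

lemma constant_lifting_linear:
  assumes c: "\<And>w w' a b t. \<lbrakk>w \<in> boundary_space k \<Omega> \<F>; w' \<in> boundary_space k \<Omega> \<F>\<rbrakk>
      \<Longrightarrow> c (lin_comb a w b w') t = a * c w t + b * c w' t"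
  shows "linear_operator_on (boundary_space k \<Omega> \<F>) (hybrid_space k \<T> \<F>) (constant_lifting \<Omega> \<T> \<F> c)"
  unfolding linear_operator_on_def
proof (intro conjI ballI allI)
  fix w w' a b assume w: "w \<in> boundary_space k \<Omega> \<F>" "w' \<in> boundary_space k \<Omega> \<F>"
  let ?L = "constant_lifting \<Omega> \<T> \<F> c"
  have "fst (?L (lin_comb a w b w')) = lin_comb a (fst (?L w)) b (fst (?L w'))"
    using c[OF w] by (auto simp: constant_lifting_def lin_comb_def fun_eq_iff)
  moreover have "snd (?L (lin_comb a w b w')) = lin_comb a (snd (?L w)) b (snd (?L w'))"
    using c[OF w] by (auto simp: constant_lifting_def lin_comb_def fun_eq_iff)
  ultimately show "?L (lin_comb a w b w') = (lin_comb a (fst (?L w)) b (fst (?L w')), lin_comb a (snd (?L w)) b (snd (?L w')))"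
    by (simp add: prod_eq_iff)
qed (rule constant_lifting_in_hybrid_space)

lemma boundary_trace_constant_lifting:
  assumes "w \<in> boundary_space k \<Omega> \<F>"
  shows "boundary_trace \<Omega> \<F> (constant_lifting \<Omega> \<T> \<F> c w) = w"
  using boundary_space_outside[OF assms] by (auto simp: boundary_trace_def constant_lifting_def fun_eq_iff)

text \<open>
  With \<open>n\<close> the dimension: \<open>\<kappa>\<close> bounds face measures from below in units of \<open>h ^ m\<close>, \<open>C1\<close> comes from the jump at the
  boundary (\<open>extension_near_boundary\<close>), \<open>C2\<close> from the jumps between cells (\<open>sum_variation_le\<close>), and \<open>N\<close> bounds the
  number of faces of a cell.
\<close>
definition lifting_constant :: "nat \<Rightarrow> real \<Rightarrow> real \<Rightarrow> real \<Rightarrow> real \<Rightarrow> real" where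
  "lifting_constant n \<beta> \<rho> \<delta> c =
     (let m = n - 1;
          \<kappa> = (2 * \<delta> * \<beta> / n) ^ m;
          C1 = 4 * 3 ^ (m + 2) / c;
          C2 = (2 * real (m + 2) * 9 ^ (m + 2))\<^sup>2 * (2 ^ (2 * m + 5) * ((1 + \<beta>) / \<beta>) ^ n * (3 ^ (m + 2) / c)\<^sup>2);
          N = (1 / \<beta>) ^ n * real (Suc n)
      in sqrt (1 + \<rho> * 2 ^ m * (C1 + N * C2) / \<kappa>\<^sup>2))"

lemma lifting_constant_pos:
  assumes "0 < \<beta>" "0 < \<rho>" "0 < c"
  shows "0 < lifting_constant n \<beta> \<rho> \<delta> c"
  unfolding lifting_constant_def Let_def using assms
  by (intro real_sqrt_gt_zero add_pos_nonneg divide_nonneg_nonneg mult_nonneg_nonneg add_nonneg_nonneg) auto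

context refined_mesh
begin

definition cell_point :: "'a set \<Rightarrow> 'a" where
  "cell_point t = (SOME x. ball x (\<beta> * h) \<subseteq> t)"

lemma cell_point_ball: "t \<in> \<T> \<Longrightarrow> ball (cell_point t) (\<beta> * h) \<subseteq> t"
  unfolding cell_point_def using cell_contains_ball by (rule someI_ex)

lemma cell_point_in: "t \<in> \<T> \<Longrightarrow> cell_point t \<in> t"
  using cell_point_ball[of t] h_pos[of t] \<beta>_pos by (auto intro: subsetD)

text \<open>
  The balls of radius \<open>\<beta> h\<close> about the cell points lie in disjoint cells.
\<close>
lemma cell_points_packing:
  assumes "t\<^sub>0 \<in> \<T>" "h \<le> R"
  shows "real (card {t\<in>\<T>. dist (cell_point t) y \<le> R}) \<le> ((1 + \<beta>) / \<beta>) ^ DIM('a) * (R / h) ^ DIM('a)"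
proof -
  have h: "0 < h" by (rule h_pos[OF assms(1)])
  have "real (card {t\<in>\<T>. dist (cell_point t) y \<le> R}) \<le> ((R + \<beta> * h) / (\<beta> * h)) ^ DIM('a)"
  proof (rule card_disjoint_balls_le)
    show "finite {t\<in>\<T>. dist (cell_point t) y \<le> R}" using finite_cells by simp
    show "0 < \<beta> * h" "0 \<le> R + \<beta> * h" using h \<beta>_pos assms(2) by (auto intro: add_nonneg_nonneg)
    show "ball (cell_point t) (\<beta> * h) \<inter> ball (cell_point t') (\<beta> * h) = {}"
      if "t \<in> {t\<in>\<T>. dist (cell_point t) y \<le> R}" "t' \<in> {t\<in>\<T>. dist (cell_point t) y \<le> R}" "t \<noteq> t'" for t t'
      using that cell_point_ball[of t] cell_point_ball[of t'] cell_disjoint[of t t'] by blast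
    show "ball (cell_point t) (\<beta> * h) \<subseteq> cball y (R + \<beta> * h)"
      if "t \<in> {t\<in>\<T>. dist (cell_point t) y \<le> R}" for t
    proof
      fix z assume "z \<in> ball (cell_point t) (\<beta> * h)"
      then show "z \<in> cball y (R + \<beta> * h)"
        using that dist_triangle[of y z "cell_point t"] by (simp add: dist_commute)
    qed
  qed
  also have "\<dots> \<le> ((1 + \<beta>) / \<beta> * (R / h)) ^ DIM('a)"
  proof (rule power_mono)
    have "R + \<beta> * h \<le> R + \<beta> * R" using assms(2) \<beta>_pos by simp
    then have "(R + \<beta> * h) / (\<beta> * h) \<le> (R + \<beta> * R) / (\<beta> * h)" using h \<beta>_pos by (intro divide_right_mono) auto
    then show "(R + \<beta> * h) / (\<beta> * h) \<le> (1 + \<beta>) / \<beta> * (R / h)" by (simp add: distrib_right)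
    show "0 \<le> (R + \<beta> * h) / (\<beta> * h)" using h \<beta>_pos assms(2) by (intro divide_nonneg_nonneg) auto
  qed
  finally show ?thesis by (simp only: power_mult_distrib)
qed

text \<open>
  Each of the separated points on the frontier lies in the closure of a boundary face.  A face has a diameter of at
  most \<open>h\<close> and so accounts for at most one of these points, which are \<open>2 h\<close> apart.
\<close>
lemma boundary_faces_covering:
  assumes reg: "lower_regular m c R1 (frontier \<Omega>)" and x: "\<And>f. f \<in> \<F> \<Longrightarrow> x f \<in> f"
    and f0: "f\<^sub>0 \<in> boundary_faces \<Omega> \<F>" and R: "0 < R" "R \<le> R1"
  shows "c * (R / h) ^ m \<le> real (card {f\<in>boundary_faces \<Omega> \<F>. dist (x f) (x f\<^sub>0) \<le> R + h})"
proof -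
  have F: "f \<in> \<F>" if "f \<in> boundary_faces \<Omega> \<F>" for f using that by (simp add: boundary_faces_def)
  obtain t where "t \<in> \<T>" using face_has_cell[OF F[OF f0]] by blast
  then have h: "0 < h" by (rule h_pos)
  have "x f\<^sub>0 \<in> frontier \<Omega>" using x[OF F[OF f0]] f0 by (auto simp: boundary_faces_def)
  from reg[unfolded lower_regular_def, THEN bspec, OF this, THEN spec[of _ R], THEN spec[of _ h], THEN mp, OF R(1),
      THEN mp, OF R(2), THEN mp, OF h]
  obtain Z where Z: "finite Z" "Z \<subseteq> frontier \<Omega> \<inter> cball (x f\<^sub>0) R"
     "\<forall>z\<in>Z. \<forall>z'\<in>Z. z \<noteq> z' \<longrightarrow> 2 * h \<le> dist z z'" "c * (R / h) ^ m \<le> real (card Z)"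
    by blast
  have "\<forall>z\<in>Z. \<exists>f. f \<in> boundary_faces \<Omega> \<F> \<and> z \<in> closure f" using Z(2) frontier_covered by blast
  then obtain g where g: "\<And>z. z \<in> Z \<Longrightarrow> g z \<in> boundary_faces \<Omega> \<F> \<and> z \<in> closure (g z)" by metis
  have near: "dist y z \<le> h" if "f \<in> boundary_faces \<Omega> \<F>" "y \<in> closure f" "z \<in> closure f" for f y z
    using diameter_bounded_bound[OF bounded_closure[OF face_bounded[OF F[OF that(1)]]] that(2,3)]
      face_diameter_le[OF F[OF that(1)]] diameter_closure[OF face_bounded[OF F[OF that(1)]]] by simp
  have "inj_on g Z"
  proof (rule inj_onI, rule ccontr)
    fix z z' assume z: "z \<in> Z" "z' \<in> Z" "g z = g z'" "z \<noteq> z'"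
    then have "dist z z' \<le> h" using near[of "g z" z z'] g[of z] g[of z'] by simp
    moreover have "2 * h \<le> dist z z'" using Z(3) z by blast
    ultimately show False using h by linarith
  qed
  moreover have "g ` Z \<subseteq> {f\<in>boundary_faces \<Omega> \<F>. dist (x f) (x f\<^sub>0) \<le> R + h}"
  proof
    fix f assume "f \<in> g ` Z"
    then obtain z where z: "z \<in> Z" "f = g z" by blast
    then have f: "f \<in> boundary_faces \<Omega> \<F>" "z \<in> closure f" using g by auto
    have "x f \<in> closure f" using x[OF F[OF f(1)]] closure_subset by blast
    then have "dist (x f) z \<le> h" by (rule near[OF f(1) _ f(2)])
    moreover have "dist z (x f\<^sub>0) \<le> R" using Z(2) z(1) by (auto simp: dist_commute)
    ultimately have "dist (x f) (x f\<^sub>0) \<le> R + h" using dist_triangle[of "x f" "x f\<^sub>0" z] by linarith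
    then show "f \<in> {f\<in>boundary_faces \<Omega> \<F>. dist (x f) (x f\<^sub>0) \<le> R + h}" using f by simp
  qed
  ultimately have "card Z \<le> card {f\<in>boundary_faces \<Omega> \<F>. dist (x f) (x f\<^sub>0) \<le> R + h}"
    using finite_boundary_faces by (intro card_inj_on_le) auto
  then show ?thesis using Z(4) by linarith
qed

text \<open>
  The scale bound \<open>2 diameter + 1\<close> exceeds every reach, since both \<open>h\<close> and the distances are bounded by the
  diameter of the domain; the summand 1 makes it positive in all cases.
\<close>
lemma mesh_boundary_sampling:
  assumes reg: "lower_regular (DIM('a) - 1) c (2 * diameter (closure \<Omega>) + 1) (frontier \<Omega>)" and c: "0 < c"
    and x: "\<And>f. f \<in> \<F> \<Longrightarrow> x f \<in> f" and ne: "boundary_faces \<Omega> \<F> \<noteq> {}"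
  shows "boundary_sampling \<T> (boundary_faces \<Omega> \<F>) cell_point x h
    (2 * diameter (closure \<Omega>) + 1) (((1 + \<beta>) / \<beta>) ^ DIM('a)) c (DIM('a) - 1)"
proof -
  obtain f1 where f1: "f1 \<in> boundary_faces \<Omega> \<F>" using ne by blast
  have F: "f \<in> \<F>" if "f \<in> boundary_faces \<Omega> \<F>" for f using that by (simp add: boundary_faces_def)
  obtain t1 where t1: "t1 \<in> \<T>" using face_has_cell[OF F[OF f1]] by blast
  have suc: "Suc (DIM('a) - 1) = DIM('a)" by simp
  have bnd: "bounded (closure \<Omega>)" using domain unfolding polytopal_domain_def by (intro bounded_closure) blast
  have "diameter t \<le> diameter (closure \<Omega>)" if "t \<in> \<T>" for t
    by (rule diameter_subset[OF cell_subset[OF that] bnd])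
  then have h_le: "h \<le> diameter (closure \<Omega>)"
    unfolding h_def mesh_size_def using finite_cells t1 by (intro Max.boundedI) auto
  show ?thesis
  proof
    show "finite \<T>" "finite (boundary_faces \<Omega> \<F>)" "boundary_faces \<Omega> \<F> \<noteq> {}" "0 < c"
      by (rule finite_cells finite_boundary_faces ne c)+
    show "0 < h" by (rule h_pos[OF t1])
    show "0 \<le> ((1 + \<beta>) / \<beta>) ^ DIM('a)" using \<beta>_pos by simp
    show "inj_on x (boundary_faces \<Omega> \<F>)"
    proof (rule inj_onI, rule ccontr)
      fix f f' assume f: "f \<in> boundary_faces \<Omega> \<F>" "f' \<in> boundary_faces \<Omega> \<F>" "x f = x f'" "f \<noteq> f'"
      have "x f \<in> f" "x f \<in> f'" using x[OF F[OF f(1)]] x[OF F[OF f(2)]] f(3) by simp_all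
      then show False using face_disjoint[OF F[OF f(1)] F[OF f(2)] f(4)] by blast
    qed
    show "real (card {t\<in>\<T>. dist (cell_point t) y \<le> R})
        \<le> ((1 + \<beta>) / \<beta>) ^ DIM('a) * (R / h) ^ Suc (DIM('a) - 1)" if "h \<le> R" for y R
      unfolding suc by (rule cell_points_packing[OF t1 that])
    show "c * (R / h) ^ (DIM('a) - 1) \<le> real (card {f\<in>boundary_faces \<Omega> \<F>. dist (x f) (x f\<^sub>0) \<le> R + h})"
      if "f\<^sub>0 \<in> boundary_faces \<Omega> \<F>" "0 < R" "R \<le> 2 * diameter (closure \<Omega>) + 1" for f\<^sub>0 R
      by (rule boundary_faces_covering[OF reg x that])
    show "dist (cell_point t) (x f) + h \<le> 2 * diameter (closure \<Omega>) + 1"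
      if "t \<in> \<T>" "f \<in> boundary_faces \<Omega> \<F>" for t f
    proof -
      have "cell_point t \<in> closure \<Omega>" using cell_point_in[OF that(1)] cell_subset[OF that(1)] by blast
      moreover have "x f \<in> closure \<Omega>"
        using x[OF F[OF that(2)]] that(2) by (auto simp: boundary_faces_def frontier_def)
      ultimately have "dist (cell_point t) (x f) \<le> diameter (closure \<Omega>)"
        by (rule diameter_bounded_bound[OF bnd])
      then show ?thesis using h_le by linarith
    qed
  qed
qed

lemma face_measure_pos:
  assumes "face_centroids \<delta> \<F> x" "0 < \<delta>" "f \<in> \<F>" shows "0 < face_measure f"
proof -
  obtain t where "t \<in> \<T>" using face_has_cell[OF assms(3)] by blast
  then have "0 < (2 * \<delta> * \<beta> / DIM('a)) ^ (DIM('a) - 1) * h ^ (DIM('a) - 1)"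
    using h_pos[of t] \<beta>_pos assms(2) by simp
  then show ?thesis using face_measure_ge[OF assms] by linarith
qed

lemma inverse_diameter_le:
  assumes "t \<in> \<T>" shows "inverse (diameter t) \<le> \<rho> / h"
  using cell_diameter_ge[OF assms] cell_diameter_pos[OF assms] h_pos[OF assms]
  by (simp add: field_simps)

text \<open>
  Reduces the seminorm of a constant lifting to estimates for numbers: \<open>E f\<close> bounds the jump between the average on
  a boundary face and the constant of its cell, and \<open>V t\<close> the jump between \<open>t\<close> and any adjacent cell.  The factor
  \<open>\<rho> / h * (2 h) ^ (d - 1)\<close> bounds \<open>h\<^sub>t ^ -1\<close> times the measure of a face.
\<close>
lemma seminorm_constant_lifting_le:
  assumes w: "w \<in> boundary_space k \<Omega> \<F>" and x: "face_centroids \<delta> \<F> x" "0 < \<delta>"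
    and near: "\<And>f t. \<lbrakk>f \<in> boundary_faces \<Omega> \<F>; t \<in> \<T>; f \<subseteq> frontier t\<rbrakk>
        \<Longrightarrow> (face_average f (w f) - c w t)\<^sup>2 \<le> E f"
    and step: "\<And>t t'. \<lbrakk>t \<in> \<T>; t' \<in> \<T>; frontier t \<inter> frontier t' \<noteq> {}\<rbrakk> \<Longrightarrow> (c w t' - c w t)\<^sup>2 \<le> V t"
  shows "(seminorm_1h \<T> \<F> (constant_lifting \<Omega> \<T> \<F> c w))\<^sup>2
    \<le> (\<Sum>f\<in>boundary_faces \<Omega> \<F>. inverse (diameter f) * face_integral f (\<lambda>y. (w f y - face_average f (w f))\<^sup>2))
      + \<rho> / h * (2 * h) ^ (DIM('a) - 1) *
         ((\<Sum>f\<in>boundary_faces \<Omega> \<F>. E f) + (1 / \<beta>) ^ DIM('a) * real (Suc DIM('a)) * (\<Sum>t\<in>\<T>. V t))"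
proof -
  let ?B = "boundary_faces \<Omega> \<F>" and ?L = "constant_lifting \<Omega> \<T> \<F> c w" and ?m = "DIM('a) - 1"
  let ?W = "\<rho> / h * (2 * h) ^ ?m" and ?N = "(1 / \<beta>) ^ DIM('a) * real (Suc DIM('a))"
  let ?I = "\<lambda>f. face_integral f (\<lambda>y. (w f y - face_average f (w f))\<^sup>2)"
  let ?J = "\<lambda>t f. inverse (diameter t) * face_integral f (\<lambda>x. (snd ?L f x - fst ?L t x)\<^sup>2)"
  let ?G = "\<lambda>f. inverse (diameter f) * ?I f + ?W * E f"
  have weight: "inverse (diameter t) * face_measure f \<le> ?W" if "t \<in> \<T>" "f \<in> \<F>" for t f
    using inverse_diameter_le[OF that(1)] face_measure_le[OF that(2)] h_pos[OF that(1)] \<rho>_pos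
    by (intro mult_mono) (auto simp: face_measure_def)
  have boundary: "?J t f \<le> ?G f" if "t \<in> \<T>" "f \<in> ?B" "f \<subseteq> frontier t" for t f
  proof -
    have f: "f \<in> \<F>" "f \<in> cell_faces \<F> t" using that by (auto simp: boundary_faces_def cell_faces_def)
    have "face_integral f (\<lambda>x. (snd ?L f x - fst ?L t x)\<^sup>2) = face_integral f (\<lambda>x. (w f x - c w t)\<^sup>2)"
      using that by (intro face_integral_cong face_borel[OF f(1)]) (auto simp: constant_lifting_def frontier_def)
    also have "\<dots> = ?I f + face_measure f * (face_average f (w f) - c w t)\<^sup>2"
      by (rule face_integral_about_average[OF f(1) boundary_space_component[OF w that(2)] face_measure_pos[OF x f(1)]])
    finally have "?J t f = inverse (diameter t) * ?I f + (inverse (diameter t) * face_measure f) * (face_average f (w f) - c w t)\<^sup>2"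
      by (simp add: distrib_left mult.assoc)
    also have "\<dots> \<le> inverse (diameter f) * ?I f + ?W * E f"
    proof (rule add_mono)
      have "0 < \<beta> * h" using \<beta>_pos h_pos[OF that(1)] by simp
      then have "0 < diameter f" using face_diameter_ge[OF f(1)] by linarith
      then show "inverse (diameter t) * ?I f \<le> inverse (diameter f) * ?I f"
        using cell_face_diameter_le[OF that(1) f(2)]
        by (intro mult_right_mono le_imp_inverse_le face_integral_nonneg) auto
      show "(inverse (diameter t) * face_measure f) * (face_average f (w f) - c w t)\<^sup>2 \<le> ?W * E f"
      proof (rule mult_mono[OF weight[OF that(1) f(1)] near[OF that(2,1,3)]])
        show "0 \<le> ?W" using \<rho>_pos h_pos[OF that(1)] by simp
      qed simp
    qed
    finally show ?thesis .
  qed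
  have interior: "?J t f \<le> ?W * V t" if "t \<in> \<T>" "f \<in> cell_faces \<F> t - ?B" for t f
  proof -
    have f: "f \<in> \<F>" "f \<subseteq> frontier t" "f \<notin> ?B" using that by (auto simp: cell_faces_def)
    let ?s = "SOME t. t \<in> \<T> \<and> f \<subseteq> frontier t"
    have s: "?s \<in> \<T> \<and> f \<subseteq> frontier ?s" using that(1) f(2) by (intro someI[of "\<lambda>t. t \<in> \<T> \<and> f \<subseteq> frontier t" t]) simp
    have "face_integral f (\<lambda>x. (snd ?L f x - fst ?L t x)\<^sup>2) = face_integral f (\<lambda>_. (c w ?s - c w t)\<^sup>2)"
    proof (rule face_integral_cong[OF face_borel[OF f(1)]])
      fix y assume "y \<in> f"
      then have "y \<in> closure f" "y \<in> closure t" using f(2) closure_subset by (auto simp: frontier_def)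
      then show "(snd ?L f y - fst ?L t y)\<^sup>2 = (c w ?s - c w t)\<^sup>2"
        using f that(1) by (simp add: constant_lifting_def)
    qed
    then have "?J t f = (inverse (diameter t) * face_measure f) * (c w ?s - c w t)\<^sup>2"
      by (simp add: face_integral_const[OF f(1)])
    also have "\<dots> \<le> ?W * V t"
    proof (rule mult_mono)
      have "frontier t \<inter> frontier ?s \<noteq> {}" using f(2) s face_nonempty[OF f(1)] by blast
      then show "(c w ?s - c w t)\<^sup>2 \<le> V t" using s that(1) by (intro step) auto
    qed (use weight[OF that(1) f(1)] \<rho>_pos h_pos[OF that(1)] in auto)
    finally show ?thesis .
  qed
  have V0: "0 \<le> V t" if "t \<in> \<T>" for t
  proof -
    have "frontier t \<noteq> {}"
      using frontier_eq_empty[of t] cell_nonempty[OF that] cell_bounded[OF that] not_bounded_UNIV by auto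
    then have "frontier t \<inter> frontier t \<noteq> {}" by simp
    from step[OF that that this] show ?thesis by simp
  qed
  have cell: "set_lebesgue_integral lborel t (\<lambda>x. (norm (gradient (fst ?L t) x))\<^sup>2) + (\<Sum>f\<in>cell_faces \<F> t. ?J t f)
      \<le> (\<Sum>f\<in>{f\<in>?B. f \<subseteq> frontier t}. ?G f) + ?W * ?N * V t" if t: "t \<in> \<T>" for t
  proof -
    have "set_lebesgue_integral lborel t (\<lambda>x. (norm (gradient (fst ?L t) x))\<^sup>2) = set_lebesgue_integral lborel t (\<lambda>x. 0)"
    proof (rule set_lebesgue_integral_cong)
      show "t \<in> sets lborel" using cell_open[OF t] by simp
      have "gradient (fst ?L t) x = 0" if "x \<in> t" for x
        using t closure_subset by (intro gradient_locally_constant[OF cell_open[OF t] that, of _ "c w t"]) (auto simp: constant_lifting_def)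
      then show "\<forall>x. x \<in> t \<longrightarrow> (norm (gradient (fst ?L t) x))\<^sup>2 = 0" by simp
    qed
    then have grad: "set_lebesgue_integral lborel t (\<lambda>x. (norm (gradient (fst ?L t) x))\<^sup>2) = 0" by simp
    have sub: "{f\<in>?B. f \<subseteq> frontier t} \<subseteq> cell_faces \<F> t" by (auto simp: cell_faces_def boundary_faces_def)
    have eq: "cell_faces \<F> t - {f\<in>?B. f \<subseteq> frontier t} = cell_faces \<F> t - ?B" by (auto simp: cell_faces_def)
    have "(\<Sum>f\<in>cell_faces \<F> t. ?J t f) = (\<Sum>f\<in>cell_faces \<F> t - ?B. ?J t f) + (\<Sum>f\<in>{f\<in>?B. f \<subseteq> frontier t}. ?J t f)"
      using sum.subset_diff[OF sub finite_cell_faces, of "?J t"] eq by simp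
    also have "\<dots> \<le> (\<Sum>f\<in>cell_faces \<F> t - ?B. ?W * V t) + (\<Sum>f\<in>{f\<in>?B. f \<subseteq> frontier t}. ?G f)"
      by (intro add_mono sum_mono interior boundary t) auto
    also have "(\<Sum>f\<in>cell_faces \<F> t - ?B. ?W * V t) = real (card (cell_faces \<F> t - ?B)) * (?W * V t)" by simp
    also have "\<dots> \<le> ?N * (?W * V t)"
    proof (rule mult_right_mono)
      have "card (cell_faces \<F> t - ?B) \<le> card (cell_faces \<F> t)" using finite_cell_faces by (intro card_mono) auto
      then show "real (card (cell_faces \<F> t - ?B)) \<le> ?N" using card_cell_faces_le[OF t] by linarith
      show "0 \<le> ?W * V t" using V0[OF t] \<rho>_pos h_pos[OF t] by simp
    qed
    finally show ?thesis using grad by (simp add: mult.assoc mult.left_commute)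
  qed
  have "(seminorm_1h \<T> \<F> ?L)\<^sup>2 = (\<Sum>t\<in>\<T>. set_lebesgue_integral lborel t (\<lambda>x. (norm (gradient (fst ?L t) x))\<^sup>2) + (\<Sum>f\<in>cell_faces \<F> t. ?J t f))"
    unfolding seminorm_1h_def
  proof (rule real_sqrt_pow2)
    show "0 \<le> (\<Sum>t\<in>\<T>. set_lebesgue_integral lborel t (\<lambda>x. (norm (gradient (fst ?L t) x))\<^sup>2) + (\<Sum>f\<in>cell_faces \<F> t. ?J t f))"
    proof (intro sum_nonneg add_nonneg_nonneg mult_nonneg_nonneg face_integral_nonneg)
      fix t assume "t \<in> \<T>"
      then show "0 \<le> inverse (diameter t)" using cell_diameter_pos[of t] by simp
      show "0 \<le> set_lebesgue_integral lborel t (\<lambda>x. (norm (gradient (fst ?L t) x))\<^sup>2)"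
        unfolding set_lebesgue_integral_def by (intro integral_nonneg_AE) auto
    qed auto
  qed
  also have "\<dots> \<le> (\<Sum>t\<in>\<T>. (\<Sum>f\<in>{f\<in>?B. f \<subseteq> frontier t}. ?G f) + ?W * ?N * V t)"
    by (intro sum_mono cell)
  also have "\<dots> = (\<Sum>f\<in>?B. ?G f) + ?W * ?N * (\<Sum>t\<in>\<T>. V t)"
    unfolding sum.distrib sum_distrib_left[symmetric]
    by (simp only: sum_over_unique_index[OF finite_cells finite_boundary_faces card_cells_of_boundary_face])
  also have "(\<Sum>f\<in>?B. ?G f) = (\<Sum>f\<in>?B. inverse (diameter f) * ?I f) + ?W * (\<Sum>f\<in>?B. E f)"
    by (simp only: sum.distrib sum_distrib_left)
  finally show ?thesis by (simp only: distrib_left mult.assoc add.assoc)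
qed

text \<open>
  The constants of the lifting are the averaging extension of the boundary averages.  Both discrete estimates
  produce \<open>h ^ d\<close> times the sum of \<open>\<bar>a\<^sub>f - a\<^sub>f'\<bar>\<^sup>2 / \<bar>x\<^sub>f - x\<^sub>f'\<bar> ^ d\<close>; with the factor \<open>h ^ (d - 2)\<close> of a jump term this is
  \<open>h ^ (2 (d - 1))\<close>, which the product of two face measures dominates.
\<close>
lemma bounded_lifting_exists:
  assumes reg: "lower_regular (DIM('a) - 1) c (2 * diameter (closure \<Omega>) + 1) (frontier \<Omega>)" and c: "0 < c"
    and cent: "face_centroids \<delta> \<F> x" and \<delta>: "0 < \<delta>"
  shows "\<exists>L. linear_operator_on (boundary_space k \<Omega> \<F>) (hybrid_space k \<T> \<F>) L \<and>
    (\<forall>w\<in>boundary_space k \<Omega> \<F>.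
       seminorm_1h \<T> \<F> (L w) \<le> lifting_constant DIM('a) \<beta> \<rho> \<delta> c * seminorm_half_h \<Omega> \<F> x w) \<and>
    (\<forall>w\<in>boundary_space k \<Omega> \<F>. boundary_trace \<Omega> \<F> (L w) = w)"
proof (cases "boundary_faces \<Omega> \<F> = {}")
  case True
  \<comment> \<open>This happens for the empty domain only, whose mesh is empty.\<close>
  let ?L = "constant_lifting \<Omega> \<T> \<F> (\<lambda>_ _. 0)"
  have "linear_operator_on (boundary_space k \<Omega> \<F>) (hybrid_space k \<T> \<F>) ?L"
    by (rule constant_lifting_linear) simp
  moreover have "seminorm_1h \<T> \<F> (?L w) \<le> lifting_constant DIM('a) \<beta> \<rho> \<delta> c * seminorm_half_h \<Omega> \<F> x w"
    if "w \<in> boundary_space k \<Omega> \<F>" for w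
  proof -
    have "(seminorm_1h \<T> \<F> (?L w))\<^sup>2 \<le> 0"
      using seminorm_constant_lifting_le[OF that cent \<delta>, of "\<lambda>_ _. 0" "\<lambda>_. 0" "\<lambda>_. 0"] True by simp
    then have "seminorm_1h \<T> \<F> (?L w) = 0" by simp
    then show ?thesis using True by (simp add: seminorm_half_h_def)
  qed
  ultimately show ?thesis using boundary_trace_constant_lifting[of _ k \<Omega> \<F> \<T> "\<lambda>_ _. 0"] by blast
next
  case False
  let ?B = "boundary_faces \<Omega> \<F>" and ?m = "DIM('a) - 1"
  let ?A = "((1 + \<beta>) / \<beta>) ^ DIM('a)" and ?R1 = "2 * diameter (closure \<Omega>) + 1"
  have x: "x f \<in> f" if "f \<in> \<F>" for f using cent that by (simp add: face_centroids_def)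
  have F: "f \<in> \<F>" if "f \<in> ?B" for f using that by (simp add: boundary_faces_def)
  interpret S: boundary_sampling \<T> ?B cell_point x h ?R1 ?A c ?m
    by (rule mesh_boundary_sampling[OF reg c x False])
  define a where "a w f = face_average f (w f)" for w :: "'a set \<Rightarrow> 'a \<Rightarrow> real" and f
  define v where "v w t = S.extension (a w) t" for w t
  let ?L = "constant_lifting \<Omega> \<T> \<F> v"
  have h: "0 < h" by (rule S.h_pos)
  have suc: "Suc ?m = DIM('a)" by simp
  have "v (lin_comb \<alpha> w \<gamma> w') t = \<alpha> * v w t + \<gamma> * v w' t"
    if w: "w \<in> boundary_space k \<Omega> \<F>" "w' \<in> boundary_space k \<Omega> \<F>" for w w' \<alpha> \<gamma> t
  proof -
    have "a (lin_comb \<alpha> w \<gamma> w') f = \<alpha> * a w f + \<gamma> * a w' f" if "f \<in> ?B" for f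
      using face_average_lin[OF F[OF that] boundary_space_component[OF w(1) that] boundary_space_component[OF w(2) that]]
      by (simp add: a_def lin_comb_def)
    then have "v (lin_comb \<alpha> w \<gamma> w') t = weighted_mean ?B (S.weight t) (\<lambda>f. \<alpha> * a w f + \<gamma> * a w' f)"
      unfolding v_def S.extension_def weighted_mean_def by simp
    then show ?thesis unfolding v_def S.extension_def by (simp only: weighted_mean_linear)
  qed
  then have lin: "linear_operator_on (boundary_space k \<Omega> \<F>) (hybrid_space k \<T> \<F>) ?L"
    by (rule constant_lifting_linear)
  have bound: "seminorm_1h \<T> \<F> (?L w) \<le> lifting_constant DIM('a) \<beta> \<rho> \<delta> c * seminorm_half_h \<Omega> \<F> x w"
    if w: "w \<in> boundary_space k \<Omega> \<F>" for w
  proof -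
    define C1 where "C1 = 4 * 3 ^ (?m + 2) / c"
    define C2 where "C2 = (2 * real (?m + 2) * 9 ^ (?m + 2))\<^sup>2 * (2 ^ (2 * ?m + 5) * ?A * (3 ^ (?m + 2) / c)\<^sup>2)"
    define N where "N = (1 / \<beta>) ^ DIM('a) * real (Suc DIM('a))"
    define \<kappa> where "\<kappa> = (2 * \<delta> * \<beta> / DIM('a)) ^ ?m"
    define K where "K = \<rho> * 2 ^ ?m * (C1 + N * C2)"
    have pos: "0 \<le> N" "0 < \<kappa>" "0 \<le> K"
      using \<beta>_pos \<delta> c \<rho>_pos by (auto simp: N_def \<kappa>_def K_def C1_def C2_def)
    let ?I = "\<Sum>f\<in>?B. inverse (diameter f) * face_integral f (\<lambda>y. (w f y - face_average f (w f))\<^sup>2)"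
    let ?P = "\<lambda>f. \<Sum>f'\<in>?B - {f}. (a w f - a w f')\<^sup>2 / dist (x f) (x f') ^ Suc ?m"
    let ?Q = "\<Sum>f\<in>?B. \<Sum>f'\<in>?B - {f}. face_measure f * face_measure f' *
                (\<bar>face_average f (w f) - face_average f' (w f')\<bar>\<^sup>2 / dist (x f) (x f') ^ DIM('a))"
    have near: "(face_average f (w f) - v w t)\<^sup>2 \<le> C1 * h ^ Suc ?m * ?P f"
      if "f \<in> ?B" "t \<in> \<T>" "f \<subseteq> frontier t" for f t
    proof -
      have "x f \<in> closure t" using x[OF F[OF that(1)]] that(3) by (auto simp: frontier_def)
      moreover have "cell_point t \<in> closure t" using cell_point_in[OF that(2)] closure_subset by blast
      ultimately have "dist (cell_point t) (x f) \<le> h" by (intro dist_in_closure_cell[OF that(2)])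
      from S.extension_near_boundary[OF that(2,1) this, of "a w"]
      show ?thesis by (simp only: C1_def v_def a_def)
    qed
    have step: "(v w t' - v w t)\<^sup>2 \<le> S.variation (a w) t"
      if "t \<in> \<T>" "t' \<in> \<T>" "frontier t \<inter> frontier t' \<noteq> {}" for t t'
    proof -
      from that(3) obtain y where "y \<in> closure t" "y \<in> closure t'" by (auto simp: frontier_def)
      moreover have "cell_point t \<in> closure t" "cell_point t' \<in> closure t'"
        using cell_point_in[OF that(1)] cell_point_in[OF that(2)] closure_subset by blast+
      ultimately have "dist (cell_point t) y \<le> h" "dist y (cell_point t') \<le> h"
        by (auto intro: dist_in_closure_cell[OF that(1)] dist_in_closure_cell[OF that(2)])
      then have "dist (cell_point t) (cell_point t') \<le> 2 * h"
        using dist_triangle[of "cell_point t" "cell_point t'" y] by linarith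
      then show ?thesis unfolding v_def by (rule S.extension_neighbour)
    qed
    have V: "(\<Sum>t\<in>\<T>. S.variation (a w) t) \<le> C2 * h ^ Suc ?m * (\<Sum>f\<in>?B. ?P f)"
      unfolding C2_def by (rule S.sum_variation_le)
    have pair: "h ^ (2 * ?m) * ((a w f - a w f')\<^sup>2 / dist (x f) (x f') ^ Suc ?m)
        \<le> face_measure f * face_measure f' * (\<bar>face_average f (w f) - face_average f' (w f')\<bar>\<^sup>2 / dist (x f) (x f') ^ DIM('a)) / \<kappa>\<^sup>2"
      if "f \<in> ?B" "f' \<in> ?B" for f f'
    proof -
      have m: "\<kappa> * h ^ ?m \<le> face_measure g" if "g \<in> ?B" for g
        unfolding \<kappa>_def by (rule face_measure_ge[OF cent \<delta> F[OF that]])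
      have "(\<kappa> * h ^ ?m) * (\<kappa> * h ^ ?m) \<le> face_measure f * face_measure f'"
        using pos h by (intro mult_mono m that) (auto simp: face_measure_def)
      then have "h ^ (2 * ?m) \<le> face_measure f * face_measure f' / \<kappa>\<^sup>2"
        using pos by (simp only: pos_le_divide_eq zero_less_power mult_2 power_add) (simp add: power2_eq_square ac_simps)
      then have "h ^ (2 * ?m) * ((a w f - a w f')\<^sup>2 / dist (x f) (x f') ^ Suc ?m)
          \<le> (face_measure f * face_measure f' / \<kappa>\<^sup>2) * ((a w f - a w f')\<^sup>2 / dist (x f) (x f') ^ Suc ?m)"
        by (intro mult_right_mono) auto
      then show ?thesis unfolding suc a_def power2_abs times_divide_eq_left .
    qed
    have "h ^ (2 * ?m) * (\<Sum>f\<in>?B. ?P f) \<le> ?Q / \<kappa>\<^sup>2"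
      unfolding sum_distrib_left sum_divide_distrib by (intro sum_mono pair) auto
    then have PQ: "K * (h ^ (2 * ?m) * (\<Sum>f\<in>?B. ?P f)) \<le> K * (?Q / \<kappa>\<^sup>2)"
      using pos by (intro mult_left_mono) auto
    have I: "0 \<le> ?I"
      using diameter_ge_0[OF face_bounded[OF F]]
      by (intro sum_nonneg mult_nonneg_nonneg face_integral_nonneg) auto
    have Q: "0 \<le> ?Q" by (intro sum_nonneg) (auto simp: face_measure_def)
    have "(seminorm_1h \<T> \<F> (?L w))\<^sup>2 \<le> ?I + \<rho> / h * (2 * h) ^ ?m *
         ((\<Sum>f\<in>?B. C1 * h ^ Suc ?m * ?P f) + N * (\<Sum>t\<in>\<T>. S.variation (a w) t))"
      unfolding N_def by (rule seminorm_constant_lifting_le[where c = v, OF w cent \<delta> near step])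
    also have "\<dots> \<le> ?I + \<rho> / h * (2 * h) ^ ?m *
         (C1 * h ^ Suc ?m * (\<Sum>f\<in>?B. ?P f) + N * (C2 * h ^ Suc ?m * (\<Sum>f\<in>?B. ?P f)))"
      unfolding sum_distrib_left[symmetric] using pos h \<rho>_pos
      by (intro add_mono order_refl mult_left_mono V) auto
    also have "\<dots> = ?I + K * (h ^ (2 * ?m) * (\<Sum>f\<in>?B. ?P f))"
    proof -
      have eq: "\<rho> / h * (2 * h) ^ m * (C1 * h ^ Suc m * P + N * (C2 * h ^ Suc m * P))
          = \<rho> * 2 ^ m * (C1 + N * C2) * (h ^ (2 * m) * P)" for m P
        unfolding mult_2[of m] power_add power_mult_distrib using h by (simp add: field_simps)
      show ?thesis unfolding K_def by (simp only: eq)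
    qed
    also have "\<dots> \<le> ?I + K / \<kappa>\<^sup>2 * ?Q" using PQ by simp
    also have "\<dots> \<le> (1 + K / \<kappa>\<^sup>2) * (?I + ?Q)"
      using I Q pos by (simp add: algebra_simps)
    finally have "seminorm_1h \<T> \<F> (?L w) \<le> sqrt ((1 + K / \<kappa>\<^sup>2) * (?I + ?Q))"
      by (rule real_le_rsqrt)
    also have "\<dots> = sqrt (1 + K / \<kappa>\<^sup>2) * seminorm_half_h \<Omega> \<F> x w"
      unfolding seminorm_half_h_def by (rule real_sqrt_mult)
    also have "sqrt (1 + K / \<kappa>\<^sup>2) = lifting_constant DIM('a) \<beta> \<rho> \<delta> c"
      unfolding lifting_constant_def Let_def K_def C1_def C2_def N_def \<kappa>_def ..
    finally show ?thesis .
  qed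
  show ?thesis using lin bound boundary_trace_constant_lifting[of _ k \<Omega> \<F> \<T> v] by blast
qed

end

theorem theorem2p3:
  fixes \<Omega> :: "'a::euclidean_space set" and k :: nat and \<theta> \<rho> \<delta> :: real
  assumes "DIM('a) \<ge> 2"
    and "polytopal_domain \<Omega>"
    and "0 < \<theta>" and "\<theta> < 1" and "0 < \<rho>" and "0 < \<delta>"
  shows "\<exists>C>0. \<forall>\<T> \<F> x.
           hybrid_mesh \<Omega> \<T> \<F> \<longrightarrow> regular_mesh \<theta> \<Omega> \<T> \<F> \<longrightarrow> quasi_uniform \<rho> \<T> \<longrightarrow>
           face_centroids \<delta> \<F> x \<longrightarrow>
           (\<exists>L. linear_operator_on (boundary_space k \<Omega> \<F>) (hybrid_space k \<T> \<F>) L \<and>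
                (\<forall>w\<in>boundary_space k \<Omega> \<F>.
                   seminorm_1h \<T> \<F> (L w) \<le> C * seminorm_half_h \<Omega> \<F> x w) \<and>
                (\<forall>w\<in>boundary_space k \<Omega> \<F>. boundary_trace \<Omega> \<F> (L w) = w))"
proof -
  obtain \<S> where \<S>: "finite \<S>" "\<forall>S\<in>\<S>. int (DIM('a) - 1) simplex S" "frontier \<Omega> = \<Union>\<S>"
    using assms(2) unfolding polytopal_domain_def by blast
  have "bounded (closure \<Omega>)" using assms(2) unfolding polytopal_domain_def by (intro bounded_closure) blast
  then have "0 < 2 * diameter (closure \<Omega>) + 1" using diameter_ge_0[of "closure \<Omega>"] by linarith
  from polytopal_lower_regular[OF \<S>(1,2) this]
  obtain c where c: "0 < c" "lower_regular (DIM('a) - 1) c (2 * diameter (closure \<Omega>) + 1) (frontier \<Omega>)"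
    unfolding \<S>(3) by blast
  let ?C = "lifting_constant DIM('a) (\<theta>\<^sup>2 / (2 * \<rho>)) \<rho> \<delta> c"
  have "0 < ?C" using assms c(1) by (intro lifting_constant_pos) auto
  moreover have "\<exists>L. linear_operator_on (boundary_space k \<Omega> \<F>) (hybrid_space k \<T> \<F>) L \<and>
                (\<forall>w\<in>boundary_space k \<Omega> \<F>.
                   seminorm_1h \<T> \<F> (L w) \<le> ?C * seminorm_half_h \<Omega> \<F> x w) \<and>
                (\<forall>w\<in>boundary_space k \<Omega> \<F>. boundary_trace \<Omega> \<F> (L w) = w)"
    if mesh: "hybrid_mesh \<Omega> \<T> \<F>" and reg: "regular_mesh \<theta> \<Omega> \<T> \<F>" and uni: "quasi_uniform \<rho> \<T>"
      and cent: "face_centroids \<delta> \<F> x" for \<T> \<F> x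
  proof -
    from reg obtain \<SS> where \<SS>: "conforming_simplicial_mesh \<Omega> \<SS>"
        "\<forall>\<tau>\<in>\<SS>. \<exists>!t. t \<in> \<T> \<and> interior \<tau> \<subseteq> t"
        "\<forall>\<tau>\<in>\<SS>. \<forall>\<sigma>. \<sigma> facet_of \<tau> \<longrightarrow> (\<forall>f\<in>\<F>. rel_interior \<sigma> \<subseteq> f \<or> disjnt (rel_interior \<sigma>) f)"
        "\<forall>\<tau>\<in>\<SS>. \<theta> * diameter \<tau> \<le> inradius \<tau>"
        "\<forall>\<tau>\<in>\<SS>. \<forall>t\<in>\<T>. interior \<tau> \<subseteq> t \<longrightarrow> \<theta> * diameter t \<le> diameter \<tau>"
      unfolding regular_mesh_def by - (elim exE conjE, rule that)
    interpret refined_mesh \<Omega> \<T> \<F> \<SS> \<theta> \<rho>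
    proof (rule refined_mesh.intro)
      show "\<exists>!t. t \<in> \<T> \<and> interior \<tau> \<subseteq> t" if "\<tau> \<in> \<SS>" for \<tau>
        by (rule bspec[OF \<SS>(2) that])
      show "rel_interior \<sigma> \<subseteq> f \<or> disjnt (rel_interior \<sigma>) f" if "\<tau> \<in> \<SS>" "\<sigma> facet_of \<tau>" "f \<in> \<F>" for \<tau> \<sigma> f
        using \<SS>(3) that by blast
      show "\<theta> * diameter \<tau> \<le> inradius \<tau>" if "\<tau> \<in> \<SS>" for \<tau>
        by (rule bspec[OF \<SS>(4) that])
      show "\<theta> * diameter t \<le> diameter \<tau>" if "\<tau> \<in> \<SS>" "t \<in> \<T>" "interior \<tau> \<subseteq> t" for \<tau> t
        using \<SS>(5) that by blast
    qed (fact assms mesh \<SS>(1) uni)+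
    show ?thesis using bounded_lifting_exists[OF c(2,1) cent assms(6), of k] unfolding \<beta>_def .
  qed
  ultimately show ?thesis by blast
qed

end
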